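(* The product of polymorphisms is separately continuous. That is, for Lebesgue spaces $(A,\alpha)$, $(B,\beta)$, $(C,\gamma)$: if $\mathfrak P^{(j)}\to\mathfrak P$ in $\mathrm{Pol}(A,B)$ and $\mathfrak Q\in\mathrm{Pol}(B,C)$, then $\mathfrak Q\circ\mathfrak P^{(j)}\to\mathfrak Q\circ\mathfrak P$ in $\mathrm{Pol}(A,C)$; and if $\mathfrak Q^{(j)}\to\mathfrak Q$ in $\mathrm{Pol}(B,C)$ and $\mathfrak P\in\mathrm{Pol}(A,B)$, then $\mathfrak Q^{(j)}\circ\mathfrak P\to\mathfrak Q\circ\mathfrak P$ in $\mathrm{Pol}(A,C)$.
   Context: A Lebesgue space $(A,\alpha)$ is a space with a finite positive measure, $\alpha(A)>0$, isomorphic to a disjoint union of a finite (possibly empty) segment with Lebesgue measure and an at most countable collection of atoms. $\mathbb R^\times$ is the multiplicative group of positive reals, with coordinate $t$. $\mathcal M^{\triangledown}$ is the set of positive measures $\mu$ on $\mathbb R^\times$ with $\int d\mu<\infty$ and $\int t\,d\mu(t)<\infty$; it is closed under addition and under the convolution $\int f\,d(\mu*\nu)=\iint f(s_1s_2)\,d\mu(s_1)\,d\nu(s_2)$. A sequence $\mu_j$ converges to $\mu$ in $\mathcal M^{\triangledown}$ if $\mu_j\to\mu$ and $t\mu_j\to t\mu$ weakly, i.e. $\int f\,d\mu_j\to\int f\,d\mu$ and $\int tf(t)\,d\mu_j(t)\to\int tf(t)\,d\mu(t)$ for every bounded continuous $f$ on $\mathbb R^\times$. A polymorphism from $(A,\alpha)$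 to $(B,\beta)$ is a measure $\mathfrak P$ on $A\times B\times\mathbb R^\times$ such that the image of $\mathfrak P$ under the projection to $A$ is $\alpha$ and the image of $t\cdot\mathfrak P$ under the projection to $B$ is $\beta$. $\mathrm{Pol}(A,B)$ is the set of all polymorphisms. For measurable $M\subset A$, $N\subset B$, $\mathfrak p[M\times N]\in\mathcal M^{\triangledown}$ is the image of the restriction of $\mathfrak P$ to $M\times N\times\mathbb R^\times$ under the projection to $\mathbb R^\times$; similarly $\mathfrak q[\cdot]$ for $\mathfrak Q$, etc. A sequence $\mathfrak P^{(j)}\in\mathrm{Pol}(A,B)$ converges to $\mathfrak P\in\mathrm{Pol}(A,B)$ if $\mathfrak p^{(j)}[M\times N]\to\mathfrak p[M\times N]$ in $\mathcal M^{\triangledown}$ for all measurable $M\subset A$, $N\subset B$. Product. Let $\mathfrak P\in\mathrm{Pol}(A,B)$, $\mathfrak Q\in\mathrm{Pol}(B,C)$. For measurable $M\subset A$ and $K\subset C$ there are measures $\mathfrak p_{M,b}$, $\mathfrak q_{b,K}\in\mathcal M^{\triangledown}$, defined for $\beta$-almost all $b\in B$, such that for every measurable $N\subset B$ one has $\mathfrak p[M\times N]=\int_N\mathfrak p_{M,b}\,d\beta(b)$ and $\mathfrak q[N\times K]=\int_N\mathfrak q_{b,K}\,d\beta(b)$. The product $\mathfrak R=\mathfrak Q\circ\mathfrak P\in\mathrm{Pol}(A,C)$ is the (well-defined) polymorphism determined by $\mathfrak r[M\times K]=\int_B\mathfrak q_{b,K}*\mathfrak p_{M,b}\,d\beta(b)$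 for all measurable $M\subset A$, $K\subset C$. *)

theory Defs
  imports "HOL-Analysis.Analysis"
begin

section \<open>Lebesgue spaces\<close>

text \<open>
  The disjoint union of the segment \<open>{0..c}\<close> with Lebesgue measure and of atoms \<open>i \<in> I\<close> of
  weight \<open>w i\<close>. The segment is empty when \<open>c < 0\<close>.
\<close>

definition standard_lebesgue_space :: "real \<Rightarrow> nat set \<Rightarrow> (nat \<Rightarrow> real) \<Rightarrow> (real + nat) measure" where
  "standard_lebesgue_space c I w =
     measure_of ({0..c} <+> I)
       {X. X \<subseteq> {0..c} <+> I \<and> Inl -` X \<in> sets lebesgue}
       (\<lambda>X. emeasure lebesgue (Inl -` X) + (\<integral>\<^sup>+ i. ennreal (w i) \<partial>count_space (Inr -` X)))"

text \<open>The two lemmas below show that \<^const>\<open>measure_of\<close> does not degenerate here.\<close>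

lemma sigma_algebra_standard_lebesgue_space:
  "sigma_algebra ({0..c} <+> I)
     {X :: (real + nat) set. X \<subseteq> {0..c} <+> I \<and> Inl -` X \<in> sets lebesgue}"
proof -
  have vimage_Compl: "Inl -` (({0..c} <+> I) - X) = {0..c} - Inl -` X" for X :: "(real + nat) set"
    by auto
  show ?thesis
    unfolding sigma_algebra_iff2
    by (auto simp: vimage_Compl vimage_UN intro!: sets.Diff)
qed

lemma
  shows space_standard_lebesgue_space:
      "space (standard_lebesgue_space c I w) = {0..c} <+> I"
    and sets_standard_lebesgue_space:
      "sets (standard_lebesgue_space c I w) =
         {X. X \<subseteq> {0..c} <+> I \<and> Inl -` X \<in> sets lebesgue}"
    and emeasure_standard_lebesgue_space:
      "X \<in> sets (standard_lebesgue_space c I w) \<Longrightarrow>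
         emeasure (standard_lebesgue_space c I w) X =
           emeasure lebesgue (Inl -` X) + (\<integral>\<^sup>+ i. ennreal (w i) \<partial>count_space (Inr -` X))"
proof -
  let ?S = "{X :: (real + nat) set. X \<subseteq> {0..c} <+> I \<and> Inl -` X \<in> sets lebesgue}"
  let ?f = "\<lambda>X :: (real + nat) set.
    emeasure lebesgue (Inl -` X) + (\<integral>\<^sup>+ i. ennreal (w i) \<partial>count_space (Inr -` X))"
  note sa = sigma_algebra_standard_lebesgue_space[of c I]
  have sub: "?S \<subseteq> Pow ({0..c} <+> I)"
    by auto
  show "space (standard_lebesgue_space c I w) = {0..c} <+> I"
    unfolding standard_lebesgue_space_def by (rule space_measure_of[OF sub])
  show sets: "sets (standard_lebesgue_space c I w) = ?S"
    unfolding standard_lebesgue_space_def sets_measure_of[OF sub]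
    by (rule sigma_algebra.sigma_sets_eq[OF sa])
  have eq: "(\<integral>\<^sup>+ i. ennreal (w i) \<partial>count_space (Inr -` X)) =
      emeasure (density (count_space UNIV) (\<lambda>i. ennreal (w i))) (Inr -` X)"
    for X :: "(real + nat) set"
    by (subst emeasure_density) (simp_all add: nn_integral_count_space_indicator)
  have ca: "countably_additive ?S ?f"
    unfolding countably_additive_def
  proof (intro allI impI)
    fix F :: "nat \<Rightarrow> (real + nat) set"
    assume F: "range F \<subseteq> ?S" "disjoint_family F" "(\<Union>i. F i) \<in> ?S"
    let ?D = "density (count_space UNIV) (\<lambda>i. ennreal (w i))"
    have dl: "disjoint_family (\<lambda>i. Inl -` F i)" and dr: "disjoint_family (\<lambda>i. Inr -` F i)"
      using F(2) by (auto simp: disjoint_family_on_def)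
    have "(\<Sum>i. emeasure lebesgue (Inl -` F i)) = emeasure lebesgue (\<Union>i. Inl -` F i)"
      using F(1) dl by (intro suminf_emeasure) auto
    moreover have "(\<Sum>i. emeasure ?D (Inr -` F i)) = emeasure ?D (\<Union>i. Inr -` F i)"
      using dr by (intro suminf_emeasure) auto
    ultimately show "(\<Sum>i. ?f (F i)) = ?f (\<Union>i. F i)"
      unfolding eq by (simp add: suminf_add[symmetric] vimage_UN)
  qed
  have pos: "positive ?S ?f"
    by (simp add: positive_def nn_integral_empty)
  show "emeasure (standard_lebesgue_space c I w) X = ?f X"
    if "X \<in> sets (standard_lebesgue_space c I w)"
    using that unfolding sets unfolding standard_lebesgue_space_def
    by (intro emeasure_measure_of_sigma[OF sa pos ca])
qed

text \<open>Isomorphism of measure spaces up to null sets (isomorphism mod 0).\<close>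

definition isomorphic_mod0 :: "'a measure \<Rightarrow> 'b measure \<Rightarrow> bool" where
  "isomorphic_mod0 M N \<longleftrightarrow>
     (\<exists>S\<in>null_sets M. \<exists>T\<in>null_sets N. \<exists>f.
        let M' = restrict_space M (space M - S); N' = restrict_space N (space N - T) in
          bij_betw f (space M') (space N') \<and>
          f \<in> M' \<rightarrow>\<^sub>M N' \<and>
          the_inv_into (space M') f \<in> N' \<rightarrow>\<^sub>M M' \<and>
          distr M' N' f = N')"

text \<open>
  The completion makes the notion insensitive to whether a space is presented with its Borel
  or its Lebesgue \<open>\<sigma>\<close>-algebra.
\<close>

definition lebesgue_space :: "'a measure \<Rightarrow> bool" where
  "lebesgue_space M \<longleftrightarrow>
     finite_measure M \<and> emeasure M (space M) > 0 \<and>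
     (\<exists>c I w. (\<forall>i\<in>I. w i > 0) \<and>
        isomorphic_mod0 (completion M) (standard_lebesgue_space c I w))"


section \<open>Measures on the multiplicative group of positive reals\<close>

definition rpos :: "real measure" where
  "rpos = restrict_space borel {0<..}"

definition mtri :: "real measure set" where
  "mtri = {\<mu>. sets \<mu> = sets rpos \<and>
              emeasure \<mu> (space \<mu>) < \<infinity> \<and> (\<integral>\<^sup>+ t. ennreal t \<partial>\<mu>) < \<infinity>}"

definition mult_convolution :: "real measure \<Rightarrow> real measure \<Rightarrow> real measure" where
  "mult_convolution \<mu> \<nu> = distr (\<mu> \<Otimes>\<^sub>M \<nu>) rpos (\<lambda>(s\<^sub>1, s\<^sub>2). s\<^sub>1 * s\<^sub>2)"

definition mtri_tendsto :: "(nat \<Rightarrow> real measure) \<Rightarrow> real measure \<Rightarrow> bool" where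
  "mtri_tendsto \<mu>j \<mu> \<longleftrightarrow>
     (\<forall>j. \<mu>j j \<in> mtri) \<and> \<mu> \<in> mtri \<and>
     (\<forall>f :: real \<Rightarrow> real. continuous_on {0<..} f \<and> bounded (f ` {0<..}) \<longrightarrow>
        (\<lambda>j. \<integral>t. f t \<partial>\<mu>j j) \<longlonglongrightarrow> (\<integral>t. f t \<partial>\<mu>) \<and>
        (\<lambda>j. \<integral>t. t * f t \<partial>\<mu>j j) \<longlonglongrightarrow> (\<integral>t. t * f t \<partial>\<mu>))"

text \<open>
  \<open>\<mu> = \<integral>\<^sub>N \<kappa>\<^sub>b dB(b)\<close> for a family \<open>\<kappa>\<close> that is meaningful only for almost all \<open>b\<close>; hence
  measurability in \<open>b\<close> is required with respect to the completion of \<open>B\<close>.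
\<close>

definition is_measure_integral ::
    "'b measure \<Rightarrow> 'b set \<Rightarrow> ('b \<Rightarrow> real measure) \<Rightarrow> real measure \<Rightarrow> bool" where
  "is_measure_integral B N \<kappa> \<mu> \<longleftrightarrow>
     (AE b in B. \<kappa> b \<in> mtri) \<and> sets \<mu> = sets rpos \<and>
     (\<forall>E\<in>sets rpos.
        (\<lambda>b. emeasure (\<kappa> b) E) \<in> borel_measurable (completion B) \<and>
        emeasure \<mu> E = (\<integral>\<^sup>+ b\<in>N. emeasure (\<kappa> b) E \<partial>B))"


section \<open>Polymorphisms\<close>

definition Pol :: "'a measure \<Rightarrow> 'b measure \<Rightarrow> ('a \<times> 'b \<times> real) measure set" where
  "Pol A B =
     {P. sets P = sets (A \<Otimes>\<^sub>M B \<Otimes>\<^sub>M rpos) \<and>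
         distr P A (\<lambda>(a, b, t). a) = A \<and>
         distr (density P (\<lambda>(a, b, t). ennreal t)) B (\<lambda>(a, b, t). b) = B}"

text \<open>The measure \<open>\<pp>[M \<times> N]\<close> on the positive reals.\<close>

definition pol_block ::
    "('a \<times> 'b \<times> real) measure \<Rightarrow> 'a set \<Rightarrow> 'b set \<Rightarrow> real measure" where
  "pol_block P M N =
     distr (restrict_space P (M \<times> N \<times> {0<..})) rpos (\<lambda>(a, b, t). t)"

definition pol_tendsto ::
    "'a measure \<Rightarrow> 'b measure \<Rightarrow> (nat \<Rightarrow> ('a \<times> 'b \<times> real) measure) \<Rightarrow>
     ('a \<times> 'b \<times> real) measure \<Rightarrow> bool" where
  "pol_tendsto A B Pj P \<longleftrightarrow>
     (\<forall>j. Pj j \<in> Pol A B) \<and> P \<in> Pol A B \<and>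
     (\<forall>M\<in>sets A. \<forall>N\<in>sets B. mtri_tendsto (\<lambda>j. pol_block (Pj j) M N) (pol_block P M N))"

text \<open>
  \<open>R\<close> is the product \<open>Q \<circ> P\<close>. Here \<open>p\<close> and \<open>q\<close> are the densities \<open>b \<mapsto> \<pp>\<^bsub>M,b\<^esub>\<close> and
  \<open>b \<mapsto> \<qq>\<^bsub>b,K\<^esub>\<close>; they are determined up to null sets, so their choice is immaterial.
\<close>

definition is_pol_product ::
    "'a measure \<Rightarrow> 'b measure \<Rightarrow> 'c measure \<Rightarrow> ('b \<times> 'c \<times> real) measure \<Rightarrow>
     ('a \<times> 'b \<times> real) measure \<Rightarrow> ('a \<times> 'c \<times> real) measure \<Rightarrow> bool" where
  "is_pol_product A B C Q P R \<longleftrightarrow>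
     R \<in> Pol A C \<and>
     (\<forall>M\<in>sets A. \<forall>K\<in>sets C. \<exists>p q.
        (\<forall>N\<in>sets B. is_measure_integral B N p (pol_block P M N)) \<and>
        (\<forall>N\<in>sets B. is_measure_integral B N q (pol_block Q N K)) \<and>
        is_measure_integral B (space B) (\<lambda>b. mult_convolution (q b) (p b)) (pol_block R M K))"

definition pol_product ::
    "'a measure \<Rightarrow> 'b measure \<Rightarrow> 'c measure \<Rightarrow> ('b \<times> 'c \<times> real) measure \<Rightarrow>
     ('a \<times> 'b \<times> real) measure \<Rightarrow> ('a \<times> 'c \<times> real) measure" where
  "pol_product A B C Q P = (THE R. is_pol_product A B C Q P R)"

end

theory Submission
  imports Defs "HOL-Probability.Probability"
begin

text \<open>
  Fix measurable sets M in A and K in C. The block of the product over M and K is the mixture over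
  b of the multiplicative convolutions of the densities p of P and q of Q at b. A character
  t \<mapsto> t^(ix) of the multiplicative group turns convolution into multiplication, and so does
  t \<mapsto> t^(1 + ix), which is a character times the weight t. Hence, if the measure P restricted to M is
  pushed to B times the positive reals, the transform of the block is the integral of g(b) s^(ix)
  against this fibre measure, possibly weighted by s, where g(b) is the transform of q at b. When
  P varies and Q is fixed, g is fixed too, and the hypothesis is convergence for all g that
  are indicators of measurable sets.

  The two weights need different extensions from indicators to g. For weight 1 the
  function g is bounded by 1, because almost every density of Q has mass at most 1; uniform
  approximation by step functions suffices (lemma \<open>fibre_tendsto_bounded_test\<close>). For weight t the
  function g is only integrable, but then the weighted fibre measures all have a marginal
  on B below that of B itself, so truncation errors are uniform along the sequence
  (lemma \<open>fibre_tendsto_integrable_test\<close>). When Q varies instead, P and Q exchange roles and so do the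
  two weights. Convergence of all transforms becomes weak convergence by the Levy continuity
  theorem, applied to logarithms after normalizing the mass (lemma \<open>mellin_levy_continuity\<close>).

  The product is given by a definite description, so its existence and uniqueness are
  part of the theorem. Uniqueness holds because the densities of the blocks are determined
  almost everywhere (lemma \<open>measure_integral_density_unique\<close>). For existence, the prescribed values are
  a measure in the A- and t-variables when K is fixed, and a measure in K when the other
  variables are fixed. Such a bimeasure extends to a measure on the product space because C is a
  Lebesgue space: C can be modelled on the real line, where conditional distribution functions
  exist (lemmas \<open>bimeasure_kernel\<close> and \<open>bimeasure_extends\<close>). The same conditional distributions
  provide everywhere defined densities of the blocks (lemma \<open>disintegration\<close>).
\<close>

section \<open>Bimeasures and conditional distributions on the real line\<close>

text \<open>
  The product of two polymorphisms first appears in this form: its values on rectangles are known,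
  and so is additivity in each factor, but joint additivity is not.
\<close>

definition bimeasure :: "'x measure \<Rightarrow> 'y measure \<Rightarrow> ('x set \<Rightarrow> 'y set \<Rightarrow> ennreal) \<Rightarrow> bool" where
  "bimeasure X Y m \<longleftrightarrow>
     m (space X) (space Y) < \<infinity> \<and>
     (\<forall>E\<in>sets Y. \<exists>\<nu>. sets \<nu> = sets X \<and> (\<forall>F\<in>sets X. emeasure \<nu> F = m F E)) \<and>
     (\<forall>F\<in>sets X. \<exists>\<mu>. sets \<mu> = sets Y \<and> (\<forall>E\<in>sets Y. emeasure \<mu> E = m F E))"

lemma bimeasureE1:
  assumes "bimeasure X Y m" "E \<in> sets Y"
  obtains \<nu> where "sets \<nu> = sets X" "\<And>F. F \<in> sets X \<Longrightarrow> emeasure \<nu> F = m F E"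
  using assms unfolding bimeasure_def by blast

lemma bimeasureE2:
  assumes "bimeasure X Y m" "F \<in> sets X"
  obtains \<mu> where "sets \<mu> = sets Y" "\<And>E. E \<in> sets Y \<Longrightarrow> emeasure \<mu> E = m F E"
  using assms unfolding bimeasure_def by blast

lemma bimeasure_mono:
  assumes m: "bimeasure X Y m" and "F \<in> sets X" "F' \<in> sets X" "F \<subseteq> F'" "E \<in> sets Y" "E' \<in> sets Y" "E \<subseteq> E'"
  shows "m F E \<le> m F' E'"
proof -
  obtain \<nu> where \<nu>: "sets \<nu> = sets X" "\<And>F. F \<in> sets X \<Longrightarrow> emeasure \<nu> F = m F E"
    using bimeasureE1[OF m \<open>E \<in> sets Y\<close>] by blast
  obtain \<mu> where \<mu>: "sets \<mu> = sets Y" "\<And>E. E \<in> sets Y \<Longrightarrow> emeasure \<mu> E = m F' E"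
    using bimeasureE2[OF m \<open>F' \<in> sets X\<close>] by blast
  have "m F E \<le> m F' E"
    using emeasure_mono[of F F' \<nu>] \<nu> assms by simp
  also have "\<dots> \<le> m F' E'"
    using emeasure_mono[of E E' \<mu>] \<mu> assms by simp
  finally show ?thesis .
qed

lemma bimeasure_finite:
  assumes m: "bimeasure X Y m" and "F \<in> sets X" "E \<in> sets Y"
  shows "m F E < \<infinity>"
  using bimeasure_mono[OF m \<open>F \<in> sets X\<close> sets.top sets.sets_into_space[OF \<open>F \<in> sets X\<close>] 
     \<open>E \<in> sets Y\<close> sets.top sets.sets_into_space[OF \<open>E \<in> sets Y\<close>]] m
  unfolding bimeasure_def by (auto intro: le_less_trans)

lemma rational_decseq_above:
  fixes y :: real
  shows "\<exists>q. (\<forall>n. q n \<in> \<rat>) \<and> (\<forall>n. y < q n) \<and> q \<longlonglongrightarrow> y \<and> decseq q"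
proof -
  have "\<exists>q\<in>\<rat>. y + 1 / real (n + 2) < q \<and> q < y + 1 / real (n + 1)" for n
    by (rule Rats_dense_in_real) (simp add: field_simps)
  then obtain q where q: "\<And>n. q n \<in> \<rat>" "\<And>n. y + 1 / real (n + 2) < q n" "\<And>n. q n < y + 1 / real (n + 1)"
    by metis
  have above: "y < q n" for n using q(2)[of n] by (rule le_less_trans[rotated]) simp
  moreover have "decseq q"
  proof (rule decseq_SucI)
    show "q (Suc n) \<le> q n" for n using q(2)[of n] q(3)[of "Suc n"] by simp
  qed
  moreover have "q \<longlonglongrightarrow> y"
  proof (rule tendsto_sandwich)
    show "(\<lambda>n. y) \<longlonglongrightarrow> y" by simp
    show "(\<lambda>n. y + 1 / real (n + 1)) \<longlonglongrightarrow> y" by real_asymp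
    show "\<forall>\<^sub>F n in sequentially. y \<le> q n"
      using above by (intro always_eventually allI less_imp_le)
    show "\<forall>\<^sub>F n in sequentially. q n \<le> y + 1 / real (n + 1)"
      using q(3) by (intro always_eventually allI less_imp_le)
  qed
  ultimately show ?thesis using q(1) by blast
qed

text \<open>
  A conditional distribution function is at first available only at rational arguments, where it
  need not be right continuous. Taking the infimum over the rationals to the right of y repairs
  this. The last conclusion says that this infimum is a limit along any rational sequence
  approaching y strictly from above.
\<close>

lemma real_distribution_from_rationals:
  fixes D :: "real \<Rightarrow> real"
  assumes bounds: "\<And>r. r \<in> \<rat> \<Longrightarrow> 0 \<le> D r" "\<And>r. r \<in> \<rat> \<Longrightarrow> D r \<le> 1"
    and mono: "\<And>r s. r \<in> \<rat> \<Longrightarrow> s \<in> \<rat> \<Longrightarrow> r \<le> s \<Longrightarrow> D r \<le> D s"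
    and bot: "(\<lambda>n. D (- real n)) \<longlonglongrightarrow> 0" and top: "(\<lambda>n. D (real n)) \<longlonglongrightarrow> 1"
  defines "F \<equiv> \<lambda>y. INF r\<in>{r\<in>\<rat>. y < r}. D r"
  shows "real_distribution (interval_measure F)"
    and "emeasure (interval_measure F) {..y} = ennreal (F y)"
    and "(\<And>n. q n \<in> \<rat>) \<Longrightarrow> (\<And>n. y < q n) \<Longrightarrow> q \<longlonglongrightarrow> y \<Longrightarrow> (\<lambda>n. D (q n)) \<longlonglongrightarrow> F y"
proof -
  have ne: "\<exists>r\<in>\<rat>. y < r \<and> r < z" if "y < z" for y z :: real
    using Rats_dense_in_real[OF that] by auto
  have ne': "{r\<in>\<rat>. y < r} \<noteq> {}" for y :: real
    using ne[of y "y+1"] by auto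
  have bdd: "bdd_below (D ` {r\<in>\<rat>. y < r})" for y
    by (rule bdd_belowI[of _ 0]) (auto simp: bounds)
  have F_le: "F y \<le> D r" if "r \<in> \<rat>" "y < r" for y r
    unfolding F_def by (rule cINF_lower[OF bdd]) (use that in auto)
  have D_le: "D r \<le> F y" if "r \<in> \<rat>" "r \<le> y" for y r
    unfolding F_def by (rule cINF_greatest[OF ne']) (use that in \<open>auto intro!: mono\<close>)
  have F_less: "\<exists>r\<in>\<rat>. y < r \<and> D r < F y + e" if "e > 0" for y e
  proof (rule ccontr)
    assume "\<not> ?thesis"
    then have "F y + e \<le> F y"
      unfolding F_def by (intro cINF_greatest[OF ne']) (auto simp: not_less)
    with that show False by simp
  qed
  have F0: "0 \<le> F y" for y
    unfolding F_def by (rule cINF_greatest[OF ne']) (auto simp: bounds)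
  have F1: "F y \<le> 1" for y
    using F_le ne[of y "y+1"] bounds by (meson less_add_one order_trans)
  have Fmono: "F x \<le> F y" if "x \<le> y" for x y
    unfolding F_def by (rule cINF_superset_mono[OF ne' bdd]) (use that in auto)
  have rcont: "continuous (at_right a) F" for a
    unfolding continuous_within
  proof (rule tendstoI)
    fix e :: real assume "0 < e"
    then obtain r where r: "r \<in> \<rat>" "a < r" "D r < F a + e" using F_less by blast
    show "\<forall>\<^sub>F x in at_right a. dist (F x) (F a) < e"
      unfolding eventually_at_right[OF r(2)]
      using r F_le Fmono by (intro exI[of _ r]) (force simp: dist_real_def)
  qed
  have lim_bot: "(F \<longlongrightarrow> 0) at_bot"
  proof (rule tendstoI)
    fix e :: real assume "0 < e"
    from order_tendstoD(2)[OF bot this] obtain n where n: "D (- real n) < e"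
      by (auto simp: eventually_sequentially)
    show "\<forall>\<^sub>F x in at_bot. dist (F x) 0 < e"
      unfolding eventually_at_bot_dense
    proof (intro exI[of _ "- real n"] allI impI)
      fix x assume "x < - real n"
      then have "F x \<le> D (- real n)" by (intro F_le) auto
      then show "dist (F x) 0 < e" using n F0[of x] by simp
    qed
  qed
  have lim_top: "(F \<longlongrightarrow> 1) at_top"
  proof (rule tendstoI)
    fix e :: real assume "0 < e"
    then have "1 - e < 1" by simp
    from order_tendstoD(1)[OF top this] obtain n where n: "D (real n) > 1 - e"
      by (auto simp: eventually_sequentially)
    show "\<forall>\<^sub>F x in at_top. dist (F x) 1 < e"
      unfolding eventually_at_top_linorder
    proof (intro exI[of _ "real n"] allI impI)
      fix x assume "real n \<le> x"
      then have "F x \<ge> D (real n)" by (intro D_le) auto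
      then show "dist (F x) 1 < e" using n F1[of x] by (simp add: dist_real_def)
    qed
  qed
  show "real_distribution (interval_measure F)"
    by (rule real_distribution_interval_measure) (fact Fmono rcont lim_bot lim_top)+
  show "emeasure (interval_measure F) {..y} = ennreal (F y)"
    by (rule emeasure_interval_measure_Iic) (fact Fmono rcont lim_bot)+
  assume q: "\<And>n. q n \<in> \<rat>" "\<And>n. y < q n" "q \<longlonglongrightarrow> y"
  show "(\<lambda>n. D (q n)) \<longlonglongrightarrow> F y"
  proof (rule tendstoI)
    fix e :: real assume "0 < e"
    then obtain r where r: "r \<in> \<rat>" "y < r" "D r < F y + e" using F_less by blast
    have "\<forall>\<^sub>F n in sequentially. q n < r" using order_tendstoD(2)[OF q(3) r(2)] .
    then show "\<forall>\<^sub>F n in sequentially. dist (D (q n)) (F y) < e"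
    proof eventually_elim
      case (elim n)
      then have "D (q n) \<le> D r" "F y \<le> D (q n)" using q r by (auto intro: mono F_le)
      then show ?case using r by (simp add: dist_real_def)
    qed
  qed
qed

text \<open>
  Conditional distributions on the line. For fixed \<open>E\<close> the measure \<open>F \<mapsto> m F E\<close> has a Radon-Nikodym
  density with respect to \<open>\<eta>\<close>. For almost every \<open>x\<close> the densities of the rational half-lines, of
  which there are only countably many, behave like a distribution function, and their
  right-continuous version defines the probability measure \<open>\<kappa> x\<close>.
\<close>

lemma bimeasure_kernel:
  fixes m :: "'x set \<Rightarrow> real set \<Rightarrow> ennreal"
  assumes m: "bimeasure X borel m"
    and sets_\<eta>: "sets \<eta> = sets X" and \<eta>: "\<And>F. F \<in> sets X \<Longrightarrow> emeasure \<eta> F = m F UNIV"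
  obtains \<kappa> where "\<kappa> \<in> X \<rightarrow>\<^sub>M prob_algebra borel"
    "\<And>F E. F \<in> sets X \<Longrightarrow> E \<in> sets borel \<Longrightarrow> m F E = (\<integral>\<^sup>+x\<in>F. emeasure (\<kappa> x) E \<partial>\<eta>)"
proof -
  have sp: "space \<eta> = space X" using sets_\<eta> by (rule sets_eq_imp_space_eq)
  note [measurable_cong] = sets_\<eta>
  interpret finite_measure \<eta>
    by standard (use m \<eta>[OF sets.top] in \<open>auto simp: sp bimeasure_def less_top\<close>)
  have mfin: "m F E < \<infinity>" if "F \<in> sets X" "E \<in> sets borel" for F E
    using bimeasure_finite[OF m that] .
  have "\<exists>f. f \<in> borel_measurable X \<and> (\<forall>F\<in>sets X. m F E = (\<integral>\<^sup>+x\<in>F. f x \<partial>\<eta>)) "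
    if E: "E \<in> sets borel" for E
  proof -
    obtain \<nu> where \<nu>: "sets \<nu> = sets X" "\<And>F. F \<in> sets X \<Longrightarrow> emeasure \<nu> F = m F E"
      using bimeasureE1[OF m E] by blast
    have "absolutely_continuous \<eta> \<nu>"
      unfolding absolutely_continuous_def
    proof
      fix N assume N: "N \<in> null_sets \<eta>"
      then have "N \<in> sets X" using sets_\<eta> by auto
      then have "m N E \<le> m N UNIV" by (intro bimeasure_mono[OF m]) (use E in auto)
      then show "N \<in> null_sets \<nu>" using N \<nu> \<eta>[of N] \<open>N \<in> sets X\<close> by (auto simp: null_sets_def)
    qed
    from Radon_Nikodym[OF this] \<nu> sets_\<eta> obtain f where f: "f \<in> borel_measurable \<eta>" "density \<eta> f = \<nu>"
      by auto
    then show ?thesis using \<nu>(2) sets_\<eta>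
      by (intro exI[of _ f]) (auto simp: measurable_cong_sets[OF sets_\<eta> refl] emeasure_density[symmetric])
  qed
  then obtain dens where dens[measurable]: "\<And>E. E \<in> sets borel \<Longrightarrow> dens E \<in> borel_measurable X"
    and m_dens: "\<And>E F. E \<in> sets borel \<Longrightarrow> F \<in> sets X \<Longrightarrow> m F E = (\<integral>\<^sup>+x\<in>F. dens E x \<partial>\<eta>)"
    by metis
  have AE_le: "AE x in \<eta>. dens E x \<le> dens E' x"
    if E: "E \<in> sets borel" "E' \<in> sets borel" "E \<subseteq> E'" for E E'
  proof -
    let ?N = "{x\<in>space \<eta>. \<not> dens E x \<le> dens E' x}"
    have N: "?N \<in> sets X" using E by (simp add: sets_\<eta>[symmetric])
    have "(\<integral>\<^sup>+x\<in>?N. dens E x \<partial>\<eta>) \<le> (\<integral>\<^sup>+x\<in>?N. dens E' x \<partial>\<eta>)"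
      unfolding m_dens[OF E(1) N, symmetric] m_dens[OF E(2) N, symmetric]
      by (rule bimeasure_mono[OF m]) (use E N in auto)
    moreover have "(\<integral>\<^sup>+x\<in>?N. dens E' x \<partial>\<eta>) < (\<integral>\<^sup>+x\<in>?N. dens E x \<partial>\<eta>)"
      if "\<not> (AE x in \<eta>. dens E x * indicator ?N x \<le> dens E' x * indicator ?N x)"
    proof (rule nn_integral_less)
      show "(\<integral>\<^sup>+x\<in>?N. dens E' x \<partial>\<eta>) \<noteq> \<infinity>"
        using mfin[OF N E(2)] m_dens[OF E(2) N] by simp
    qed (use E N that in \<open>auto simp: sets_\<eta> indicator_def\<close>)
    ultimately have "AE x in \<eta>. dens E x * indicator ?N x \<le> dens E' x * indicator ?N x"
      using leD by blast
    with AE_space show ?thesis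
      by eventually_elim (simp add: indicator_def, metis mult_1_right nle_le of_bool_eq(2))
  qed
  \<comment> \<open>Densities are taken with respect to \<open>\<eta>\<close> itself, so the conditional measures have mass one.\<close>
  have AE_1: "AE x in \<eta>. dens UNIV x = 1"
    by (rule density_unique_finite_measure)
       (auto simp: measurable_cong_sets[OF sets_\<eta> refl] sets_\<eta> m_dens[symmetric] \<eta>[symmetric])
  define D where "D r x = enn2real (dens {..r} x)" for r x
  have D_meas[measurable]: "D r \<in> borel_measurable X" for r unfolding D_def by measurable
  have "AE x in \<eta>. \<forall>r\<in>\<rat>. \<forall>s\<in>\<rat>. r \<le> s \<longrightarrow> dens {..r} x \<le> dens {..s} x"
    by (subst AE_ball_countable[OF countable_rat] | intro ballI AE_impI AE_le | simp)+
  moreover have "AE x in \<eta>. \<forall>r\<in>\<rat>. dens {..r} x \<le> dens UNIV x"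
    by (subst AE_ball_countable[OF countable_rat] | intro ballI AE_impI AE_le | simp)+
  ultimately have AE_mono: "AE x in \<eta>. (\<forall>r\<in>\<rat>. dens {..r} x \<le> 1) \<and> 
      (\<forall>r\<in>\<rat>. \<forall>s\<in>\<rat>. r \<le> s \<longrightarrow> dens {..r} x \<le> dens {..s} x)"
    using AE_1 by eventually_elim auto

  have UNIV_F: "\<exists>\<mu>. sets \<mu> = sets borel \<and> (\<forall>E\<in>sets borel. emeasure \<mu> E = m F E) \<and> finite_measure \<mu>"
    if F: "F \<in> sets X" for F
  proof -
    obtain \<mu> where \<mu>: "sets \<mu> = sets borel" "\<And>E. E \<in> sets borel \<Longrightarrow> emeasure \<mu> E = m F E"
      using bimeasureE2[OF m F] by blast
    moreover have "finite_measure \<mu>"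
      by standard (use \<mu> mfin[OF F] in \<open>simp add: sets_eq_imp_space_eq[OF \<mu>(1)] less_top\<close>)
    ultimately show ?thesis by blast
  qed
  have AE_top: "AE x in \<eta>. (SUP n. dens {..real n} x) = dens UNIV x"
  proof (rule density_unique_finite_measure)
    fix F assume F': "F \<in> sets \<eta>"
    then have F: "F \<in> sets X" using sets_\<eta> by simp
    obtain \<mu> where \<mu>: "sets \<mu> = sets borel" "\<And>E. E \<in> sets borel \<Longrightarrow> emeasure \<mu> E = m F E"
      using UNIV_F[OF F] by blast
    have "(\<integral>\<^sup>+ x. (SUP n. dens {..real n} x) * indicator F x \<partial>\<eta>)
      = (\<integral>\<^sup>+ x. (SUP n. dens {..real n} x * indicator F x) \<partial>\<eta>)"
      by (simp add: SUP_mult_right_ennreal)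
    also have "\<dots> = (SUP n. \<integral>\<^sup>+x. dens {..real n} x * indicator F x \<partial>\<eta>)"
    proof (rule nn_integral_monotone_convergence_SUP_AE)
      fix i :: nat
      show "AE x in \<eta>. dens {..real i} x * indicator F x \<le> dens {..real (Suc i)} x * indicator F x"
        using AE_mono by eventually_elim (auto intro!: mult_right_mono)
    qed (use F' in measurable)
    also have "\<dots> = (SUP n. emeasure \<mu> {..real n})"
      using m_dens F \<mu> by simp
    also have "\<dots> = emeasure \<mu> (\<Union>n. {..real n})"
      by (rule SUP_emeasure_incseq) (auto simp: \<mu> incseq_def)
    also have "(\<Union>n. {..real n}) = UNIV"
      by (auto intro: real_arch_simple)
    finally show "(\<integral>\<^sup>+ x. (SUP n. dens {..real n} x) * indicator F x \<partial>\<eta>) = (\<integral>\<^sup>+ x. dens UNIV x * indicator F x \<partial>\<eta>)"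
      using m_dens F \<mu> by simp
  qed auto
  have AE_bot: "AE x in \<eta>. (INF n. dens {..- real n} x) = 0"
  proof -
    obtain \<mu> where \<mu>: "sets \<mu> = sets borel" "\<And>E. E \<in> sets borel \<Longrightarrow> emeasure \<mu> E = m (space X) E"
      "finite_measure \<mu>" using UNIV_F[OF sets.top] by blast
    interpret \<mu>: finite_measure \<mu> by fact
    have "(\<integral>\<^sup>+x. (INF n. dens {..- real n} x) \<partial>\<eta>) \<le> emeasure \<mu> {..- real n}" for n
    proof -
      have "(\<integral>\<^sup>+x. (INF n. dens {..- real n} x) \<partial>\<eta>) \<le> (\<integral>\<^sup>+x. dens {..- real n} x \<partial>\<eta>)"
        by (intro nn_integral_mono INF_lower) auto
      also have "\<dots> = (\<integral>\<^sup>+x\<in>space X. dens {..- real n} x \<partial>\<eta>)"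
        by (intro nn_integral_cong) (auto simp: sp)
      finally show ?thesis using \<mu> m_dens by simp
    qed
    then have "(\<integral>\<^sup>+x. (INF n. dens {..- real n} x) \<partial>\<eta>) \<le> (INF n. emeasure \<mu> {..- real n})"
      by (intro INF_greatest)
    also have "\<dots> = emeasure \<mu> (\<Inter>n. {..- real n})"
      by (rule INF_emeasure_decseq) (use \<mu>.emeasure_finite in \<open>auto simp: \<mu>(1) decseq_def\<close>)
    also have "(\<Inter>n. {..- real n}) = {}"
    proof -
      have "\<exists>n. \<not> x \<le> - real n" for x using reals_Archimedean2[of "-x"] by (auto simp: not_le minus_less_iff)
      then show ?thesis by auto
    qed
    finally have "(\<integral>\<^sup>+x. (INF n. dens {..- real n} x) \<partial>\<eta>) = 0" by simp
    then show ?thesis by (subst (asm) nn_integral_0_iff_AE) auto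
  qed
  define good0 where "good0 x \<longleftrightarrow> (\<forall>r\<in>\<rat>. D r x \<le> 1) \<and> (\<forall>r\<in>\<rat>. \<forall>s\<in>\<rat>. r \<le> s \<longrightarrow> D r x \<le> D s x) \<and>
      (\<lambda>n. D (- real n) x) \<longlonglongrightarrow> 0 \<and> (\<lambda>n. D (real n) x) \<longlonglongrightarrow> 1" for x
  have "AE x in \<eta>. good0 x \<and> (\<forall>r\<in>\<rat>. ennreal (D r x) = dens {..r} x)"
    using AE_mono AE_top AE_bot AE_1
  proof eventually_elim
    case (elim x)
    have fin: "ennreal (D r x) = dens {..r} x" if "r \<in> \<rat>" for r
    proof -
      have "dens {..r} x \<le> 1" using elim(1) that by blast
      then have "dens {..r} x < top" using le_less_trans ennreal_one_less_top by blast
      then show ?thesis by (simp add: D_def)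
    qed
    have D1: "D r x \<le> 1" if "r \<in> \<rat>" for r
    proof -
      have "ennreal (D r x) \<le> ennreal 1" using elim(1) that fin by simp
      then show ?thesis by (subst (asm) ennreal_le_iff) auto
    qed
    have Dmono: "D r x \<le> D s x" if "r \<in> \<rat>" "s \<in> \<rat>" "r \<le> s" for r s
    proof -
      have "ennreal (D r x) \<le> ennreal (D s x)" using elim(1) that fin by simp
      then show ?thesis by (subst (asm) ennreal_le_iff) (auto simp: D_def)
    qed
    have "(\<lambda>n. dens {..real n} x) \<longlonglongrightarrow> (SUP n. dens {..real n} x)"
      by (rule LIMSEQ_SUP) (use elim(1) in \<open>auto simp: incseq_def\<close>)
    then have "(\<lambda>n. ennreal (D (real n) x)) \<longlonglongrightarrow> ennreal 1" using elim by (simp add: fin)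
    then have l1: "(\<lambda>n. D (real n) x) \<longlonglongrightarrow> 1" 
      by (subst (asm) tendsto_ennreal_iff) (auto simp: D_def)
    have "(\<lambda>n. dens {..- real n} x) \<longlonglongrightarrow> (INF n. dens {..- real n} x)"
      by (rule LIMSEQ_INF) (use elim(1) in \<open>auto simp: decseq_def\<close>)
    then have "(\<lambda>n. ennreal (D (- real n) x)) \<longlonglongrightarrow> ennreal 0" using elim by (simp add: fin)
    then have l2: "(\<lambda>n. D (- real n) x) \<longlonglongrightarrow> 0" 
      by (subst (asm) tendsto_ennreal_iff) (auto simp: D_def)
    from fin D1 Dmono l1 l2 show ?case unfolding good0_def by blast
  qed
  then have AE_good0: "AE x in \<eta>. good0 x" and AE_D: "AE x in \<eta>. \<forall>r\<in>\<rat>. ennreal (D r x) = dens {..r} x"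
    by auto
  from AE_E[OF AE_good0] obtain N where N: "{x\<in>space \<eta>. \<not> good0 x} \<subseteq> N" "N \<in> null_sets \<eta>"
    by (metis null_setsI)
  \<comment> \<open>A measurable set of full measure on which the rational data form a distribution function; the
    kernel is an arbitrary constant outside it.\<close>
  define good where "good x \<longleftrightarrow> x \<in> space \<eta> - N" for x
  have good0: "good0 x" if "good x" for x using that N by (auto simp: good_def)
  have AE_good: "AE x in \<eta>. good x"
    using AE_space AE_not_in[OF N(2)] by eventually_elim (simp add: good_def)
  have good_meas[measurable]: "Measurable.pred X good"
  proof -
    have "{x\<in>space X. good x} = space X - N" by (auto simp: good_def sp)
    moreover have "N \<in> sets X" using N(2) sets_\<eta> by auto
    ultimately show ?thesis by (simp add: pred_def sets.compl_sets)
  qed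
  define G where "G y x = (INF r\<in>{r\<in>\<rat>. y < r}. D r x)" for y x
  define \<kappa> where "\<kappa> x = (if good x then interval_measure (\<lambda>y. G y x) else return borel 0)" for x
  have rd: "real_distribution (interval_measure (\<lambda>y. G y x))"
    and Iic: "emeasure (interval_measure (\<lambda>y. G y x)) {..y} = ennreal (G y x)"
    and lim: "(\<And>n. q n \<in> \<rat>) \<Longrightarrow> (\<And>n. y < q n) \<Longrightarrow> q \<longlonglongrightarrow> y \<Longrightarrow> (\<lambda>n. D (q n) x) \<longlonglongrightarrow> G y x"
    if "good x" for x y q
    using real_distribution_from_rationals[of "\<lambda>r. D r x"] good0[OF that] unfolding good0_def G_def
    by (auto simp: D_def)
  have prob: "prob_space (\<kappa> x)" and sets_\<kappa>: "sets (\<kappa> x) = sets borel" for x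
    using real_distribution.axioms(1)[OF rd[of x]] by (auto simp: \<kappa>_def intro: prob_space_return)
  have sigma: "sets (borel :: real measure) = sigma_sets UNIV (range (\<lambda>a. {..a}))"
    by (simp add: borel_eq_atMost)
  have stable: "Int_stable (range (\<lambda>a::real. {..a}))"
    by (auto simp: Int_stable_def)
  have G_meas: "(\<lambda>x. if good x then G y x else indicator {..y} (0::real)) \<in> borel_measurable X" for y
  proof -
    obtain q where q: "\<And>n. q n \<in> \<rat>" "\<And>n. y < q n" "q \<longlonglongrightarrow> y"
      using rational_decseq_above by blast
    show ?thesis
    proof (rule borel_measurable_LIMSEQ_real)
      show "(\<lambda>n. if good x then D (q n) x else indicator {..y} (0::real)) \<longlonglongrightarrow> (if good x then G y x else indicator {..y} 0)" for x
        using lim[OF _ q] by auto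
    qed measurable
  qed
  have \<kappa>_Iic: "emeasure (\<kappa> x) {..y} = ennreal (if good x then G y x else indicator {..y} 0)" for x y
    by (auto simp: \<kappa>_def Iic indicator_def)
  have \<kappa>: "\<kappa> \<in> X \<rightarrow>\<^sub>M prob_algebra borel"
    by (rule measurable_prob_algebra_generated[OF sigma stable])
       (use G_meas in \<open>auto simp: prob sets_\<kappa> \<kappa>_Iic\<close>)
  note [measurable] = \<kappa>
  show thesis
  proof (rule that[OF \<kappa>])
    fix F :: "'x set" and E :: "real set" assume F: "F \<in> sets X" and E: "E \<in> sets borel"
    have F'[measurable]: "F \<in> sets \<eta>" using F sets_\<eta> by simp
    obtain \<mu> where \<mu>: "sets \<mu> = sets borel" "\<And>E. E \<in> sets borel \<Longrightarrow> emeasure \<mu> E = m F E" "finite_measure \<mu>"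
      using UNIV_F[OF F] by blast
    interpret \<mu>: finite_measure \<mu> by fact
    have meas_sub: "\<kappa> \<in> density \<eta> (indicator F) \<rightarrow>\<^sub>M subprob_algebra borel"
      using measurable_prob_algebraD[OF \<kappa>] by (simp add: measurable_cong_sets[OF sets_\<eta> refl])
    show "m F E = (\<integral>\<^sup>+x\<in>F. emeasure (\<kappa> x) E \<partial>\<eta>)"
    proof (cases "space X = {}")
      case True
      then have "F = {}" using sets.sets_into_space[OF F] by auto
      moreover have "m {} E = 0"
        using bimeasureE1[OF m E] by (metis emeasure_empty sets.empty_sets)
      ultimately show ?thesis by simp
    next
      case False
      then have ne: "space (density \<eta> (indicator F)) \<noteq> {}" by (simp add: sp)
      have "\<mu> = density \<eta> (indicator F) \<bind> \<kappa>"
      proof (rule measure_eqI_generator_eq[OF stable, where A="\<lambda>n. {..real n}"])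
        show "sets (density \<eta> (indicator F) \<bind> \<kappa>) = sigma_sets UNIV (range atMost)"
          using sets_bind[of "density \<eta> (indicator F)" \<kappa> borel, OF sets_\<kappa> ne] sigma by simp
        show "(\<Union>n. {..real n}) = UNIV" by (auto intro: real_arch_simple)
        fix Y :: "real set" assume "Y \<in> range atMost"
        then obtain y where Y: "Y = {..y}" by auto
        obtain q where q: "\<And>n. q n \<in> \<rat>" "\<And>n. y < q n" "q \<longlonglongrightarrow> y" "decseq q"
          using rational_decseq_above by blast
        have lim1: "(\<lambda>n. \<integral>\<^sup>+x. ennreal (D (q n) x) * indicator F x \<partial>\<eta>) \<longlonglongrightarrow> (\<integral>\<^sup>+x. ennreal (if good x then G y x else indicator {..y} 0) * indicator F x \<partial>\<eta>)"
        proof (rule nn_integral_dominated_convergence[where w="\<lambda>_. 1"])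
          show "AE x in \<eta>. (\<lambda>n. ennreal (D (q n) x) * indicator F x) \<longlonglongrightarrow> ennreal (if good x then G y x else indicator {..y} 0) * indicator F x"
            using AE_good by eventually_elim (auto intro!: tendsto_ennrealI lim q simp: indicator_def)
          show "AE x in \<eta>. ennreal (D (q n) x) * indicator F x \<le> 1" for n
            using AE_good by eventually_elim (use good0 in \<open>auto simp: good0_def q indicator_def\<close>)
          show "(\<lambda>x. ennreal (if good x then G y x else indicator {..y} 0) * indicator F x) \<in> borel_measurable \<eta>"
            using G_meas by measurable
        qed (auto simp: emeasure_eq_measure)
        have "(\<integral>\<^sup>+x. ennreal (D (q n) x) * indicator F x \<partial>\<eta>) = emeasure \<mu> {..q n}" for n
        proof -
          have "(\<integral>\<^sup>+x. ennreal (D (q n) x) * indicator F x \<partial>\<eta>) = (\<integral>\<^sup>+x\<in>F. dens {..q n} x \<partial>\<eta>)"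
            by (rule nn_integral_cong_AE) (use AE_D in \<open>eventually_elim, simp add: q\<close>)
          then show ?thesis using m_dens F \<mu> by simp
        qed
        with lim1 have "(\<lambda>n. emeasure \<mu> {..q n}) \<longlonglongrightarrow> (\<integral>\<^sup>+x. ennreal (if good x then G y x else indicator {..y} 0) * indicator F x \<partial>\<eta>)"
          by simp
        moreover have "(\<lambda>n. emeasure \<mu> {..q n}) \<longlonglongrightarrow> emeasure \<mu> (\<Inter>n. {..q n})"
          by (rule Lim_emeasure_decseq) (use q \<mu>.emeasure_finite in \<open>auto simp: \<mu>(1) decseq_def intro: order_trans\<close>)
        moreover have "(\<Inter>n. {..q n}) = {..y}"
        proof -
          have "z \<le> y" if "\<And>n. z \<le> q n" for z
            by (rule LIMSEQ_le_const[OF q(3)]) (use that in auto)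
          moreover have "z \<le> q n" if "z \<le> y" for z n using that q(2)[of n] by simp
          ultimately show ?thesis by auto
        qed
        ultimately have "emeasure \<mu> {..y} = (\<integral>\<^sup>+x. ennreal (if good x then G y x else indicator {..y} 0) * indicator F x \<partial>\<eta>)"
          using LIMSEQ_unique by metis
        also have "\<dots> = (\<integral>\<^sup>+x. emeasure (\<kappa> x) {..y} \<partial>density \<eta> (indicator F))"
          by (subst nn_integral_density) (use G_meas in \<open>auto simp: \<kappa>_Iic mult.commute\<close>)
        also have "\<dots> = emeasure (density \<eta> (indicator F) \<bind> \<kappa>) {..y}"
          by (rule emeasure_bind[OF ne meas_sub, symmetric]) simp
        finally show "emeasure \<mu> Y = emeasure (density \<eta> (indicator F) \<bind> \<kappa>) Y" using Y by simp
      qed (use \<mu>.emeasure_finite sigma \<mu>(1) in \<open>auto simp: less_top\<close>)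
      then have "m F E = emeasure (density \<eta> (indicator F) \<bind> \<kappa>) E"
        using \<mu>(2)[OF E] by simp
      also have "\<dots> = (\<integral>\<^sup>+x. emeasure (\<kappa> x) E \<partial>density \<eta> (indicator F))"
        by (rule emeasure_bind[OF ne meas_sub E])
      also have "\<dots> = (\<integral>\<^sup>+x\<in>F. emeasure (\<kappa> x) E \<partial>\<eta>)"
        using measurable_emeasure_kernel[OF measurable_prob_algebraD[OF \<kappa>] E]
        by (subst nn_integral_density) (auto simp: mult.commute measurable_cong_sets[OF sets_\<eta> refl])
      finally show ?thesis .
    qed
  qed
qed

section \<open>Real models of Lebesgue spaces\<close>

lemma isomorphic_mod0E:
  assumes "isomorphic_mod0 M N"
  obtains S T f where "S \<in> null_sets M" "T \<in> null_sets N"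
    "bij_betw f (space M - S) (space N - T)"
    "f \<in> restrict_space M (space M - S) \<rightarrow>\<^sub>M restrict_space N (space N - T)"
    "the_inv_into (space M - S) f \<in> restrict_space N (space N - T) \<rightarrow>\<^sub>M restrict_space M (space M - S)"
    "distr (restrict_space M (space M - S)) (restrict_space N (space N - T)) f = restrict_space N (space N - T)"
  using assms unfolding isomorphic_mod0_def Let_def
  by (auto simp: space_restrict_space Int_absorb2)

text \<open>
  The atoms go to the negative integers so that they cannot meet the segment, which lies in the
  nonnegative half-line.
\<close>

definition segment_atoms_embedding :: "real + nat \<Rightarrow> real" where
  "segment_atoms_embedding s = (case s of Inl x \<Rightarrow> x | Inr n \<Rightarrow> - 1 - real n)"

lemma inj_segment_atoms_embedding: "inj_on segment_atoms_embedding ({0..c} <+> I)"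
  by (auto simp: inj_on_def segment_atoms_embedding_def)

lemma lebesgue_space_finite: "lebesgue_space M \<Longrightarrow> finite_measure M"
  by (simp add: lebesgue_space_def)

lemma lebesgue_space_nonempty: "lebesgue_space M \<Longrightarrow> space M \<noteq> {}"
  by (auto simp: lebesgue_space_def)

text \<open>
  Up to null sets a Lebesgue space is the real line with the image measure. The map \<open>j\<close> can be
  chosen measurable for the original \<open>\<sigma>\<close>-algebra, but its inverse \<open>g\<close> only for the completion on the
  line, because \<open>C\<close> may carry the Lebesgue and not merely the Borel \<open>\<sigma>\<close>-algebra.
\<close>

lemma lebesgue_space_real_model:
  fixes C :: "'c measure"
  assumes C: "lebesgue_space C"
  obtains j :: "'c \<Rightarrow> real" and g where
    "j \<in> C \<rightarrow>\<^sub>M borel" "g \<in> completion (distr C borel j) \<rightarrow>\<^sub>M C" "AE x in C. g (j x) = x"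
proof -
  obtain c I w where iso: "isomorphic_mod0 (completion C) (standard_lebesgue_space c I w)"
    using C unfolding lebesgue_space_def by blast
  define N where "N = standard_lebesgue_space c I w"
  note spN = space_standard_lebesgue_space[of c I w, folded N_def]
    and setsN = sets_standard_lebesgue_space[of c I w, folded N_def]
    and emN = emeasure_standard_lebesgue_space[of _ c I w, folded N_def]
  obtain S T f where S: "S \<in> null_sets (completion C)" and T: "T \<in> null_sets N"
    and bij: "bij_betw f (space C - S) (space N - T)"
    and f: "f \<in> restrict_space (completion C) (space C - S) \<rightarrow>\<^sub>M restrict_space N (space N - T)"
    and inv: "the_inv_into (space C - S) f \<in> restrict_space N (space N - T) \<rightarrow>\<^sub>M restrict_space (completion C) (space C - S)"
    and dist: "distr (restrict_space (completion C) (space C - S)) (restrict_space N (space N - T)) f = restrict_space N (space N - T)"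
    using isomorphic_mod0E[OF iso[folded N_def]] unfolding space_completion by blast
  let ?M' = "restrict_space (completion C) (space C - S)" and ?N' = "restrict_space N (space N - T)"
  let ?e = segment_atoms_embedding
  have CS: "space C - S \<in> sets (completion C)"
    using S sets.compl_sets[of S "completion C"] by (simp add: null_setsD2)
  have NT: "space N - T \<in> sets N" using T by (simp add: null_setsD2 sets.compl_sets)
  have spM': "space ?M' = space C - S" and spN': "space ?N' = space N - T"
    by (auto simp: space_restrict_space)
  have inj_e: "inj_on ?e (space N)" unfolding spN by (rule inj_segment_atoms_embedding)
  have e_meas: "?e \<in> N \<rightarrow>\<^sub>M borel"
  proof (rule measurableI)
    fix E :: "real set" assume E: "E \<in> sets borel"
    have "Inl -` (?e -` E \<inter> space N) = {0..c} \<inter> E"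
      unfolding spN by (auto simp: segment_atoms_embedding_def)
    then show "?e -` E \<inter> space N \<in> sets N"
      using E by (auto simp: setsN spN)
  qed auto
  define j0 where "j0 x = (if x \<in> space C - S then ?e (f x) else 0)" for x
  have "j0 \<in> completion C \<rightarrow>\<^sub>M borel"
    unfolding j0_def
  proof (rule measurable_If_restrict_space_iff[THEN iffD2])
    show "{x \<in> space (completion C). x \<in> space C - S} \<in> sets (completion C)"
      using CS by (simp add: set_diff_eq)
    have "f \<in> ?M' \<rightarrow>\<^sub>M N" using f by (simp add: measurable_restrict_space2_iff)
    from measurable_compose[OF this e_meas]
    show "(\<lambda>x. ?e (f x)) \<in> restrict_space (completion C) {x. x \<in> space C - S} \<rightarrow>\<^sub>M borel \<and>
       (\<lambda>x. 0) \<in> restrict_space (completion C) {x. x \<notin> space C - S} \<rightarrow>\<^sub>M borel" by (simp add: Collect_mem_eq del: Diff_iff)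
  qed
  from completion_ex_borel_measurable_real[OF this] obtain j
    where j: "j \<in> C \<rightarrow>\<^sub>M borel" and j0_j: "AE x in C. j0 x = j x" by auto
  let ?L = "distr C borel j"
  obtain c0 where c0: "c0 \<in> space C" using lebesgue_space_nonempty[OF C] by blast
  define g where "g y = (if y \<in> ?e ` (space N - T) then the_inv_into (space C - S) f (the_inv_into (space N) ?e y) else c0)" for y
  have AE_S: "AE x in C. x \<notin> S" using AE_not_in[OF S] by (simp add: AE_completion_iff)
  have gj: "AE x in C. g (j x) = x"
    using j0_j AE_S AE_space
  proof eventually_elim
    case (elim x)
    then have x: "x \<in> space C - S" "j x = ?e (f x)" by (auto simp: j0_def)
    moreover have fx: "f x \<in> space N - T" using bij x(1) by (auto simp: bij_betw_def)
    moreover have "the_inv_into (space N) ?e (?e (f x)) = f x"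
      using the_inv_into_f_f[OF inj_e] fx by blast
    moreover have "the_inv_into (space C - S) f (f x) = x"
      using the_inv_into_f_f bij x(1) by (metis bij_betw_def)
    ultimately show ?case by (simp add: g_def)
  qed
  \<comment> \<open>It is enough that images of measurable sets of the standard space lie in the completion. On
    the segment such a set is Borel up to a Lebesgue null set, and the isomorphism sends null sets to
    null sets; the atoms contribute a countable set.\<close>
  have img: "?e ` U \<in> sets (completion ?L)" if U: "U \<in> sets N" for U
  proof -
    have UL: "Inl -` U \<in> sets (completion lborel)" and sub: "Inl -` U \<subseteq> {0..c}" using U by (auto simp: setsN)
    from UL obtain E Z Z' where EZ: "Inl -` U = E \<union> Z" "Z \<subseteq> Z'" "Z' \<in> null_sets lborel" "E \<in> sets lborel"
      by (rule sets_completionE)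
    define Z0 where "Z0 = Z' \<inter> {0..c}"
    have Z0: "Z0 \<in> sets borel" "Z \<subseteq> Z0" "Z0 \<subseteq> {0..c}"  using EZ sub by (auto simp: Z0_def)
    have "emeasure lborel Z0 = 0" 
      using EZ(3) emeasure_mono[of Z0 Z' lborel] by (auto simp: Z0_def null_sets_def)
    moreover have vim: "Inl -` (Inl ` Z0 :: (real + nat) set) = Z0" "Inr -` (Inl ` Z0 :: (real + nat) set) = {}" by auto
    moreover have Z0N: "Inl ` Z0 \<in> sets N" using Z0 by (auto simp: setsN vim)
    ultimately have Z0_null: "emeasure N (Inl ` Z0) = 0"
      using Z0(1) by (simp add: emN nn_integral_empty)
    define W where "W = f -` (Inl ` Z0 - T) \<inter> (space C - S)"
    have ZT: "Inl ` Z0 - T \<in> sets ?N'"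
      using Z0N NT T sets.sets_into_space[OF Z0N] by (subst sets_restrict_space_iff) auto
    have W_sets: "W \<in> sets ?M'" using measurable_sets[OF f ZT] by (simp add: W_def spM')
    have "emeasure (completion C) W = emeasure ?M' W"
      using CS by (subst emeasure_restrict_space) (auto simp: W_def)
    also have "\<dots> = emeasure (distr ?M' ?N' f) (Inl ` Z0 - T)"
      by (subst emeasure_distr[OF f ZT]) (simp add: W_def spM')
    also have "\<dots> = emeasure N (Inl ` Z0 - T)"
      unfolding dist using NT sets.sets_into_space[OF Z0N] by (subst emeasure_restrict_space) auto
    also have "\<dots> \<le> emeasure N (Inl ` Z0)" by (rule emeasure_mono[OF _ Z0N]) auto
    finally have "W \<in> null_sets (completion C)"
      using sets_restrict_space_subset[OF CS] W_sets Z0_null by (auto simp: null_sets_def)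
    then have "AE x in C. x \<notin> W" using AE_not_in AE_completion_iff by blast
    then have "AE x in C. j x \<notin> Z0"
      using j0_j AE_S AE_space
    proof eventually_elim
      case (elim x)
      then have x: "x \<in> space C - S" "j x = ?e (f x)" by (auto simp: j0_def)
      have fx: "f x \<in> space N - T" using bij x(1) by (auto simp: bij_betw_def)
      show ?case
      proof
        assume "j x \<in> Z0"
        then have "f x \<in> Inl ` Z0"
          using x(2) Z0(3) by (cases "f x") (auto simp: segment_atoms_embedding_def)
        then show False using fx x elim(1) by (auto simp: W_def)
      qed
    qed
    then have "Z0 \<in> null_sets ?L"
    proof -
      have "j -` Z0 \<inter> space C \<in> sets C" using j Z0(1) by (rule measurable_sets)
      moreover have "AE x in C. x \<notin> j -` Z0 \<inter> space C"
        using \<open>AE x in C. j x \<notin> Z0\<close> by eventually_elim auto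
      ultimately have "j -` Z0 \<inter> space C \<in> null_sets C" by (simp add: AE_iff_null_sets)
      then show ?thesis using Z0(1) j by (simp add: null_sets_distr_iff)
    qed
    then have "E \<union> Z \<in> sets (completion ?L)"
      by (intro sets_completionI[of _ E Z Z0]) (use EZ Z0 in auto)
    moreover have "?e ` U = (E \<union> Z) \<union> (\<lambda>n. - 1 - real n) ` (Inr -` U)"
    proof -
      have "U = Inl ` (Inl -` U) \<union> Inr ` (Inr -` U)" 
      proof (rule set_eqI)
        show "u \<in> U \<longleftrightarrow> u \<in> Inl ` (Inl -` U) \<union> Inr ` (Inr -` U)" for u by (cases u) auto
      qed
      then have "?e ` U = ?e ` Inl ` (Inl -` U) \<union> ?e ` Inr ` (Inr -` U)" by (metis image_Un)
      moreover have "?e ` Inl ` V = V" "?e ` Inr ` V' = (\<lambda>n. - 1 - real n) ` V'" for V V'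
        by (simp_all add: image_image segment_atoms_embedding_def)
      ultimately show ?thesis unfolding EZ(1)[symmetric] by (simp only:)
    qed
    moreover have "(\<lambda>n. - 1 - real n) ` (Inr -` U) \<in> sets (completion ?L)"
      by (rule sets_completionI_sets, rule sets.countable) auto
    ultimately show ?thesis by (metis sets.Un)
  qed
  have g: "g \<in> completion ?L \<rightarrow>\<^sub>M C"
  proof (rule measurableI)
    have inv_in: "the_inv_into (space C - S) f y \<in> space C - S" if "y \<in> space N - T" for y
      using bij that by (metis bij_betw_def the_inv_into_into subset_refl)
    moreover have "the_inv_into (space N) ?e y \<in> space N - T" if "y \<in> ?e ` (space N - T)" for y
      using that the_inv_into_f_f[OF inj_e] by auto
    ultimately have "g y \<in> space C" for y using c0 by (auto simp: g_def)
    then show "g y \<in> space C" for y .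
    fix K assume K: "K \<in> sets C"
    define U where "U = the_inv_into (space C - S) f -` (K - S) \<inter> (space N - T)"
    have "K - S \<in> sets ?M'"
      using CS S K sets.sets_into_space[OF K] by (subst sets_restrict_space_iff) (auto simp: null_setsD2)
    from measurable_sets[OF inv this] have "U \<in> sets ?N'" by (simp add: U_def spN')
    then have U: "U \<in> sets N" using NT by (subst (asm) sets_restrict_space_iff) auto
    have "g -` K \<inter> space (completion ?L) = ?e ` U \<union> (if c0 \<in> K then space (completion ?L) - ?e ` (space N - T) else {})"
    proof (rule set_eqI)
      fix y
      show "y \<in> g -` K \<inter> space (completion ?L) \<longleftrightarrow>
        y \<in> ?e ` U \<union> (if c0 \<in> K then space (completion ?L) - ?e ` (space N - T) else {})"
      proof (cases "y \<in> ?e ` (space N - T)")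
        case True
        then obtain u where u: "u \<in> space N - T" "y = ?e u" by blast
        have "the_inv_into (space N) ?e (?e u) = u" using the_inv_into_f_f[OF inj_e] u by blast
        then have "g y \<in> K \<longleftrightarrow> the_inv_into (space C - S) f u \<in> K - S"
          using u True inv_in[OF u(1)] by (auto simp: g_def)
        also have "\<dots> \<longleftrightarrow> u \<in> U" using u by (simp add: U_def)
        also have "\<dots> \<longleftrightarrow> y \<in> ?e ` U"
          using u inj_e by (auto simp: U_def inj_on_def)
        finally show ?thesis using True by auto
      next
        case False
        then have "y \<notin> ?e ` U" by (auto simp: U_def)
        then show ?thesis using False by (auto simp: g_def)
      qed
    qed
    also have "\<dots> \<in> sets (completion ?L)"
      using img[OF U] img[OF NT] sets.compl_sets by (auto intro!: sets.Un)
    finally show "g -` K \<inter> space (completion ?L) \<in> sets (completion ?L)" .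
  qed
  show thesis using that[OF j g gj] .
qed



text \<open>
  Transport the second variable to the line, extend there by a kernel, and come back along the
  inverse \<open>g\<close>. Since \<open>g\<close> is measurable only up to completion, the way back starts from the
  completed measure; this is where vanishing on null sets of \<open>C\<close> enters.
\<close>

lemma bimeasure_extends:
  fixes X :: "'x measure" and C :: "'c measure"
  assumes C: "lebesgue_space C" and m: "bimeasure X C m" and X: "space X \<noteq> {}"
    and null: "\<And>K. K \<in> null_sets C \<Longrightarrow> m (space X) K = 0"
  obtains R where "sets R = sets (X \<Otimes>\<^sub>M C)"
    "\<And>F K. F \<in> sets X \<Longrightarrow> K \<in> sets C \<Longrightarrow> emeasure R (F \<times> K) = m F K"
proof -
  obtain j :: "'c \<Rightarrow> real" and g where j: "j \<in> C \<rightarrow>\<^sub>M borel"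
    and g: "g \<in> completion (distr C borel j) \<rightarrow>\<^sub>M C" and gj: "AE x in C. g (j x) = x"
    using lebesgue_space_real_model[OF C] by blast
  note [measurable] = j
  define L where "L = distr C borel j"
  define m' where "m' F E = m F (j -` E \<inter> space C)" for F and E :: "real set"
  have m': "bimeasure X borel m'"
    unfolding bimeasure_def
  proof (intro conjI ballI)
    show "m' (space X) (space borel) < \<infinity>" using m by (simp add: m'_def bimeasure_def)
    show "\<exists>\<nu>. sets \<nu> = sets X \<and> (\<forall>F\<in>sets X. emeasure \<nu> F = m' F E)" if E: "E \<in> sets borel" for E
    proof -
      obtain \<nu> where "sets \<nu> = sets X" "\<And>F. F \<in> sets X \<Longrightarrow> emeasure \<nu> F = m F (j -` E \<inter> space C)"
        using bimeasureE1[OF m measurable_sets[OF j E]] by blast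
      then show ?thesis unfolding m'_def by blast
    qed
    fix F assume "F \<in> sets X"
    then obtain \<mu> where \<mu>: "sets \<mu> = sets C" "\<And>K. K \<in> sets C \<Longrightarrow> emeasure \<mu> K = m F K"
      using bimeasureE2[OF m] by blast
    have "j \<in> \<mu> \<rightarrow>\<^sub>M borel" using j by (simp add: measurable_cong_sets[OF \<mu>(1) refl])
    then have "emeasure (distr \<mu> borel j) E = m' F E" if "E \<in> sets borel" for E
      using that \<mu> measurable_sets[OF j that] sets_eq_imp_space_eq[OF \<mu>(1)]
      by (simp add: emeasure_distr m'_def)
    then show "\<exists>\<mu>. sets \<mu> = sets borel \<and> (\<forall>E\<in>sets borel. emeasure \<mu> E = m' F E)"
      by (intro exI[of _ "distr \<mu> borel j"]) auto
  qed
  obtain \<eta> where \<eta>: "sets \<eta> = sets X" "\<And>F. F \<in> sets X \<Longrightarrow> emeasure \<eta> F = m' F UNIV"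
    using bimeasureE1[OF m', of UNIV] by auto
  obtain \<kappa> where \<kappa>: "\<kappa> \<in> X \<rightarrow>\<^sub>M prob_algebra borel"
    and m'_\<kappa>: "\<And>F E. F \<in> sets X \<Longrightarrow> E \<in> sets borel \<Longrightarrow> m' F E = (\<integral>\<^sup>+x\<in>F. emeasure (\<kappa> x) E \<partial>\<eta>)"
    using bimeasure_kernel[OF m' \<eta>] by blast
  have sp: "space \<eta> = space X" using \<eta>(1) by (rule sets_eq_imp_space_eq)
  note [measurable_cong] = \<eta>(1) and [measurable] = \<kappa>
  define \<kappa>' where "\<kappa>' x = distr (\<kappa> x) (X \<Otimes>\<^sub>M borel) (\<lambda>y. (x, y))" for x
  have \<kappa>': "\<kappa>' \<in> \<eta> \<rightarrow>\<^sub>M subprob_algebra (X \<Otimes>\<^sub>M borel)"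
    unfolding \<kappa>'_def by (rule measurable_prob_algebraD) measurable
  define R0 where "R0 = \<eta> \<bind> \<kappa>'"
  have ne: "space \<eta> \<noteq> {}" using X sp by simp
  have sets_R0: "sets R0 = sets (X \<Otimes>\<^sub>M borel)"
    unfolding R0_def by (rule sets_bind[OF sets_kernel[OF \<kappa>'] ne])
  have R0: "emeasure R0 (F \<times> E) = m' F E" if [measurable]: "F \<in> sets X" "E \<in> sets borel" for F E
  proof -
    have "emeasure R0 (F \<times> E) = (\<integral>\<^sup>+x. emeasure (\<kappa>' x) (F \<times> E) \<partial>\<eta>)"
      unfolding R0_def by (rule emeasure_bind[OF ne \<kappa>']) measurable
    also have "\<dots> = (\<integral>\<^sup>+x\<in>F. emeasure (\<kappa> x) E \<partial>\<eta>)"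
    proof (rule nn_integral_cong)
      fix x assume "x \<in> space \<eta>"
      then have x: "x \<in> space X" by (simp add: sp)
      have s: "sets (\<kappa> x) = sets borel" using sets_kernel[OF measurable_prob_algebraD[OF \<kappa>] x] .
      have "emeasure (\<kappa>' x) (F \<times> E) = emeasure (\<kappa> x) ((\<lambda>y. (x, y)) -` (F \<times> E) \<inter> space (\<kappa> x))"
        unfolding \<kappa>'_def using x by (subst emeasure_distr) (simp_all add: measurable_cong_sets[OF s refl])
      also have "(\<lambda>y. (x, y)) -` (F \<times> E) \<inter> space (\<kappa> x) = (if x \<in> F then E else {})"
        using sets_eq_imp_space_eq[OF s] by auto
      finally show "emeasure (\<kappa>' x) (F \<times> E) = emeasure (\<kappa> x) E * indicator F x" by simp
    qed
    finally show ?thesis using m'_\<kappa> that by simp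
  qed
  have sp_R0: "space R0 = space X \<times> UNIV"
    using sets_eq_imp_space_eq[OF sets_R0] by (simp add: space_pair_measure)
  note [measurable_cong] = sets_R0
  have snd_g: "(\<lambda>z. g (snd z)) \<in> completion R0 \<rightarrow>\<^sub>M C"
  proof (rule measurable_compose[OF _ g[folded L_def]])
    show "snd \<in> completion R0 \<rightarrow>\<^sub>M completion L"
    proof (rule completion.measurable_completion2)
      show sndL: "snd \<in> completion R0 \<rightarrow>\<^sub>M L"
        unfolding L_def by (rule measurable_completion) measurable
      show "null_sets L \<subseteq> null_sets (distr (completion R0) L snd)"
      proof
        fix Z assume Z: "Z \<in> null_sets L"
        then have Zb: "Z \<in> sets borel" by (auto simp: L_def)
        have "j -` Z \<inter> space C \<in> null_sets C" using Z by (simp add: L_def null_sets_distr_iff)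
        then have "emeasure R0 (space X \<times> Z) = 0" using R0[OF sets.top Zb] null by (simp add: m'_def)
        moreover have "snd -` Z \<inter> space R0 = space X \<times> Z" by (auto simp: sp_R0)
        moreover have "space X \<times> Z \<in> sets R0" using Zb by simp
        ultimately have "snd -` Z \<inter> space R0 \<in> null_sets R0" by auto
        then show "Z \<in> null_sets (distr (completion R0) L snd)"
          using Zb by (simp add: null_sets_distr_iff[OF sndL] null_sets_completionI) (simp add: L_def)
      qed
    qed
  qed
  have fst_X: "fst \<in> completion R0 \<rightarrow>\<^sub>M X"
    by (rule measurable_completion) measurable
  define R where "R = distr (completion R0) (X \<Otimes>\<^sub>M C) (\<lambda>z. (fst z, g (snd z)))"
  have pair: "(\<lambda>z. (fst z, g (snd z))) \<in> completion R0 \<rightarrow>\<^sub>M X \<Otimes>\<^sub>M C"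
    using fst_X snd_g by (rule measurable_Pair)
  show thesis
  proof (rule that)
    show "sets R = sets (X \<Otimes>\<^sub>M C)" by (simp add: R_def)
    fix F K assume F[measurable]: "F \<in> sets X" and K[measurable]: "K \<in> sets C"
    have "g -` K \<inter> space L \<in> sets (completion L)"
      using measurable_sets[OF g K] by (simp add: L_def)
    then obtain E Z Z' where EZ: "g -` K \<inter> space L = E \<union> Z" "Z \<subseteq> Z'" "Z' \<in> null_sets L" "E \<in> sets L"
      by (rule sets_completionE)
    have spL: "space L = UNIV" and setsL: "sets L = sets borel" by (simp_all add: L_def)
    have Z': "Z' \<in> sets borel" "E \<in> sets borel" using EZ setsL by auto
    have jZ': "j -` Z' \<inter> space C \<in> null_sets C" using EZ(3) by (simp add: L_def null_sets_distr_iff)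
    have R0Z': "space X \<times> Z' \<in> null_sets R0"
      using R0[OF sets.top Z'(1)] null[OF jZ'] Z' by (auto simp: m'_def)
    have "emeasure R (F \<times> K) = emeasure (completion R0) (F \<times> (g -` K))"
      unfolding R_def using sets.sets_into_space[OF F]
      by (subst emeasure_distr[OF pair]) (auto simp: sp_R0 intro!: arg_cong2[where f=emeasure])
    also have "\<dots> = emeasure (completion R0) (F \<times> E)"
    proof (rule emeasure_eq_AE)
      have "AE z in completion R0. z \<notin> space X \<times> Z'"
        using R0Z' by (intro AE_completion AE_not_in)
      moreover have "AE z in completion R0. z \<in> space X \<times> UNIV" 
        using AE_space[of "completion R0"] by (simp add: sp_R0)
      ultimately show "AE z in completion R0. (z \<in> F \<times> g -` K) = (z \<in> F \<times> E)"
        by eventually_elim (use EZ(1,2) spL in blast)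
      have "F \<times> g -` K = (\<lambda>z. (fst z, g (snd z))) -` (F \<times> K) \<inter> space (completion R0)"
        using sets.sets_into_space[OF F] by (auto simp: sp_R0)
      then show "F \<times> g -` K \<in> sets (completion R0)"
        using measurable_sets[OF pair, of "F \<times> K"] by simp
    qed (use Z' in auto)
    also have "\<dots> = m F (j -` E \<inter> space C)"
      using R0[OF F Z'(2)] Z' by (simp add: m'_def)
    also have "\<dots> = m F K"
    proof -
      obtain \<mu> where \<mu>: "sets \<mu> = sets C" "\<And>K. K \<in> sets C \<Longrightarrow> emeasure \<mu> K = m F K"
        using bimeasureE2[OF m F] by blast
      have "absolutely_continuous C \<mu>"
        unfolding absolutely_continuous_def
      proof
        fix K assume K: "K \<in> null_sets C"
        then have "m F K \<le> m (space X) K"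
          using F sets.sets_into_space[OF F] by (intro bimeasure_mono[OF m]) auto
        then show "K \<in> null_sets \<mu>" using K null[OF K] \<mu> by (auto simp: null_sets_def)
      qed
      moreover have "AE x in C. x \<in> j -` E \<inter> space C \<longleftrightarrow> x \<in> K"
        using gj AE_not_in[OF jZ'] AE_space
      proof eventually_elim
        case (elim x)
        then have "j x \<notin> Z'" by auto
        then have "j x \<in> E \<longleftrightarrow> g (j x) \<in> K" using EZ spL by blast
        then show ?case using elim by simp
      qed
      ultimately have "AE x in \<mu>. x \<in> j -` E \<inter> space C \<longleftrightarrow> x \<in> K"
        by (rule absolutely_continuous_AE[OF \<mu>(1)])
      then have "emeasure \<mu> (j -` E \<inter> space C) = emeasure \<mu> K"
        by (rule emeasure_eq_AE) (use \<mu>(1) K measurable_sets[OF j Z'(2)] in simp_all)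
      then show ?thesis using \<mu>(2)[OF K] \<mu>(2)[OF measurable_sets[OF j Z'(2)]] by simp
    qed
    finally show "emeasure R (F \<times> K) = m F K" .
  qed
qed

section \<open>Finite kernels and their mixtures\<close>

lemma measure_eqI_pair:
  assumes sets: "sets \<mu> = sets (X \<Otimes>\<^sub>M Y)" "sets \<nu> = sets (X \<Otimes>\<^sub>M Y)"
    and fin: "finite_measure \<mu>"
    and eq: "\<And>F G. F \<in> sets X \<Longrightarrow> G \<in> sets Y \<Longrightarrow> emeasure \<mu> (F \<times> G) = emeasure \<nu> (F \<times> G)"
  shows "\<mu> = \<nu>"
proof (rule measure_eqI_generator_eq[OF Int_stable_pair_measure_generator[of X Y], where A="\<lambda>_. space X \<times> space Y"])
  show "{a \<times> b |a b. a \<in> sets X \<and> b \<in> sets Y} \<subseteq> Pow (space X \<times> space Y)"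
    by (rule pair_measure_closed)
  show "emeasure \<mu> (space X \<times> space Y) \<noteq> \<infinity>" for i :: nat
    using finite_measure.emeasure_finite[OF fin] by simp
qed (auto simp: sets sets_pair_measure eq)

lemma measurable_congI:
  "g \<in> X \<rightarrow>\<^sub>M Y \<Longrightarrow> (\<And>x. x \<in> space X \<Longrightarrow> f x = g x) \<Longrightarrow> f \<in> X \<rightarrow>\<^sub>M Y"
  by (simp cong: measurable_cong)

definition finite_kernel :: "'b measure \<Rightarrow> 'y measure \<Rightarrow> ('b \<Rightarrow> 'y measure) \<Rightarrow> bool" where
  "finite_kernel B Y q \<longleftrightarrow>
     (\<forall>b\<in>space B. sets (q b) = sets Y \<and> finite_measure (q b)) \<and>
     (\<forall>E\<in>sets Y. (\<lambda>b. emeasure (q b) E) \<in> borel_measurable B)"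

lemma finite_kernelD:
  assumes "finite_kernel B Y q"
  shows "b \<in> space B \<Longrightarrow> sets (q b) = sets Y" "b \<in> space B \<Longrightarrow> space (q b) = space Y"
    "b \<in> space B \<Longrightarrow> finite_measure (q b)"
    "E \<in> sets Y \<Longrightarrow> (\<lambda>b. emeasure (q b) E) \<in> borel_measurable B"
  using assms unfolding finite_kernel_def by (auto dest: sets_eq_imp_space_eq)

text \<open>
  The sets \<open>S\<close> with this property form a Dynkin system that contains the rectangles; finiteness of
  the kernel gives the complements.
\<close>

lemma finite_kernel_section_measurable:
  assumes q: "finite_kernel B Y q" and h: "h \<in> X \<rightarrow>\<^sub>M B" and S: "S \<in> sets (X \<Otimes>\<^sub>M Y)"
  shows "(\<lambda>x. emeasure (q (h x)) (Pair x -` S)) \<in> borel_measurable X"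
proof -
  let ?G = "{a \<times> b |a b. a \<in> sets X \<and> b \<in> sets Y}" and ?\<Omega> = "space X \<times> space Y"
  have hB: "h x \<in> space B" if "x \<in> space X" for x using measurable_space[OF h that] .
  have qE: "(\<lambda>x. emeasure (q (h x)) E) \<in> borel_measurable X" if "E \<in> sets Y" for E
    using finite_kernelD(4)[OF q that] h by (rule measurable_compose[rotated])
  show ?thesis
    using Int_stable_pair_measure_generator pair_measure_closed S unfolding sets_pair_measure
  proof (induct rule: sigma_sets_induct_disjoint)
    case (basic S)
    then obtain F E where FE: "S = F \<times> E" "F \<in> sets X" "E \<in> sets Y" by blast
    have "emeasure (q (h x)) (Pair x -` S) = indicator F x * emeasure (q (h x)) E" for x
    proof -
      have "Pair x -` S = (if x \<in> F then E else {})" by (auto simp: FE(1))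
      then show ?thesis by simp
    qed
    then show ?case using FE qE by simp
  next
    case empty
    then show ?case by simp
  next
    case (compl S)
    have *: "emeasure (q (h x)) (Pair x -` (?\<Omega> - S)) = emeasure (q (h x)) (space Y) - emeasure (q (h x)) (Pair x -` S)"
      if x: "x \<in> space X" for x
    proof -
      interpret finite_measure "q (h x)" using finite_kernelD(3)[OF q hB[OF x]] .
      have "Pair x -` S \<in> sets (q (h x))"
        using compl(1) finite_kernelD(1)[OF q hB[OF x]] by (simp add: sets_pair_measure[symmetric] sets_Pair1)
      moreover have "Pair x -` (?\<Omega> - S) = space (q (h x)) - Pair x -` S"
        using x finite_kernelD(2)[OF q hB[OF x]] by auto
      ultimately show ?thesis
        using emeasure_compl[of "Pair x -` S" "q (h x)"] emeasure_finite finite_kernelD(2)[OF q hB[OF x]] by simp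
    qed
    show ?case
      by (rule measurable_congI[OF borel_measurable_minus_ennreal[OF qE[OF sets.top] compl(2)]], rule *)
  next
    case (union S)
    have *: "emeasure (q (h x)) (Pair x -` (\<Union>i. S i)) = (\<Sum>i. emeasure (q (h x)) (Pair x -` S i))"
      if x: "x \<in> space X" for x
    proof -
      have "S i \<in> sets (X \<Otimes>\<^sub>M Y)" for i
        using union(2) by (auto simp: sets_pair_measure)
      then have "range (\<lambda>i. Pair x -` S i) \<subseteq> sets (q (h x))"
        by (auto simp: finite_kernelD(1)[OF q hB[OF x]] intro: sets_Pair1)
      moreover have "disjoint_family (\<lambda>i. Pair x -` S i)"
        using union(1) by (auto simp: disjoint_family_on_def)
      ultimately show ?thesis using suminf_emeasure[of "\<lambda>i. Pair x -` S i" "q (h x)"] by (simp add: vimage_UN)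
    qed
    show ?case
      by (rule measurable_congI[OF borel_measurable_suminf_order[OF union(3)]], rule *)
  qed
qed

lemma finite_kernel_nn_integral_measurable:
  assumes q: "finite_kernel B Y q" and h: "h \<in> X \<rightarrow>\<^sub>M B"
    and f: "f \<in> borel_measurable (X \<Otimes>\<^sub>M Y)"
  shows "(\<lambda>x. \<integral>\<^sup>+y. f (x, y) \<partial>q (h x)) \<in> borel_measurable X"
proof -
  have hB: "h x \<in> space B" if "x \<in> space X" for x using measurable_space[OF h that] .
  note s = finite_kernelD(1)[OF q hB]
  have sec: "(\<lambda>y. g (x, y)) \<in> borel_measurable (q (h x))"
    if "g \<in> borel_measurable (X \<Otimes>\<^sub>M Y)" "x \<in> space X" for g :: "_ \<Rightarrow> ennreal" and x
    using that by (simp add: measurable_cong_sets[OF s refl])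
  from f show ?thesis
  proof induct
    case (cong f g)
    then have *: "(\<integral>\<^sup>+y. f (x, y) \<partial>q (h x)) = (\<integral>\<^sup>+y. g (x, y) \<partial>q (h x))" if "x \<in> space X" for x
      using that finite_kernelD(2)[OF q hB[OF that]] by (intro nn_integral_cong) (auto simp: space_pair_measure)
    show ?case by (rule measurable_congI[OF cong(4)], rule *)
  next
    case (set S)
    have *: "(\<integral>\<^sup>+y. indicator S (x, y) \<partial>q (h x)) = emeasure (q (h x)) (Pair x -` S)" if "x \<in> space X" for x
    proof -
      have "(\<integral>\<^sup>+y. indicator S (x, y) \<partial>q (h x)) = (\<integral>\<^sup>+y. indicator (Pair x -` S) y \<partial>q (h x))"
        by (simp add: indicator_def vimage_def)
      then show ?thesis using sets_Pair1[OF set] s[OF that] by simp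
    qed
    show ?case by (rule measurable_congI[OF finite_kernel_section_measurable[OF q h set]], rule *)
  next
    case (mult u c)
    have *: "(\<integral>\<^sup>+y. c * u (x, y) \<partial>q (h x)) = c * (\<integral>\<^sup>+y. u (x, y) \<partial>q (h x))" if "x \<in> space X" for x
      using sec[OF mult(2) that] by (rule nn_integral_cmult)
    have "(\<lambda>x. c * (\<integral>\<^sup>+y. u (x, y) \<partial>q (h x))) \<in> borel_measurable X" using mult(4) by measurable
    then show ?case by (rule measurable_congI) (rule *)
  next
    case (add u v)
    have *: "(\<integral>\<^sup>+y. v (x, y) + u (x, y) \<partial>q (h x)) = (\<integral>\<^sup>+y. v (x, y) \<partial>q (h x)) + (\<integral>\<^sup>+y. u (x, y) \<partial>q (h x))" if "x \<in> space X" for x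
      using sec[OF add(1) that] sec[OF add(4) that] by (intro nn_integral_add)
    have "(\<lambda>x. (\<integral>\<^sup>+y. v (x, y) \<partial>q (h x)) + (\<integral>\<^sup>+y. u (x, y) \<partial>q (h x))) \<in> borel_measurable X" by (intro borel_measurable_add add(3) add(7))
    then show ?case by (rule measurable_congI) (rule *)
  next
    case (seq U)
    have *: "(\<integral>\<^sup>+y. (SUP i. U i) (x, y) \<partial>q (h x)) = (SUP i. \<integral>\<^sup>+y. U i (x, y) \<partial>q (h x))" if "x \<in> space X" for x
      using seq(4) sec[OF seq(1) that] unfolding SUP_apply
      by (intro nn_integral_monotone_convergence_SUP) (auto simp: incseq_def le_fun_def)
    have "(\<lambda>x. SUP i. (\<integral>\<^sup>+y. U i (x, y) \<partial>q (h x))) \<in> borel_measurable X" using seq(3) by measurable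
    then show ?case by (rule measurable_congI) (rule *)
  qed
qed

lemma finite_kernel_distr:
  assumes q: "finite_kernel B Y q" and h: "h \<in> X \<rightarrow>\<^sub>M B" and f: "f \<in> X \<Otimes>\<^sub>M Y \<rightarrow>\<^sub>M Z"
  shows "finite_kernel X Z (\<lambda>x. distr (q (h x)) Z (\<lambda>y. f (x, y)))"
  unfolding finite_kernel_def
proof (intro conjI ballI)
  have hB: "h x \<in> space B" if "x \<in> space X" for x using measurable_space[OF h that] .
  have fx: "(\<lambda>y. f (x, y)) \<in> q (h x) \<rightarrow>\<^sub>M Z" if "x \<in> space X" for x
    using f that by (simp add: measurable_cong_sets[OF finite_kernelD(1)[OF q hB[OF that]] refl])
  show "finite_measure (distr (q (h x)) Z (\<lambda>y. f (x, y)))" if "x \<in> space X" for x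
    using finite_measure.finite_measure_distr[OF finite_kernelD(3)[OF q hB] fx] that by blast
  fix E assume E: "E \<in> sets Z"
  let ?S = "f -` E \<inter> space (X \<Otimes>\<^sub>M Y)"
  have *: "emeasure (distr (q (h x)) Z (\<lambda>y. f (x, y))) E = emeasure (q (h x)) (Pair x -` ?S)" if "x \<in> space X" for x
    using that E finite_kernelD(2)[OF q hB[OF that]]
    by (subst emeasure_distr[OF fx]) (auto intro!: arg_cong2[where f=emeasure] simp: space_pair_measure)
  show "(\<lambda>x. emeasure (distr (q (h x)) Z (\<lambda>y. f (x, y))) E) \<in> borel_measurable X"
    by (rule measurable_congI[OF finite_kernel_section_measurable[OF q h measurable_sets[OF f E]]], rule *)
qed simp

text \<open>
  The integral of the measures \<open>k x\<close> against \<open>P\<close>. Unlike the monadic bind it allows kernels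
  whose masses are finite but unbounded, as are the densities of the blocks of a polymorphism.
\<close>

definition mixture :: "'x measure \<Rightarrow> ('x \<Rightarrow> 'y measure) \<Rightarrow> 'y measure \<Rightarrow> 'y measure" where
  "mixture P k Y = measure_of (space Y) (sets Y) (\<lambda>E. \<integral>\<^sup>+x. emeasure (k x) E \<partial>P)"

lemma sets_mixture[simp, measurable_cong]: "sets (mixture P k Y) = sets Y"
  by (simp add: mixture_def sets.space_closed)

lemma emeasure_mixture:
  assumes k: "finite_kernel P Y k" and E: "E \<in> sets Y"
  shows "emeasure (mixture P k Y) E = (\<integral>\<^sup>+x. emeasure (k x) E \<partial>P)"
  unfolding mixture_def
proof (rule emeasure_measure_of_sigma[OF sets.sigma_algebra_axioms _ _ E])
  show "positive (sets Y) (\<lambda>E. \<integral>\<^sup>+x. emeasure (k x) E \<partial>P)" by (simp add: positive_def)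
  show "countably_additive (sets Y) (\<lambda>E. \<integral>\<^sup>+x. emeasure (k x) E \<partial>P)"
    unfolding countably_additive_def
  proof (intro allI impI)
    fix F :: "nat \<Rightarrow> _" assume F: "range F \<subseteq> sets Y" "disjoint_family F"
    have "(\<Sum>i. \<integral>\<^sup>+x. emeasure (k x) (F i) \<partial>P) = (\<integral>\<^sup>+x. (\<Sum>i. emeasure (k x) (F i)) \<partial>P)"
      using finite_kernelD(4)[OF k] F(1) by (intro nn_integral_suminf[symmetric]) auto
    also have "\<dots> = (\<integral>\<^sup>+x. emeasure (k x) (\<Union>i. F i) \<partial>P)"
      using F finite_kernelD(1)[OF k] by (intro nn_integral_cong suminf_emeasure) auto
    finally show "(\<Sum>i. \<integral>\<^sup>+x. emeasure (k x) (F i) \<partial>P) = (\<integral>\<^sup>+x. emeasure (k x) (\<Union>i. F i) \<partial>P)" .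
  qed
qed

lemma nn_integral_mixture:
  assumes k: "finite_kernel P Y k" and f: "f \<in> borel_measurable Y"
  shows "(\<integral>\<^sup>+y. f y \<partial>mixture P k Y) = (\<integral>\<^sup>+x. \<integral>\<^sup>+y. f y \<partial>k x \<partial>P)"
  using f
proof induct
  note s = finite_kernelD(1)[OF k]
  have sp: "space (mixture P k Y) = space Y" by (rule sets_eq_imp_space_eq) simp
  have m: "g \<in> borel_measurable (k x)" if "x \<in> space P" "g \<in> borel_measurable Y" for g :: "_ \<Rightarrow> ennreal" and x
    using that by (simp add: measurable_cong_sets[OF s refl])
  have mi: "(\<lambda>x. \<integral>\<^sup>+y. g y \<partial>k x) \<in> borel_measurable P" if "g \<in> borel_measurable Y" for g :: "_ \<Rightarrow> ennreal"
    using finite_kernel_nn_integral_measurable[OF k measurable_ident, of "\<lambda>(x, y). g y"] that by simp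
  {
    case (cong f g)
    have "(\<integral>\<^sup>+y. f y \<partial>mixture P k Y) = (\<integral>\<^sup>+y. g y \<partial>mixture P k Y)"
      by (intro nn_integral_cong) (simp add: cong sp)
    also have "\<dots> = (\<integral>\<^sup>+x. \<integral>\<^sup>+y. g y \<partial>k x \<partial>P)" by (rule cong(4))
    also have "\<dots> = (\<integral>\<^sup>+x. \<integral>\<^sup>+y. f y \<partial>k x \<partial>P)"
      by (intro nn_integral_cong) (simp add: cong finite_kernelD(2)[OF k])
    finally show ?case .
  next
    case (set E)
    then show ?case using emeasure_mixture[OF k set] s by (simp cong: nn_integral_cong)
  next
    case (mult u c)
    have "(\<integral>\<^sup>+x. \<integral>\<^sup>+y. c * u y \<partial>k x \<partial>P) = (\<integral>\<^sup>+x. c * (\<integral>\<^sup>+y. u y \<partial>k x) \<partial>P)"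
      by (intro nn_integral_cong nn_integral_cmult m mult)
    then show ?case using mult mi by (simp add: nn_integral_cmult)
  next
    case (add u v)
    have "(\<integral>\<^sup>+x. \<integral>\<^sup>+y. v y + u y \<partial>k x \<partial>P) = (\<integral>\<^sup>+x. (\<integral>\<^sup>+y. v y \<partial>k x) + (\<integral>\<^sup>+y. u y \<partial>k x) \<partial>P)"
      by (intro nn_integral_cong nn_integral_add m add)
    then show ?case using add mi by (simp add: nn_integral_add)
  next
    case (seq U)
    have "(\<integral>\<^sup>+y. (SUP i. U i) y \<partial>mixture P k Y) = (SUP i. \<integral>\<^sup>+y. U i y \<partial>mixture P k Y)"
      unfolding SUP_apply using seq by (intro nn_integral_monotone_convergence_SUP) auto
    also have "\<dots> = (SUP i. \<integral>\<^sup>+x. \<integral>\<^sup>+y. U i y \<partial>k x \<partial>P)" using seq by simp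
    also have "\<dots> = (\<integral>\<^sup>+x. (SUP i. \<integral>\<^sup>+y. U i y \<partial>k x) \<partial>P)"
      using seq mi
      by (intro nn_integral_monotone_convergence_SUP[symmetric])
         (auto simp: incseq_def le_fun_def intro!: nn_integral_mono)
    also have "\<dots> = (\<integral>\<^sup>+x. \<integral>\<^sup>+y. (SUP i. U i) y \<partial>k x \<partial>P)"
    proof (rule nn_integral_cong)
      fix x assume x: "x \<in> space P"
      show "(SUP i. \<integral>\<^sup>+y. U i y \<partial>k x) = (\<integral>\<^sup>+y. (SUP i. U i) y \<partial>k x)"
        unfolding SUP_apply
        by (rule nn_integral_monotone_convergence_SUP[OF seq(4) m[OF x seq(1)], symmetric])
    qed
    finally show ?case .
  }
qed

lemma finite_measure_mixture:
  assumes "finite_kernel P Y k" "(\<integral>\<^sup>+x. emeasure (k x) (space Y) \<partial>P) < \<infinity>"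
  shows "finite_measure (mixture P k Y)"
proof
  have "space (mixture P k Y) = space Y" by (rule sets_eq_imp_space_eq) simp
  then show "emeasure (mixture P k Y) (space (mixture P k Y)) \<noteq> \<infinity>"
    using emeasure_mixture[OF assms(1) sets.top] assms(2) by simp
qed

lemma integral_mixture_nonneg:
  fixes f :: "'y \<Rightarrow> real"
  assumes k: "finite_kernel P Y k" and f: "f \<in> borel_measurable Y"
    and bd: "\<And>y. y \<in> space Y \<Longrightarrow> 0 \<le> f y \<and> f y \<le> c"
    and fin: "(\<integral>\<^sup>+x. emeasure (k x) (space Y) \<partial>P) < \<infinity>"
  shows "integrable P (\<lambda>x. \<integral>y. f y \<partial>k x) \<and> (\<integral>y. f y \<partial>mixture P k Y) = (\<integral>x. \<integral>y. f y \<partial>k x \<partial>P)"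
proof -
  note s = finite_kernelD(1)[OF k] and sp = finite_kernelD(2)[OF k]
  have spm: "space (mixture P k Y) = space Y" by (rule sets_eq_imp_space_eq) simp
  have fk: "f \<in> borel_measurable (k x)" if "x \<in> space P" for x
    using that f by (simp add: measurable_cong_sets[OF s refl])
  have le: "(\<integral>\<^sup>+y. ennreal (f y) \<partial>k x) \<le> ennreal c * emeasure (k x) (space Y)" if "x \<in> space P" for x
  proof -
    have "(\<integral>\<^sup>+y. ennreal (f y) \<partial>k x) \<le> (\<integral>\<^sup>+y. ennreal c \<partial>k x)"
      using bd sp[OF that] by (intro nn_integral_mono ennreal_leI) auto
    then show ?thesis using sp[OF that] by simp
  qed
  have eq: "ennreal (\<integral>y. f y \<partial>k x) = (\<integral>\<^sup>+y. ennreal (f y) \<partial>k x)" if "x \<in> space P" for x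
  proof -
    interpret finite_measure "k x" using finite_kernelD(3)[OF k that] .
    have "(\<integral>\<^sup>+y. ennreal (f y) \<partial>k x) < \<infinity>"
      by (rule le_less_trans[OF le[OF that]]) (use emeasure_finite[of "space Y"] less_top[of "emeasure (k x) (space Y)"] in \<open>simp add: ennreal_mult_less_top\<close>)
    then have "integrable (k x) f"
      using fk[OF that] bd sp[OF that] by (intro integrableI_nonneg) (auto intro!: AE_I2)
    then show ?thesis
      using bd sp[OF that] by (intro nn_integral_eq_integral[symmetric]) (auto intro!: AE_I2)
  qed
  have meas: "(\<lambda>x. \<integral>\<^sup>+y. ennreal (f y) \<partial>k x) \<in> borel_measurable P"
    using finite_kernel_nn_integral_measurable[OF k measurable_ident, of "\<lambda>(x, y). ennreal (f y)"] f by simp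
  have nn: "0 \<le> (\<integral>y. f y \<partial>k x)" if "x \<in> space P" for x
    using bd sp[OF that] by (intro integral_nonneg_AE) (auto intro!: AE_I2)
  have measI: "(\<lambda>x. \<integral>y. f y \<partial>k x) \<in> borel_measurable P"
  proof (rule measurable_cong[THEN iffD1])
    show "(\<lambda>x. enn2real (\<integral>\<^sup>+y. ennreal (f y) \<partial>k x)) \<in> borel_measurable P" using meas by measurable
    show "enn2real (\<integral>\<^sup>+y. ennreal (f y) \<partial>k x) = (\<integral>y. f y \<partial>k x)" if "x \<in> space P" for x
      using eq[OF that] nn[OF that] by (metis enn2real_ennreal)
  qed
  have int: "(\<integral>\<^sup>+x. ennreal (\<integral>y. f y \<partial>k x) \<partial>P) = (\<integral>\<^sup>+y. ennreal (f y) \<partial>mixture P k Y)"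
    using nn_integral_mixture[OF k, of "\<lambda>y. ennreal (f y)"] f eq by (simp cong: nn_integral_cong)
  have "(\<integral>\<^sup>+x. ennreal (\<integral>y. f y \<partial>k x) \<partial>P) \<le> (\<integral>\<^sup>+x. ennreal c * emeasure (k x) (space Y) \<partial>P)"
    using eq le by (intro nn_integral_mono) simp
  also have "\<dots> = ennreal c * (\<integral>\<^sup>+x. emeasure (k x) (space Y) \<partial>P)"
    using finite_kernelD(4)[OF k] by (intro nn_integral_cmult) auto
  also have "\<dots> < \<infinity>" using fin by (simp add: ennreal_mult_less_top)
  finally have "integrable P (\<lambda>x. \<integral>y. f y \<partial>k x)"
    using measI nn by (intro integrableI_nonneg) (auto intro!: AE_I2)
  moreover have "(\<integral>x. \<integral>y. f y \<partial>k x \<partial>P) = enn2real (\<integral>\<^sup>+x. ennreal (\<integral>y. f y \<partial>k x) \<partial>P)"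
    using measI nn by (intro integral_eq_nn_integral) (auto intro!: AE_I2)
  moreover have "(\<integral>y. f y \<partial>mixture P k Y) = enn2real (\<integral>\<^sup>+y. ennreal (f y) \<partial>mixture P k Y)"
    using f bd spm by (intro integral_eq_nn_integral) (auto intro!: AE_I2)
  ultimately show ?thesis using int by simp
qed

lemma integral_mixture_real:
  fixes f :: "'y \<Rightarrow> real"
  assumes k: "finite_kernel P Y k" and f: "f \<in> borel_measurable Y"
    and bd: "\<And>y. y \<in> space Y \<Longrightarrow> \<bar>f y\<bar> \<le> c"
    and fin: "(\<integral>\<^sup>+x. emeasure (k x) (space Y) \<partial>P) < \<infinity>"
  shows "integrable P (\<lambda>x. \<integral>y. f y \<partial>k x) \<and> (\<integral>y. f y \<partial>mixture P k Y) = (\<integral>x. \<integral>y. f y \<partial>k x \<partial>P)"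
proof -
  let ?p = "\<lambda>y. max 0 (f y)" and ?n = "\<lambda>y. max 0 (- f y)"
  have p: "integrable P (\<lambda>x. \<integral>y. ?p y \<partial>k x) \<and> (\<integral>y. ?p y \<partial>mixture P k Y) = (\<integral>x. \<integral>y. ?p y \<partial>k x \<partial>P)"
    by (rule integral_mixture_nonneg[OF k _ _ fin, where c=c]) (use f bd in \<open>force+\<close>)
  have n: "integrable P (\<lambda>x. \<integral>y. ?n y \<partial>k x) \<and> (\<integral>y. ?n y \<partial>mixture P k Y) = (\<integral>x. \<integral>y. ?n y \<partial>k x \<partial>P)"
    by (rule integral_mixture_nonneg[OF k _ _ fin, where c=c]) (use f bd in \<open>force+\<close>)
  have bounded_int: "integrable N g" if "finite_measure N" "sets N = sets Y" "g \<in> borel_measurable Y"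
    "\<And>y. y \<in> space Y \<Longrightarrow> \<bar>g y\<bar> \<le> c" for N and g :: "'y \<Rightarrow> real"
    using that by (intro finite_measure.integrable_const_bound[where B=c])
      (auto simp: measurable_cong_sets[OF that(2) refl] sets_eq_imp_space_eq[OF that(2)] intro!: AE_I2)
  have split: "(\<integral>y. f y \<partial>N) = (\<integral>y. ?p y \<partial>N) - (\<integral>y. ?n y \<partial>N)" if "finite_measure N" "sets N = sets Y" for N
  proof -
    have "(\<integral>y. f y \<partial>N) = (\<integral>y. ?p y - ?n y \<partial>N)" by (intro Bochner_Integration.integral_cong) auto
    also have "\<dots> = (\<integral>y. ?p y \<partial>N) - (\<integral>y. ?n y \<partial>N)"
      by (intro Bochner_Integration.integral_diff bounded_int that) (use f bd in \<open>force+\<close>)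
    finally show ?thesis .
  qed
  have kx: "(\<integral>y. f y \<partial>k x) = (\<integral>y. ?p y \<partial>k x) - (\<integral>y. ?n y \<partial>k x)" if "x \<in> space P" for x
    using finite_kernelD[OF k] that by (intro split) auto
  have mix: "(\<integral>y. f y \<partial>mixture P k Y) = (\<integral>y. ?p y \<partial>mixture P k Y) - (\<integral>y. ?n y \<partial>mixture P k Y)"
    by (intro split finite_measure_mixture[OF k fin]) simp
  have "integrable P (\<lambda>x. (\<integral>y. ?p y \<partial>k x) - (\<integral>y. ?n y \<partial>k x))"
    using p n by (intro Bochner_Integration.integrable_diff) auto
  then have "integrable P (\<lambda>x. \<integral>y. f y \<partial>k x)"
    by (subst Bochner_Integration.integrable_cong[OF refl]) (erule kx)
  moreover have "(\<integral>x. \<integral>y. f y \<partial>k x \<partial>P) = (\<integral>x. (\<integral>y. ?p y \<partial>k x) - (\<integral>y. ?n y \<partial>k x) \<partial>P)"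
    by (intro Bochner_Integration.integral_cong refl kx)
  moreover have "\<dots> = (\<integral>x. \<integral>y. ?p y \<partial>k x \<partial>P) - (\<integral>x. \<integral>y. ?n y \<partial>k x \<partial>P)"
    using p n by (intro Bochner_Integration.integral_diff) auto
  ultimately show ?thesis using p n mix by simp
qed

lemma integral_complex_of_re_im:
  assumes "integrable P u" "integrable P v"
  shows "(\<integral>x. Complex (u x) (v x) \<partial>P) = Complex (\<integral>x. u x \<partial>P) (\<integral>x. v x \<partial>P)"
proof -
  have "integrable P (\<lambda>x. Complex (u x) (v x))" 
    unfolding Complex_eq using assms by (intro Bochner_Integration.integrable_add integrable_mult_right integrable_of_real)
  from integral_Re[OF this] integral_Im[OF this] show ?thesis by (simp add: complex_eq_iff)
qed

text \<open>
  For bounded integrands all integrals reduce to nonnegative ones, where the mixture formula is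
  monotone convergence: split into real and imaginary, then into positive and negative parts.
\<close>

lemma integral_mixture:
  fixes f :: "'y \<Rightarrow> complex"
  assumes k: "finite_kernel P Y k" and f: "f \<in> borel_measurable Y"
    and bd: "\<And>y. y \<in> space Y \<Longrightarrow> norm (f y) \<le> c"
    and fin: "(\<integral>\<^sup>+x. emeasure (k x) (space Y) \<partial>P) < \<infinity>"
  shows "integrable P (\<lambda>x. \<integral>y. f y \<partial>k x)" "(\<integral>y. f y \<partial>mixture P k Y) = (\<integral>x. \<integral>y. f y \<partial>k x \<partial>P)"
proof -
  have bounded_int: "integrable N f" if "finite_measure N" "sets N = sets Y" for N
    using that f bd by (intro finite_measure.integrable_const_bound[where B=c])
      (auto simp: measurable_cong_sets[OF that(2) refl] sets_eq_imp_space_eq[OF that(2)] intro!: AE_I2)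
  have re: "integrable P (\<lambda>x. \<integral>y. Re (f y) \<partial>k x) \<and> (\<integral>y. Re (f y) \<partial>mixture P k Y) = (\<integral>x. \<integral>y. Re (f y) \<partial>k x \<partial>P)"
    by (rule integral_mixture_real[OF k _ _ fin, where c=c]) (use f bd in \<open>auto intro: order_trans[OF abs_Re_le_cmod]\<close>)
  have im: "integrable P (\<lambda>x. \<integral>y. Im (f y) \<partial>k x) \<and> (\<integral>y. Im (f y) \<partial>mixture P k Y) = (\<integral>x. \<integral>y. Im (f y) \<partial>k x \<partial>P)"
    by (rule integral_mixture_real[OF k _ _ fin, where c=c]) (use f bd in \<open>auto intro: order_trans[OF abs_Im_le_cmod]\<close>)
  have split: "(\<integral>y. f y \<partial>N) = Complex (\<integral>y. Re (f y) \<partial>N) (\<integral>y. Im (f y) \<partial>N)" 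
    if "finite_measure N" "sets N = sets Y" for N
    using bounded_int[OF that] by (simp add: complex_eq_iff)
  have kx: "(\<integral>y. f y \<partial>k x) = Complex (\<integral>y. Re (f y) \<partial>k x) (\<integral>y. Im (f y) \<partial>k x)" if "x \<in> space P" for x
    using finite_kernelD[OF k] that by (intro split) auto
  have "integrable P (\<lambda>x. Complex (\<integral>y. Re (f y) \<partial>k x) (\<integral>y. Im (f y) \<partial>k x))"
    unfolding Complex_eq using re im by (intro Bochner_Integration.integrable_add integrable_mult_right integrable_of_real) auto
  then show int: "integrable P (\<lambda>x. \<integral>y. f y \<partial>k x)"
    by (subst Bochner_Integration.integrable_cong[OF refl]) (erule kx)
  have "(\<integral>x. \<integral>y. f y \<partial>k x \<partial>P) = (\<integral>x. Complex (\<integral>y. Re (f y) \<partial>k x) (\<integral>y. Im (f y) \<partial>k x) \<partial>P)"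
    by (intro Bochner_Integration.integral_cong refl kx)
  also have "\<dots> = Complex (\<integral>x. \<integral>y. Re (f y) \<partial>k x \<partial>P) (\<integral>x. \<integral>y. Im (f y) \<partial>k x \<partial>P)"
    using re im by (intro integral_complex_of_re_im) auto
  finally show "(\<integral>y. f y \<partial>mixture P k Y) = (\<integral>x. \<integral>y. f y \<partial>k x \<partial>P)"
    using re im split[OF finite_measure_mixture[OF k fin]] by simp
qed

section \<open>Disintegration over the positive reals and multiplicative convolution\<close>

lemma space_rpos[simp]: "space rpos = {0<..}"
  by (simp add: rpos_def space_restrict_space)

lemma sets_rpos: "E \<in> sets rpos \<longleftrightarrow> E \<subseteq> {0<..} \<and> E \<in> sets borel"
  unfolding rpos_def by (subst sets_restrict_space_iff) auto

lemma rpos_measurable: "f \<in> M \<rightarrow>\<^sub>M rpos \<Longrightarrow> f \<in> borel_measurable M"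
  by (simp add: rpos_def measurable_restrict_space2_iff)

lemma id_rpos_borel: "(\<lambda>x. x) \<in> borel_measurable rpos"
  by (rule rpos_measurable) simp

lemma snd_rpos_borel[measurable]: "snd \<in> borel_measurable (B \<Otimes>\<^sub>M rpos)"
  by (rule rpos_measurable) simp

lemma fst_rpos_borel[measurable]: "fst \<in> borel_measurable (rpos \<Otimes>\<^sub>M B)"
  by (rule rpos_measurable) simp

lemma measurable_rposI:
  "f \<in> borel_measurable M \<Longrightarrow> (\<And>x. x \<in> space M \<Longrightarrow> f x > 0) \<Longrightarrow> f \<in> M \<rightarrow>\<^sub>M rpos"
  by (auto simp: rpos_def measurable_restrict_space2_iff)

text \<open>
  Both sides are integrals against one measure, the mixture of the measures \<open>q b\<close> placed on the
  fibres \<open>{b} \<times> Y\<close>; it agrees with \<open>\<nu>\<close> on rectangles.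
\<close>

lemma nn_integral_disintegration:
  assumes q: "finite_kernel B Y q" and sets_\<nu>: "sets \<nu> = sets (B \<Otimes>\<^sub>M Y)" and fin: "finite_measure \<nu>"
    and \<nu>: "\<And>N E. N \<in> sets B \<Longrightarrow> E \<in> sets Y \<Longrightarrow> emeasure \<nu> (N \<times> E) = (\<integral>\<^sup>+b\<in>N. emeasure (q b) E \<partial>B)"
    and f: "f \<in> borel_measurable (B \<Otimes>\<^sub>M Y)"
  shows "(\<integral>\<^sup>+z. f z \<partial>\<nu>) = (\<integral>\<^sup>+b. \<integral>\<^sup>+y. f (b, y) \<partial>q b \<partial>B)"
proof -
  define k where "k b = distr (q b) (B \<Otimes>\<^sub>M Y) (\<lambda>y. (b, y))" for b
  have k: "finite_kernel B (B \<Otimes>\<^sub>M Y) k"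
    unfolding k_def using finite_kernel_distr[OF q measurable_ident, of "\<lambda>z. z"] by simp
  have pm: "Pair b \<in> q b \<rightarrow>\<^sub>M B \<Otimes>\<^sub>M Y" if "b \<in> space B" for b
    using that by (simp add: measurable_cong_sets[OF finite_kernelD(1)[OF q that] refl])
  have "\<nu> = mixture B k (B \<Otimes>\<^sub>M Y)"
  proof (rule measure_eqI_pair[OF sets_\<nu> sets_mixture fin])
    fix N E assume NE: "N \<in> sets B" "E \<in> sets Y"
    have "emeasure (k b) (N \<times> E) = emeasure (q b) E * indicator N b" if b: "b \<in> space B" for b
    proof -
      have "Pair b -` (N \<times> E) \<inter> space (q b) = (if b \<in> N then E else {})"
        using finite_kernelD(2)[OF q b] sets.sets_into_space[OF NE(2)] by auto
      then show ?thesis unfolding k_def using NE by (subst emeasure_distr[OF pm[OF b]]) auto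
    qed
    then show "emeasure \<nu> (N \<times> E) = emeasure (mixture B k (B \<Otimes>\<^sub>M Y)) (N \<times> E)"
      unfolding \<nu>[OF NE] emeasure_mixture[OF k pair_measureI[OF NE]]
      by (intro nn_integral_cong) simp
  qed
  then have "(\<integral>\<^sup>+z. f z \<partial>\<nu>) = (\<integral>\<^sup>+b. \<integral>\<^sup>+z. f z \<partial>k b \<partial>B)"
    using nn_integral_mixture[OF k f] by simp
  also have "\<dots> = (\<integral>\<^sup>+b. \<integral>\<^sup>+y. f (b, y) \<partial>q b \<partial>B)"
    unfolding k_def by (intro nn_integral_cong nn_integral_distr[OF pm]) (simp_all add: f)
  finally show ?thesis .
qed

text \<open>
  The vanishing on null sets of \<open>B\<close> replaces the assumption that the marginal is \<open>B\<close> itself: the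
  conditional distributions of \<open>\<nu>\<close> are rescaled by the density of its marginal. The finite
  first moment makes almost all fibres lie in \<^const>\<open>mtri\<close>; the remaining ones are set to zero.
\<close>

lemma disintegration:
  fixes \<nu> :: "('b \<times> real) measure"
  assumes B: "finite_measure B"
    and sets_\<nu>: "sets \<nu> = sets (B \<Otimes>\<^sub>M rpos)" and fin: "finite_measure \<nu>"
    and t: "(\<integral>\<^sup>+z. ennreal (snd z) \<partial>\<nu>) < \<infinity>"
    and null: "\<And>N. N \<in> null_sets B \<Longrightarrow> emeasure \<nu> (N \<times> {0<..}) = 0"
  obtains p where "finite_kernel B rpos p" "\<And>b. b \<in> space B \<Longrightarrow> p b \<in> mtri"
    "\<And>N E. N \<in> sets B \<Longrightarrow> E \<in> sets rpos \<Longrightarrow> emeasure \<nu> (N \<times> E) = (\<integral>\<^sup>+b\<in>N. emeasure (p b) E \<partial>B)"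
proof -
  interpret B: finite_measure B by fact
  interpret \<nu>: finite_measure \<nu> by fact
  note [measurable_cong] = sets_\<nu>
  have sp_\<nu>: "space \<nu> = space B \<times> {0<..}"
    using sets_eq_imp_space_eq[OF sets_\<nu>] by (simp add: space_pair_measure)
  have S2: "N \<times> {0<..} \<in> sets \<nu>" if "N \<in> sets B" for N
    using pair_measureI[OF that sets.top[of rpos]] by (simp add: sets_\<nu>)
  have pos: "E \<inter> {0<..} \<in> sets rpos" if "E \<in> sets borel" for E :: "real set"
    using that by (simp add: sets_rpos)
  have S1: "space B \<times> (E \<inter> {0<..}) \<in> sets \<nu>" if "E \<in> sets borel" for E
    using pair_measureI[OF sets.top pos[OF that]] by (simp add: sets_\<nu>)
  define m where "m N E = emeasure \<nu> (N \<times> (E \<inter> {0<..}))" for N and E :: "real set"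
  have m: "bimeasure B borel m"
    unfolding bimeasure_def
  proof (intro conjI ballI)
    show "m (space B) (space borel) < \<infinity>" by (simp add: m_def less_top[symmetric])
    show "\<exists>\<mu>. sets \<mu> = sets B \<and> (\<forall>N\<in>sets B. emeasure \<mu> N = m N E)" if E: "E \<in> sets borel" for E
    proof (intro exI[of _ "distr (density \<nu> (indicator (space B \<times> (E \<inter> {0<..})))) B fst"] conjI ballI)
      fix N assume N: "N \<in> sets B"
      have "emeasure (distr (density \<nu> (indicator (space B \<times> (E \<inter> {0<..})))) B fst) N =
         emeasure (density \<nu> (indicator (space B \<times> (E \<inter> {0<..})))) (N \<times> {0<..})"
        using N sets.sets_into_space[OF N] by (subst emeasure_distr) (auto simp: sp_\<nu> intro!: arg_cong2[where f=emeasure])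
      also have "\<dots> = emeasure \<nu> ((space B \<times> (E \<inter> {0<..})) \<inter> (N \<times> {0<..}))"
        using S1[OF E] S2[OF N]
        by (subst emeasure_density) (simp_all add: nn_integral_indicator sets.Int flip: indicator_inter_arith)
      also have "(space B \<times> (E \<inter> {0<..})) \<inter> (N \<times> {0<..}) = N \<times> (E \<inter> {0<..})"
        using sets.sets_into_space[OF N] by auto
      finally show "emeasure (distr (density \<nu> (indicator (space B \<times> (E \<inter> {0<..})))) B fst) N = m N E"
        by (simp add: m_def)
    qed simp
    fix N assume N: "N \<in> sets B"
    show "\<exists>\<mu>. sets \<mu> = sets borel \<and> (\<forall>E\<in>sets borel. emeasure \<mu> E = m N E)"
    proof (intro exI[of _ "distr (density \<nu> (indicator (N \<times> {0<..}))) borel snd"] conjI ballI)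
      fix E :: "real set" assume E: "E \<in> sets borel"
      have "emeasure (distr (density \<nu> (indicator (N \<times> {0<..}))) borel snd) E =
         emeasure (density \<nu> (indicator (N \<times> {0<..}))) (space B \<times> (E \<inter> {0<..}))"
        using E by (subst emeasure_distr) (auto simp: sp_\<nu> intro!: arg_cong2[where f=emeasure])
      also have "\<dots> = emeasure \<nu> ((N \<times> {0<..}) \<inter> (space B \<times> (E \<inter> {0<..})))"
        using S1[OF E] S2[OF N]
        by (subst emeasure_density) (simp_all add: nn_integral_indicator sets.Int flip: indicator_inter_arith)
      also have "(N \<times> {0<..}) \<inter> (space B \<times> (E \<inter> {0<..})) = N \<times> (E \<inter> {0<..})"
        using sets.sets_into_space[OF N] by auto
      finally show "emeasure (distr (density \<nu> (indicator (N \<times> {0<..}))) borel snd) E = m N E"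
        by (simp add: m_def)
    qed simp
  qed
  define \<eta> where "\<eta> = distr \<nu> B fst"
  have sets_\<eta>: "sets \<eta> = sets B" by (simp add: \<eta>_def)
  have \<eta>: "emeasure \<eta> N = m N UNIV" if "N \<in> sets B" for N
    unfolding \<eta>_def m_def using that sets.sets_into_space[OF that]
    by (subst emeasure_distr) (auto simp: sp_\<nu> intro!: arg_cong2[where f=emeasure])
  obtain \<kappa> where \<kappa>: "\<kappa> \<in> B \<rightarrow>\<^sub>M prob_algebra borel"
    and m_\<kappa>: "\<And>N E. N \<in> sets B \<Longrightarrow> E \<in> sets borel \<Longrightarrow> m N E = (\<integral>\<^sup>+b\<in>N. emeasure (\<kappa> b) E \<partial>\<eta>)"
    using bimeasure_kernel[OF m sets_\<eta> \<eta>] by blast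
  note \<kappa>' = measurable_prob_algebraD[OF \<kappa>]
  have "absolutely_continuous B \<eta>"
    unfolding absolutely_continuous_def using null \<eta> sets_\<eta> by (auto simp: null_sets_def m_def)
  then obtain f where f[measurable]: "f \<in> borel_measurable B" and f\<eta>: "density B f = \<eta>"
    using B.Radon_Nikodym sets_\<eta> by blast
  have "(\<integral>\<^sup>+b. f b \<partial>B) = emeasure \<eta> (space B)"
    unfolding f\<eta>[symmetric] by (subst emeasure_density) (auto intro!: nn_integral_cong)
  also have "\<dots> < \<infinity>" using \<eta>[OF sets.top] by (simp add: m_def less_top[symmetric])
  finally have fin_f: "AE b in B. f b \<noteq> \<infinity>"
    by (intro nn_integral_PInf_AE) auto
  \<comment> \<open>The density of the marginal is finite almost everywhere; elsewhere \<open>D\<close> is 0.\<close>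
  define D where "D b = enn2real (f b)" for b
  have [measurable]: "D \<in> borel_measurable B" unfolding D_def by measurable
  define q where "q b = density (restrict_space (\<kappa> b) {0<..}) (\<lambda>_. ennreal (D b))" for b
  have s\<kappa>: "sets (\<kappa> b) = sets borel" if "b \<in> space B" for b using sets_kernel[OF \<kappa>' that] .
  have sq: "sets (q b) = sets rpos" if "b \<in> space B" for b
    unfolding q_def rpos_def using sets_restrict_space_cong[OF s\<kappa>[OF that]] by simp
  have emq: "emeasure (q b) E = ennreal (D b) * emeasure (\<kappa> b) E" if "b \<in> space B" "E \<in> sets rpos" for b E
  proof -
    have "E \<in> sets (restrict_space (\<kappa> b) {0<..})"
      using sq[OF that(1)] that(2) by (simp add: q_def)
    then show ?thesis
      unfolding q_def using that s\<kappa>[OF that(1)] sets_eq_imp_space_eq[OF s\<kappa>[OF that(1)]]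
      by (subst emeasure_density_const) (auto simp: emeasure_restrict_space sets_rpos)
  qed
  have qk: "finite_kernel B rpos q"
    unfolding finite_kernel_def
  proof (intro conjI ballI)
    show "finite_measure (q b)" if b: "b \<in> space B" for b
    proof
      interpret subprob_space "\<kappa> b" using subprob_space_kernel[OF \<kappa>' b] .
      have "emeasure (q b) (space (q b)) = ennreal (D b) * emeasure (\<kappa> b) {0<..}"
        using emq[OF b sets.top] sets_eq_imp_space_eq[OF sq[OF b]] by simp
      then show "emeasure (q b) (space (q b)) \<noteq> \<infinity>" by (simp add: ennreal_mult_eq_top_iff)
    qed
    fix E assume E: "E \<in> sets rpos"
    then have "E \<in> sets borel" by (simp add: sets_rpos)
    from measurable_emeasure_kernel[OF \<kappa>' this]
    have "(\<lambda>b. ennreal (D b) * emeasure (\<kappa> b) E) \<in> borel_measurable B" by measurable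
    then show "(\<lambda>b. emeasure (q b) E) \<in> borel_measurable B"
      by (rule measurable_congI) (simp add: emq E)
  qed (rule sq)
  have \<nu>q: "emeasure \<nu> (N \<times> E) = (\<integral>\<^sup>+b\<in>N. emeasure (q b) E \<partial>B)" if N: "N \<in> sets B" and E: "E \<in> sets rpos" for N E
  proof -
    have Eb: "E \<in> sets borel" "E \<inter> {0<..} = E" using E by (auto simp: sets_rpos)
    have "emeasure \<nu> (N \<times> E) = (\<integral>\<^sup>+b\<in>N. emeasure (\<kappa> b) E \<partial>\<eta>)"
      using m_\<kappa>[OF N Eb(1)] Eb(2) by (simp add: m_def)
    also have "\<dots> = (\<integral>\<^sup>+b. f b * (emeasure (\<kappa> b) E * indicator N b) \<partial>B)"
      unfolding f\<eta>[symmetric] using measurable_emeasure_kernel[OF \<kappa>' Eb(1)] N by (subst nn_integral_density) auto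
    also have "\<dots> = (\<integral>\<^sup>+b\<in>N. emeasure (q b) E \<partial>B)"
    proof (rule nn_integral_cong_AE)
      show "AE b in B. f b * (emeasure (\<kappa> b) E * indicator N b) = emeasure (q b) E * indicator N b"
        using fin_f AE_space by eventually_elim (simp add: emq E D_def less_top mult.assoc)
    qed
    finally show ?thesis .
  qed
  define T where "T b = (\<integral>\<^sup>+t. ennreal t \<partial>q b)" for b
  have T[measurable]: "T \<in> borel_measurable B"
    unfolding T_def using finite_kernel_nn_integral_measurable[OF qk measurable_ident, of "\<lambda>z. ennreal (snd z)"]
      measurable_compose[OF snd_rpos_borel[of B] measurable_ennreal] by simp
  have "(\<integral>\<^sup>+z. ennreal (snd z) \<partial>\<nu>) = (\<integral>\<^sup>+b. \<integral>\<^sup>+t. ennreal (snd (b, t)) \<partial>q b \<partial>B)"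
    by (rule nn_integral_disintegration[OF qk sets_\<nu> fin])
       (use \<nu>q measurable_compose[OF snd_rpos_borel measurable_ennreal] in blast)+
  then have "(\<integral>\<^sup>+z. ennreal (snd z) \<partial>\<nu>) = (\<integral>\<^sup>+b. T b \<partial>B)"
    by (simp add: T_def)
  with t have T_fin: "AE b in B. T b \<noteq> \<infinity>"
    by (intro nn_integral_PInf_AE) auto
  define p where "p b = (if T b < \<infinity> then q b else null_measure rpos)" for b
  show thesis
  proof (rule that)
    show "finite_kernel B rpos p"
      unfolding finite_kernel_def
    proof (intro conjI ballI)
      show "sets (p b) = sets rpos" "finite_measure (p b)" if "b \<in> space B" for b
        using finite_kernelD[OF qk] that by (auto simp: p_def intro: finite_measureI)
      fix E assume "E \<in> sets rpos"
      then have "(\<lambda>b. if T b < \<infinity> then emeasure (q b) E else 0) \<in> borel_measurable B"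
        using finite_kernelD(4)[OF qk] by measurable
      then show "(\<lambda>b. emeasure (p b) E) \<in> borel_measurable B"
        by (rule measurable_congI) (simp add: p_def)
    qed
    show "p b \<in> mtri" if b: "b \<in> space B" for b
      using finite_kernelD(1,2)[OF qk b] finite_measure.emeasure_finite[OF finite_kernelD(3)[OF qk b]]
      by (auto simp: p_def mtri_def T_def less_top)
    fix N E assume "N \<in> sets B" "E \<in> sets rpos"
    then have "emeasure \<nu> (N \<times> E) = (\<integral>\<^sup>+b\<in>N. emeasure (q b) E \<partial>B)" by (rule \<nu>q)
    also have "\<dots> = (\<integral>\<^sup>+b\<in>N. emeasure (p b) E \<partial>B)"
      using T_fin by (intro nn_integral_cong_AE) (auto simp: p_def less_top)
    finally show "emeasure \<nu> (N \<times> E) = (\<integral>\<^sup>+b\<in>N. emeasure (p b) E \<partial>B)" .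
  qed
qed

text \<open>
  Half-lines with rational end points determine a measure. Only countably many sets are needed,
  so equality on each of them almost everywhere gives equality of kernels almost everywhere.
\<close>

lemma mtri_eqI:
  assumes \<mu>: "\<mu> \<in> mtri" and \<nu>: "\<nu> \<in> mtri"
    and eq: "\<And>r. r \<in> \<rat> \<Longrightarrow> emeasure \<mu> ({r<..} \<inter> {0<..}) = emeasure \<nu> ({r<..} \<inter> {0<..})"
  shows "\<mu> = \<nu>"
proof -
  have s: "sets \<mu> = sets rpos" "sets \<nu> = sets rpos" and fin: "finite_measure \<mu>" "finite_measure \<nu>"
    using \<mu> \<nu> by (auto simp: mtri_def less_top intro: finite_measureI)
  let ?e = "\<lambda>\<mu>. distr \<mu> borel (\<lambda>x. x :: real)"
  have em: "emeasure (?e \<mu>) E = emeasure \<mu> (E \<inter> {0<..})" if "sets \<mu> = sets rpos" "E \<in> sets borel" for E \<mu>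
  proof -
    have "(\<lambda>x. x) \<in> \<mu> \<rightarrow>\<^sub>M borel" using id_rpos_borel by (simp add: measurable_cong_sets[OF that(1) refl])
    then show ?thesis using that sets_eq_imp_space_eq[OF that(1)] by (simp add: emeasure_distr)
  qed
  have eq': "emeasure \<mu> ({x<..} \<inter> {0<..}) = emeasure \<nu> ({x<..} \<inter> {0<..})" for x
  proof -
    obtain r where r: "\<And>n. r n \<in> \<rat>" "\<And>n. x < r n" "r \<longlonglongrightarrow> x" "decseq r"
      using rational_decseq_above[of x] by blast
    have inc: "incseq (\<lambda>n. {r n<..} \<inter> {0<..})"
      unfolding incseq_def using decseqD[OF r(4)] by (auto intro: le_less_trans)
    have un: "(\<Union>n. {r n<..} \<inter> {0<..}) = {x<..} \<inter> {0<..}"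
    proof -
      have "\<exists>n. r n < y" if "x < y" for y
        using order_tendstoD(2)[OF r(3) that] by (auto simp: eventually_sequentially)
      then show ?thesis using r(2) by (auto intro: less_trans)
    qed
    have l1: "(\<lambda>n. emeasure \<mu> ({r n<..} \<inter> {0<..})) \<longlonglongrightarrow> emeasure \<mu> (\<Union>n. {r n<..} \<inter> {0<..})"
      by (rule Lim_emeasure_incseq) (use inc in \<open>auto simp: s sets_rpos\<close>)
    have l2: "(\<lambda>n. emeasure \<nu> ({r n<..} \<inter> {0<..})) \<longlonglongrightarrow> emeasure \<nu> (\<Union>n. {r n<..} \<inter> {0<..})"
      by (rule Lim_emeasure_incseq) (use inc in \<open>auto simp: s sets_rpos\<close>)
    show ?thesis
      using LIMSEQ_unique[OF l1[unfolded eq[OF r(1)]] l2] unfolding un .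
  qed
  have "?e \<mu> = ?e \<nu>"
  proof (rule measure_eqI_lessThan)
    show "emeasure (?e \<mu>) {x<..} < \<infinity>" for x
      using em[OF s(1)] finite_measure.emeasure_finite[OF fin(1)] by (simp add: less_top)
    show "emeasure (?e \<mu>) {x<..} = emeasure (?e \<nu>) {x<..}" for x
      using em[OF s(1)] em[OF s(2)] eq' by simp
  qed simp_all
  show ?thesis
  proof (rule measure_eqI)
    fix E assume "E \<in> sets \<mu>"
    then have E: "E \<in> sets borel" "E \<inter> {0<..} = E" by (auto simp: s sets_rpos)
    show "emeasure \<mu> E = emeasure \<nu> E"
      using em[OF s(1) E(1)] em[OF s(2) E(1)] \<open>?e \<mu> = ?e \<nu>\<close> E(2) by simp
  qed (simp add: s)
qed

text \<open>
  This makes the densities in the definition of the product immaterial.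
\<close>

lemma measure_integral_density_unique:
  assumes B: "finite_measure B"
    and \<kappa>: "\<And>N. N \<in> sets B \<Longrightarrow> is_measure_integral B N \<kappa> (\<mu> N)"
    and \<kappa>': "\<And>N. N \<in> sets B \<Longrightarrow> is_measure_integral B N \<kappa>' (\<mu> N)"
  shows "AE b in B. \<kappa> b = \<kappa>' b"
proof -
  interpret finite_measure B by fact
  have *: "AE b in B. emeasure (\<kappa> b) E = emeasure (\<kappa>' b) E" if E: "E \<in> sets rpos" for E
  proof -
    have "(\<lambda>b. emeasure (\<kappa> b) E) \<in> borel_measurable (completion B)"
      "(\<lambda>b. emeasure (\<kappa>' b) E) \<in> borel_measurable (completion B)"
      using \<kappa>[OF sets.top] \<kappa>'[OF sets.top] E unfolding is_measure_integral_def by blast+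
    then obtain f g where f: "f \<in> borel_measurable B" "AE b in B. emeasure (\<kappa> b) E = f b"
      and g: "g \<in> borel_measurable B" "AE b in B. emeasure (\<kappa>' b) E = g b"
      using completion_ex_borel_measurable by metis
    have "AE b in B. f b = g b"
    proof (rule density_unique_finite_measure[OF f(1) g(1)])
      fix N assume N: "N \<in> sets B"
      have "(\<integral>\<^sup>+b\<in>N. f b \<partial>B) = (\<integral>\<^sup>+b\<in>N. emeasure (\<kappa> b) E \<partial>B)"
        using f(2) by (intro nn_integral_cong_AE) (auto elim!: eventually_mono)
      also have "\<dots> = (\<integral>\<^sup>+b\<in>N. emeasure (\<kappa>' b) E \<partial>B)"
        using \<kappa>[OF N] \<kappa>'[OF N] E unfolding is_measure_integral_def by metis
      also have "\<dots> = (\<integral>\<^sup>+b\<in>N. g b \<partial>B)"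
        using g(2) by (intro nn_integral_cong_AE) (auto elim!: eventually_mono)
      finally show "(\<integral>\<^sup>+b\<in>N. f b \<partial>B) = (\<integral>\<^sup>+b\<in>N. g b \<partial>B)" .
    qed auto
    with f(2) g(2) show ?thesis by eventually_elim simp
  qed
  have "AE b in B. \<forall>r\<in>\<rat>. emeasure (\<kappa> b) ({r<..} \<inter> {0<..}) = emeasure (\<kappa>' b) ({r<..} \<inter> {0<..})"
    by (subst AE_ball_countable[OF countable_rat]) (auto intro!: * simp: sets_rpos)
  moreover have "AE b in B. \<kappa> b \<in> mtri" "AE b in B. \<kappa>' b \<in> mtri"
    using \<kappa>[OF sets.top] \<kappa>'[OF sets.top] unfolding is_measure_integral_def by blast+
  ultimately show ?thesis
    by eventually_elim (auto intro: mtri_eqI)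
qed

lemma mult_rpos_measurable: "(\<lambda>(s, t). s * t) \<in> rpos \<Otimes>\<^sub>M rpos \<rightarrow>\<^sub>M rpos"
  unfolding case_prod_beta'
  by (intro measurable_rposI borel_measurable_times snd_rpos_borel fst_rpos_borel) (auto simp: space_pair_measure)

lemma mult_convolution_nn_integral:
  assumes \<mu>: "sets \<mu> = sets rpos" "finite_measure \<mu>" and \<nu>: "sets \<nu> = sets rpos" "finite_measure \<nu>"
    and f: "f \<in> borel_measurable rpos"
  shows "(\<integral>\<^sup>+t. f t \<partial>mult_convolution \<mu> \<nu>) = (\<integral>\<^sup>+s. \<integral>\<^sup>+u. f (s * u) \<partial>\<mu> \<partial>\<nu>)"
    and "(\<integral>\<^sup>+t. f t \<partial>mult_convolution \<mu> \<nu>) = (\<integral>\<^sup>+u. \<integral>\<^sup>+s. f (u * s) \<partial>\<nu> \<partial>\<mu>)"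
proof -
  interpret \<mu>: finite_measure \<mu> by fact
  interpret \<nu>: finite_measure \<nu> by fact
  interpret pair_sigma_finite \<mu> \<nu> ..
  have sp: "sets (\<mu> \<Otimes>\<^sub>M \<nu>) = sets (rpos \<Otimes>\<^sub>M rpos)" using \<mu>(1) \<nu>(1) by (rule sets_pair_measure_cong)
  have m: "(\<lambda>(s, t). s * t) \<in> \<mu> \<Otimes>\<^sub>M \<nu> \<rightarrow>\<^sub>M rpos"
    using mult_rpos_measurable by (simp add: measurable_cong_sets[OF sp refl])
  have fm: "(\<lambda>(s, t). f (s * t)) \<in> borel_measurable (\<mu> \<Otimes>\<^sub>M \<nu>)"
    using measurable_compose[OF m f] by (simp add: case_prod_beta')
  have "(\<integral>\<^sup>+t. f t \<partial>mult_convolution \<mu> \<nu>) = (\<integral>\<^sup>+z. (\<lambda>(s, t). f (s * t)) z \<partial>(\<mu> \<Otimes>\<^sub>M \<nu>))"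
    unfolding mult_convolution_def by (subst nn_integral_distr[OF m]) (simp_all add: case_prod_beta' f)
  then show "(\<integral>\<^sup>+t. f t \<partial>mult_convolution \<mu> \<nu>) = (\<integral>\<^sup>+s. \<integral>\<^sup>+u. f (s * u) \<partial>\<mu> \<partial>\<nu>)"
    "(\<integral>\<^sup>+t. f t \<partial>mult_convolution \<mu> \<nu>) = (\<integral>\<^sup>+u. \<integral>\<^sup>+s. f (u * s) \<partial>\<nu> \<partial>\<mu>)"
    using \<nu>.nn_integral_fst[OF fm] nn_integral_snd[OF fm] by (simp_all add: mult.commute)
qed

lemma sets_mult_convolution[simp]: "sets (mult_convolution \<mu> \<nu>) = sets rpos"
  by (simp add: mult_convolution_def)

lemma mult_convolution_commute:
  assumes \<mu>: "sets \<mu> = sets rpos" "finite_measure \<mu>" and \<nu>: "sets \<nu> = sets rpos" "finite_measure \<nu>"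
  shows "mult_convolution \<mu> \<nu> = mult_convolution \<nu> \<mu>"
proof (rule measure_eqI)
  fix E assume "E \<in> sets (mult_convolution \<mu> \<nu>)"
  then have E: "E \<in> sets rpos" by simp
  have "(\<integral>\<^sup>+t. indicator E t \<partial>mult_convolution \<mu> \<nu>) = (\<integral>\<^sup>+t. indicator E t \<partial>mult_convolution \<nu> \<mu>)"
    using mult_convolution_nn_integral(1)[OF assms, of "indicator E"]
      mult_convolution_nn_integral(2)[OF \<nu> \<mu>, of "indicator E"] E by simp
  then show "emeasure (mult_convolution \<mu> \<nu>) E = emeasure (mult_convolution \<nu> \<mu>) E"
    using E by simp
qed simp

lemma emeasure_mult_convolution:
  assumes \<mu>: "sets \<mu> = sets rpos" "finite_measure \<mu>" and \<nu>: "sets \<nu> = sets rpos" "finite_measure \<nu>"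
    and E: "E \<in> sets rpos"
  shows "emeasure (mult_convolution \<mu> \<nu>) E = (\<integral>\<^sup>+s. emeasure (distr \<mu> rpos (\<lambda>u. s * u)) E \<partial>\<nu>)"
proof -
  have "emeasure (mult_convolution \<mu> \<nu>) E = (\<integral>\<^sup>+t. indicator E t \<partial>mult_convolution \<mu> \<nu>)"
    using E by simp
  also have "\<dots> = (\<integral>\<^sup>+s. \<integral>\<^sup>+u. indicator E (s * u) \<partial>\<mu> \<partial>\<nu>)"
    using E by (intro mult_convolution_nn_integral(1)[OF assms(1-4)]) simp
  also have "\<dots> = (\<integral>\<^sup>+s. emeasure (distr \<mu> rpos (\<lambda>u. s * u)) E \<partial>\<nu>)"
  proof (rule nn_integral_cong)
    fix s assume "s \<in> space \<nu>"
    then have "s > 0" using sets_eq_imp_space_eq[OF \<nu>(1)] by simp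
    then have m: "(\<lambda>u. s * u) \<in> \<mu> \<rightarrow>\<^sub>M rpos"
      unfolding measurable_cong_sets[OF \<mu>(1) refl]
      by (intro measurable_rposI borel_measurable_times id_rpos_borel) auto
    have "(\<integral>\<^sup>+u. indicator E (s * u) \<partial>\<mu>) = (\<integral>\<^sup>+t. indicator E t \<partial>distr \<mu> rpos (\<lambda>u. s * u))"
      using E by (subst nn_integral_distr[OF m]) auto
    then show "(\<integral>\<^sup>+u. indicator E (s * u) \<partial>\<mu>) = emeasure (distr \<mu> rpos (\<lambda>u. s * u)) E"
      using E by simp
  qed
  finally show ?thesis .
qed

lemma mult_convolution_mass:
  assumes \<mu>: "sets \<mu> = sets rpos" "finite_measure \<mu>" and \<nu>: "sets \<nu> = sets rpos" "finite_measure \<nu>"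
  shows "emeasure (mult_convolution \<mu> \<nu>) {0<..} = emeasure \<mu> {0<..} * emeasure \<nu> {0<..}"
    and "(\<integral>\<^sup>+t. ennreal t \<partial>mult_convolution \<mu> \<nu>) = (\<integral>\<^sup>+t. ennreal t \<partial>\<mu>) * (\<integral>\<^sup>+t. ennreal t \<partial>\<nu>)"
proof -
  have sp: "space \<mu> = {0<..}" "space \<nu> = {0<..}" "space (mult_convolution \<mu> \<nu>) = {0<..}"
    using sets_eq_imp_space_eq[OF \<mu>(1)] sets_eq_imp_space_eq[OF \<nu>(1)]
      sets_eq_imp_space_eq[OF sets_mult_convolution] by simp_all
  have "(\<integral>\<^sup>+t. 1 \<partial>mult_convolution \<mu> \<nu>) = (\<integral>\<^sup>+s. \<integral>\<^sup>+u. 1 \<partial>\<mu> \<partial>\<nu>)"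
    by (intro mult_convolution_nn_integral(1)[OF assms]) simp
  then show "emeasure (mult_convolution \<mu> \<nu>) {0<..} = emeasure \<mu> {0<..} * emeasure \<nu> {0<..}"
    using sp by simp
  have i: "(\<lambda>t. ennreal t) \<in> borel_measurable rpos"
    by (rule measurable_compose[OF id_rpos_borel measurable_ennreal])
  have i': "(\<lambda>t. ennreal t) \<in> borel_measurable \<mu>" "(\<lambda>t. ennreal t) \<in> borel_measurable \<nu>"
    using i by (simp_all add: measurable_cong_sets[OF \<mu>(1) refl] measurable_cong_sets[OF \<nu>(1) refl])
  have "(\<integral>\<^sup>+t. ennreal t \<partial>mult_convolution \<mu> \<nu>) = (\<integral>\<^sup>+s. \<integral>\<^sup>+u. ennreal (s * u) \<partial>\<mu> \<partial>\<nu>)"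
    by (intro mult_convolution_nn_integral(1)[OF assms] i)
  also have "\<dots> = (\<integral>\<^sup>+s. ennreal s * (\<integral>\<^sup>+u. ennreal u \<partial>\<mu>) \<partial>\<nu>)"
    using sp i' by (intro nn_integral_cong) (simp add: ennreal_mult' nn_integral_cmult flip: nn_integral_cmult)
  also have "\<dots> = (\<integral>\<^sup>+t. ennreal t \<partial>\<mu>) * (\<integral>\<^sup>+t. ennreal t \<partial>\<nu>)"
    using i' by (simp add: nn_integral_multc mult.commute)
  finally show "(\<integral>\<^sup>+t. ennreal t \<partial>mult_convolution \<mu> \<nu>) = (\<integral>\<^sup>+t. ennreal t \<partial>\<mu>) * (\<integral>\<^sup>+t. ennreal t \<partial>\<nu>)" .
qed

lemma mtriD:
  assumes "\<mu> \<in> mtri"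
  shows "sets \<mu> = sets rpos" "finite_measure \<mu>" "space \<mu> = {0<..}" "(\<integral>\<^sup>+t. ennreal t \<partial>\<mu>) < \<infinity>"
  using assms sets_eq_imp_space_eq[of \<mu> rpos] by (auto simp: mtri_def less_top intro: finite_measureI)

lemma mtriI:
  assumes "sets \<mu> = sets rpos" "finite_measure \<mu>" "(\<integral>\<^sup>+t. ennreal t \<partial>\<mu>) < \<infinity>"
  shows "\<mu> \<in> mtri"
  using assms finite_measure.emeasure_finite[OF assms(2), of "space \<mu>"] by (simp add: mtri_def less_top)

lemma mult_convolution_mtri:
  assumes "\<mu> \<in> mtri" "\<nu> \<in> mtri"
  shows "mult_convolution \<mu> \<nu> \<in> mtri"
proof (rule mtriI)
  note \<mu> = mtriD[OF assms(1)] and \<nu> = mtriD[OF assms(2)]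
  have "space (mult_convolution \<mu> \<nu>) = {0<..}"
    using sets_eq_imp_space_eq[OF sets_mult_convolution] by simp
  then show "finite_measure (mult_convolution \<mu> \<nu>)"
    using mult_convolution_mass(1)[OF \<mu>(1,2) \<nu>(1,2)]
      finite_measure.emeasure_finite[OF \<mu>(2)] finite_measure.emeasure_finite[OF \<nu>(2)]
    by (intro finite_measureI) (simp add: ennreal_mult_eq_top_iff)
  show "(\<integral>\<^sup>+t. ennreal t \<partial>mult_convolution \<mu> \<nu>) < \<infinity>"
    using mult_convolution_mass(2)[OF \<mu>(1,2) \<nu>(1,2)] \<mu>(4) \<nu>(4) by (simp add: ennreal_mult_less_top)
qed simp

lemma mult_rpos_kernel:
  assumes q: "finite_kernel B rpos q"
  shows "finite_kernel (B \<Otimes>\<^sub>M rpos) rpos (\<lambda>z. distr (q (fst z)) rpos (\<lambda>u. snd z * u))"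
proof -
  have "(\<lambda>z. snd (fst z) :: real) \<in> borel_measurable ((B \<Otimes>\<^sub>M rpos) \<Otimes>\<^sub>M rpos)"
    by (rule rpos_measurable) simp
  then have mult: "(\<lambda>z. snd (fst z) * snd z) \<in> (B \<Otimes>\<^sub>M rpos) \<Otimes>\<^sub>M rpos \<rightarrow>\<^sub>M rpos"
    by (intro measurable_rposI borel_measurable_times snd_rpos_borel) (auto simp: space_pair_measure)
  show ?thesis
    using finite_kernel_distr[OF q measurable_fst mult] by simp
qed

lemma finite_kernel_mult_convolution:
  assumes p: "finite_kernel B rpos p" and q: "finite_kernel B rpos q"
  shows "finite_kernel B rpos (\<lambda>b. mult_convolution (q b) (p b))"
  unfolding finite_kernel_def
proof (intro conjI ballI)
  show "finite_measure (mult_convolution (q b) (p b))" if b: "b \<in> space B" for b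
  proof -
    note p' = finite_kernelD(1-3)[OF p b] and q' = finite_kernelD(1-3)[OF q b]
    have "space (mult_convolution (q b) (p b)) = {0<..}"
      using sets_eq_imp_space_eq[OF sets_mult_convolution] by simp
    then show ?thesis
      using mult_convolution_mass(1)[OF q'(1,3) p'(1,3)]
        finite_measure.emeasure_finite[OF p'(3)] finite_measure.emeasure_finite[OF q'(3)]
      by (intro finite_measureI) (simp add: ennreal_mult_eq_top_iff)
  qed
  fix E assume E: "E \<in> sets rpos"
  from finite_kernel_nn_integral_measurable[OF p measurable_ident finite_kernelD(4)[OF mult_rpos_kernel[OF q] E]]
  have "(\<lambda>b. \<integral>\<^sup>+s. emeasure (distr (q b) rpos (\<lambda>u. s * u)) E \<partial>p b) \<in> borel_measurable B" by simp
  then show "(\<lambda>b. emeasure (mult_convolution (q b) (p b)) E) \<in> borel_measurable B"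
  proof (rule measurable_congI)
    fix b assume b: "b \<in> space B"
    show "emeasure (mult_convolution (q b) (p b)) E = (\<integral>\<^sup>+s. emeasure (distr (q b) rpos (\<lambda>u. s * u)) E \<partial>p b)"
      using finite_kernelD(1,3)[OF p b] finite_kernelD(1,3)[OF q b] E by (intro emeasure_mult_convolution)
  qed
qed simp

text \<open>
  If \<open>\<nu>\<close> has the densities \<open>p\<close>, then pushing \<open>\<nu>\<close> forward under multiplication by a \<open>q\<close>-distributed
  factor yields the mixture of the convolutions of \<open>q b\<close> and \<open>p b\<close>. The left-hand side involves one of
  the two polymorphisms only through its fibre measure, which is what makes additivity and
  convergence in that polymorphism accessible.
\<close>

lemma integral_mult_kernel_eq_convolution:
  assumes p: "finite_kernel B rpos p" and q: "finite_kernel B rpos q"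
    and sets_\<nu>: "sets \<nu> = sets (B \<Otimes>\<^sub>M rpos)" and fin: "finite_measure \<nu>"
    and \<nu>: "\<And>N E. N \<in> sets B \<Longrightarrow> E \<in> sets rpos \<Longrightarrow> emeasure \<nu> (N \<times> E) = (\<integral>\<^sup>+b\<in>N. emeasure (p b) E \<partial>B)"
    and E: "E \<in> sets rpos"
  shows "(\<integral>\<^sup>+z. emeasure (distr (q (fst z)) rpos (\<lambda>u. snd z * u)) E \<partial>\<nu>) =
    (\<integral>\<^sup>+b. emeasure (mult_convolution (q b) (p b)) E \<partial>B)"
proof -
  have "(\<integral>\<^sup>+z. emeasure (distr (q (fst z)) rpos (\<lambda>u. snd z * u)) E \<partial>\<nu>) =
    (\<integral>\<^sup>+b. \<integral>\<^sup>+s. emeasure (distr (q (fst (b, s))) rpos (\<lambda>u. snd (b, s) * u)) E \<partial>p b \<partial>B)"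
    by (rule nn_integral_disintegration[OF p sets_\<nu> fin])
       (use \<nu> finite_kernelD(4)[OF mult_rpos_kernel[OF q] E] in blast)+
  also have "\<dots> = (\<integral>\<^sup>+b. emeasure (mult_convolution (q b) (p b)) E \<partial>B)"
  proof (rule nn_integral_cong)
    fix b assume b: "b \<in> space B"
    show "(\<integral>\<^sup>+s. emeasure (distr (q (fst (b, s))) rpos (\<lambda>u. snd (b, s) * u)) E \<partial>p b) = emeasure (mult_convolution (q b) (p b)) E"
      using emeasure_mult_convolution[OF finite_kernelD(1,3)[OF q b] finite_kernelD(1,3)[OF p b] E] by simp
  qed
  finally show ?thesis .
qed

section \<open>Polymorphisms, their fibres and the densities of their blocks\<close>

text \<open>
  Otherwise integrating over the set where \<open>f\<close> exceeds 1 gives a contradiction.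
\<close>

lemma AE_le_1_of_integral_le:
  assumes B: "finite_measure B" and f: "f \<in> borel_measurable B"
    and le: "\<And>N. N \<in> sets B \<Longrightarrow> (\<integral>\<^sup>+b\<in>N. f b \<partial>B) \<le> emeasure B N"
  shows "AE b in B. f b \<le> (1::ennreal)"
proof -
  interpret finite_measure B by fact
  let ?N = "{b\<in>space B. 1 < f b}"
  have N: "?N \<in> sets B" using f by measurable
  have "AE b in B. f b * indicator ?N b \<le> indicator ?N b"
  proof (rule ccontr)
    assume neg: "\<not> ?thesis"
    have "(\<integral>\<^sup>+b. indicator ?N b \<partial>B) < (\<integral>\<^sup>+b\<in>?N. f b \<partial>B)"
    proof (rule nn_integral_less)
      show "(\<lambda>b. f b * indicator ?N b) \<in> borel_measurable B"
        using f N by (intro borel_measurable_times_ennreal borel_measurable_indicator)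
      show "AE b in B. indicator ?N b \<le> f b * indicator ?N b"
        by (intro AE_I2) (auto simp: indicator_def)
    qed (use N neg in auto)
    then show False using le[OF N] N by (simp add: not_le[symmetric])
  qed
  with AE_space show ?thesis
  proof eventually_elim
    case (elim b)
    then show ?case by (cases "1 < f b") (auto simp: not_less)
  qed
qed

lemma PolD:
  assumes "P \<in> Pol A B"
  shows "sets P = sets (A \<Otimes>\<^sub>M B \<Otimes>\<^sub>M rpos)" "space P = space A \<times> space B \<times> {0<..}"
    "distr P A (\<lambda>(a, b, t). a) = A"
    "distr (density P (\<lambda>(a, b, t). ennreal t)) B (\<lambda>(a, b, t). b) = B"
  using assms sets_eq_imp_space_eq[of P "A \<Otimes>\<^sub>M B \<Otimes>\<^sub>M rpos"] by (auto simp: Pol_def space_pair_measure)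

lemma triple_measurable:
  assumes "sets P = sets (A \<Otimes>\<^sub>M B \<Otimes>\<^sub>M rpos)"
  shows "fst \<in> P \<rightarrow>\<^sub>M A" "snd \<in> P \<rightarrow>\<^sub>M B \<Otimes>\<^sub>M rpos" "(\<lambda>z. fst (snd z)) \<in> P \<rightarrow>\<^sub>M B"
    "(\<lambda>z. snd (snd z)) \<in> P \<rightarrow>\<^sub>M rpos" "(\<lambda>z. snd (snd z)) \<in> borel_measurable P"
    "(\<lambda>z. (fst z, snd (snd z))) \<in> P \<rightarrow>\<^sub>M A \<Otimes>\<^sub>M rpos"
proof -
  show m: "fst \<in> P \<rightarrow>\<^sub>M A" "snd \<in> P \<rightarrow>\<^sub>M B \<Otimes>\<^sub>M rpos"
    by (simp_all add: measurable_cong_sets[OF assms refl])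
  show "(\<lambda>z. fst (snd z)) \<in> P \<rightarrow>\<^sub>M B" "(\<lambda>z. snd (snd z)) \<in> P \<rightarrow>\<^sub>M rpos"
    using measurable_compose[OF m(2) measurable_fst] measurable_compose[OF m(2) measurable_snd] by auto
  then show "(\<lambda>z. snd (snd z)) \<in> borel_measurable P" "(\<lambda>z. (fst z, snd (snd z))) \<in> P \<rightarrow>\<^sub>M A \<Otimes>\<^sub>M rpos"
    using rpos_measurable measurable_Pair[OF m(1)] by blast+
qed

lemma triple_sets:
  assumes "sets P = sets (A \<Otimes>\<^sub>M B \<Otimes>\<^sub>M rpos)" "M \<in> sets A" "N \<in> sets B" "E \<in> sets rpos"
  shows "M \<times> N \<times> E \<in> sets P"
  using assms by (auto intro!: pair_measureI)

lemma Pol_source_marginal: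
  assumes P: "P \<in> Pol A B" and M: "M \<in> sets A"
  shows "emeasure P (M \<times> space B \<times> {0<..}) = emeasure A M"
proof -
  note p = PolD[OF P]
  have "emeasure A M = emeasure (distr P A (\<lambda>(a, b, t). a)) M" using p(3) by simp
  also have "\<dots> = emeasure P ((\<lambda>(a, b, t). a) -` M \<inter> space P)"
    using triple_measurable(1)[OF p(1)] M by (intro emeasure_distr) (simp_all add: case_prod_beta')
  also have "(\<lambda>(a, b, t). a) -` M \<inter> space P = M \<times> space B \<times> {0<..}"
    using sets.sets_into_space[OF M] p(2) by auto
  finally show ?thesis by simp
qed

lemma Pol_finite:
  assumes P: "P \<in> Pol A B" and A: "finite_measure A"
  shows "finite_measure P"
  using Pol_source_marginal[OF P sets.top] PolD(2)[OF P] finite_measure.emeasure_finite[OF A]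
  by (intro finite_measureI) simp

lemma Pol_target_marginal:
  assumes P: "P \<in> Pol A B" and N: "N \<in> sets B"
  shows "(\<integral>\<^sup>+z. ennreal (snd (snd z)) * indicator N (fst (snd z)) \<partial>P) = emeasure B N"
proof -
  note p = PolD[OF P] and m = triple_measurable[OF PolD(1)[OF P]]
  have i: "(\<lambda>(a, b, t). b) -` N \<inter> space (density P (\<lambda>(a, b, t). ennreal t)) \<in> sets P"
    using measurable_sets[OF m(3) N] by (simp add: case_prod_beta' vimage_def)
  have "emeasure B N = emeasure (distr (density P (\<lambda>(a, b, t). ennreal t)) B (\<lambda>(a, b, t). b)) N"
    using p(4) by simp
  also have "\<dots> = emeasure (density P (\<lambda>(a, b, t). ennreal t)) ((\<lambda>(a, b, t). b) -` N \<inter> space (density P (\<lambda>(a, b, t). ennreal t)))"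
    using m(3) N by (intro emeasure_distr) (simp_all add: case_prod_beta')
  also have "\<dots> = (\<integral>\<^sup>+z. ennreal (snd (snd z)) * indicator N (fst (snd z)) \<partial>P)"
    using m(5) i by (subst emeasure_density)
      (auto simp: case_prod_beta' indicator_def intro!: nn_integral_cong)
  finally show ?thesis by simp
qed

lemma emeasure_pol_block:
  assumes s: "sets P = sets (A \<Otimes>\<^sub>M B \<Otimes>\<^sub>M rpos)" and M: "M \<in> sets A" and N: "N \<in> sets B" and E: "E \<in> sets rpos"
  shows "emeasure (pol_block P M N) E = emeasure P (M \<times> N \<times> E)"
proof -
  have sp: "space P = space A \<times> space B \<times> {0<..}"
    using sets_eq_imp_space_eq[OF s] by (simp add: space_pair_measure)
  have S: "M \<times> N \<times> {0<..} \<in> sets P" using triple_sets[OF s M N sets.top] by simp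
  have "emeasure (pol_block P M N) E =
    emeasure (restrict_space P (M \<times> N \<times> {0<..})) ((\<lambda>(a, b, t). t) -` E \<inter> space (restrict_space P (M \<times> N \<times> {0<..})))"
    unfolding pol_block_def using triple_measurable(4)[OF s] E
    by (intro emeasure_distr measurable_restrict_space1) (simp_all add: case_prod_beta')
  also have "(\<lambda>(a, b, t). t) -` E \<inter> space (restrict_space P (M \<times> N \<times> {0<..})) = M \<times> N \<times> E"
    using sets.sets_into_space[OF M] sets.sets_into_space[OF N] sets.sets_into_space[OF E]
    by (auto simp: space_restrict_space sp)
  also have "emeasure (restrict_space P (M \<times> N \<times> {0<..})) (M \<times> N \<times> E) = emeasure P (M \<times> N \<times> E)"
    using S sets.sets_into_space[OF E] by (intro emeasure_restrict_space) (auto simp: sets.Int_space_eq1)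
  finally show ?thesis .
qed

lemma sets_pol_block[simp]: "sets (pol_block P M N) = sets rpos"
  by (simp add: pol_block_def)

text \<open>
  For fixed \<open>M\<close>, the second and third coordinates under \<open>P\<close> restricted to \<open>M\<close>. Its restriction to
  \<open>N\<close> projects to \<open>pol_block P M N\<close>.
\<close>

definition source_fibre :: "'b measure \<Rightarrow> ('a \<times> 'b \<times> real) measure \<Rightarrow> 'a set \<Rightarrow> ('b \<times> real) measure" where
  "source_fibre B P M = distr (density P (\<lambda>z. indicator M (fst z))) (B \<Otimes>\<^sub>M rpos) snd"

text \<open>
  The analogue of \<^const>\<open>source_fibre\<close> with the target set fixed and the source coordinate retained.
\<close>

definition target_fibre :: "'a measure \<Rightarrow> ('a \<times> 'b \<times> real) measure \<Rightarrow> 'b set \<Rightarrow> ('a \<times> real) measure" where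
  "target_fibre A P N = distr (density P (\<lambda>z. indicator N (fst (snd z)))) (A \<Otimes>\<^sub>M rpos) (\<lambda>z. (fst z, snd (snd z)))"

lemma sets_fibre[simp]: "sets (source_fibre B P M) = sets (B \<Otimes>\<^sub>M rpos)"
  "sets (target_fibre A P N) = sets (A \<Otimes>\<^sub>M rpos)"
  by (simp_all add: source_fibre_def target_fibre_def)

lemma nn_integral_source_fibre:
  assumes s: "sets P = sets (A \<Otimes>\<^sub>M B \<Otimes>\<^sub>M rpos)" and M: "M \<in> sets A" and f: "f \<in> borel_measurable (B \<Otimes>\<^sub>M rpos)"
  shows "(\<integral>\<^sup>+y. f y \<partial>source_fibre B P M) = (\<integral>\<^sup>+z. f (snd z) * indicator M (fst z) \<partial>P)"
proof -
  note m = triple_measurable[OF s]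
  have i: "(\<lambda>z. indicator M (fst z) :: ennreal) \<in> borel_measurable P"
    using m(1) M by (intro measurable_compose[OF m(1)] borel_measurable_indicator)
  have "(\<integral>\<^sup>+y. f y \<partial>source_fibre B P M) = (\<integral>\<^sup>+z. f (snd z) \<partial>density P (\<lambda>z. indicator M (fst z)))"
    unfolding source_fibre_def using m(2) f by (intro nn_integral_distr) simp_all
  also have "\<dots> = (\<integral>\<^sup>+z. indicator M (fst z) * f (snd z) \<partial>P)"
    by (intro nn_integral_density i measurable_compose[OF m(2) f])
  finally show ?thesis by (simp add: mult.commute)
qed

lemma nn_integral_target_fibre:
  assumes s: "sets P = sets (A \<Otimes>\<^sub>M B \<Otimes>\<^sub>M rpos)" and N: "N \<in> sets B" and f: "f \<in> borel_measurable (A \<Otimes>\<^sub>M rpos)"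
  shows "(\<integral>\<^sup>+y. f y \<partial>target_fibre A P N) = (\<integral>\<^sup>+z. f (fst z, snd (snd z)) * indicator N (fst (snd z)) \<partial>P)"
proof -
  note m = triple_measurable[OF s]
  have i: "(\<lambda>z. indicator N (fst (snd z)) :: ennreal) \<in> borel_measurable P"
    using N by (intro measurable_compose[OF m(3)] borel_measurable_indicator)
  have "(\<integral>\<^sup>+y. f y \<partial>target_fibre A P N) = (\<integral>\<^sup>+z. f (fst z, snd (snd z)) \<partial>density P (\<lambda>z. indicator N (fst (snd z))))"
    unfolding target_fibre_def using m(6) f by (intro nn_integral_distr) simp_all
  also have "\<dots> = (\<integral>\<^sup>+z. indicator N (fst (snd z)) * f (fst z, snd (snd z)) \<partial>P)"
    by (intro nn_integral_density i measurable_compose[OF m(6) f])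
  finally show ?thesis by (simp add: mult.commute)
qed

lemma emeasure_source_fibre:
  assumes s: "sets P = sets (A \<Otimes>\<^sub>M B \<Otimes>\<^sub>M rpos)" and M: "M \<in> sets A" and N: "N \<in> sets B" and E: "E \<in> sets rpos"
  shows "emeasure (source_fibre B P M) (N \<times> E) = emeasure P (M \<times> N \<times> E)"
proof -
  have NE: "N \<times> E \<in> sets (B \<Otimes>\<^sub>M rpos)" using N E by (rule pair_measureI)
  have "emeasure (source_fibre B P M) (N \<times> E) = (\<integral>\<^sup>+y. indicator (N \<times> E) y \<partial>source_fibre B P M)"
    using NE by simp
  also have "\<dots> = (\<integral>\<^sup>+z. indicator (N \<times> E) (snd z) * indicator M (fst z) \<partial>P)"
    by (rule nn_integral_source_fibre[OF s M borel_measurable_indicator[OF NE]])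
  also have "\<dots> = (\<integral>\<^sup>+z. indicator (M \<times> N \<times> E) z \<partial>P)"
    by (intro nn_integral_cong) (auto simp: indicator_def)
  finally show ?thesis using triple_sets[OF s M N E] by simp
qed

lemma emeasure_target_fibre:
  assumes s: "sets P = sets (A \<Otimes>\<^sub>M B \<Otimes>\<^sub>M rpos)" and M: "M \<in> sets A" and N: "N \<in> sets B" and E: "E \<in> sets rpos"
  shows "emeasure (target_fibre A P N) (M \<times> E) = emeasure P (M \<times> N \<times> E)"
proof -
  have ME: "M \<times> E \<in> sets (A \<Otimes>\<^sub>M rpos)" using M E by (rule pair_measureI)
  have "emeasure (target_fibre A P N) (M \<times> E) = (\<integral>\<^sup>+y. indicator (M \<times> E) y \<partial>target_fibre A P N)"
    using ME by simp
  also have "\<dots> = (\<integral>\<^sup>+z. indicator (M \<times> E) (fst z, snd (snd z)) * indicator N (fst (snd z)) \<partial>P)"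
    by (rule nn_integral_target_fibre[OF s N borel_measurable_indicator[OF ME]])
  also have "\<dots> = (\<integral>\<^sup>+z. indicator (M \<times> N \<times> E) z \<partial>P)"
    by (intro nn_integral_cong) (auto simp: indicator_def)
  finally show ?thesis using triple_sets[OF s M N E] by simp
qed

lemma fibre_finite:
  assumes P: "P \<in> Pol A B" and A: "finite_measure A" and M: "M \<in> sets A" and N: "N \<in> sets B"
  shows "finite_measure (source_fibre B P M)" "finite_measure (target_fibre A P N)"
proof -
  interpret finite_measure P by (rule Pol_finite[OF P A])
  note s = PolD(1)[OF P]
  have "space (source_fibre B P M) = space B \<times> space rpos" "space (target_fibre A P N) = space A \<times> space rpos"
    using sets_eq_imp_space_eq[OF sets_fibre(1), of B P M] sets_eq_imp_space_eq[OF sets_fibre(2), of A P N]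
    by (simp_all add: space_pair_measure)
  then show "finite_measure (source_fibre B P M)" "finite_measure (target_fibre A P N)"
    using emeasure_source_fibre[OF s M sets.top sets.top] emeasure_target_fibre[OF s sets.top N sets.top]
    by (auto intro!: finite_measureI)
qed

text \<open>
  The marginal of \<open>P\<close> on \<open>B\<close> is not \<open>B\<close>, but it is absolutely continuous, because the factor \<open>t\<close> in
  the second marginal condition never vanishes.
\<close>

lemma Pol_null_target:
  assumes P: "P \<in> Pol A B" and N: "N \<in> null_sets B"
  shows "emeasure P (space A \<times> N \<times> {0<..}) = 0"
proof -
  note s = PolD(1)[OF P] and m = triple_measurable[OF PolD(1)[OF P]]
  have Ns: "N \<in> sets B" using N by auto
  have i: "(\<lambda>z. indicator N (fst (snd z)) :: ennreal) \<in> borel_measurable P"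
    using Ns by (intro measurable_compose[OF m(3)] borel_measurable_indicator)
  have "(\<integral>\<^sup>+z. ennreal (snd (snd z)) * indicator N (fst (snd z)) \<partial>P) = 0"
    using Pol_target_marginal[OF P Ns] N by auto
  then have "AE z in P. ennreal (snd (snd z)) * indicator N (fst (snd z)) = 0"
    using m(5) i by (subst (asm) nn_integral_0_iff_AE) auto
  then have "AE z in P. z \<notin> space A \<times> N \<times> {0<..}"
    by eventually_elim (auto simp: indicator_def split: if_splits)
  then show ?thesis
    using triple_sets[OF s sets.top Ns sets.top] by (subst (asm) AE_iff_null_sets[symmetric]) auto
qed

lemma Pol_null_source:
  assumes P: "P \<in> Pol A B" and M: "M \<in> null_sets A"
  shows "emeasure P (M \<times> space B \<times> {0<..}) = 0"
  using Pol_source_marginal[OF P null_setsD2[OF M]] null_setsD1[OF M] by simp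

lemma is_measure_integralI:
  assumes p: "finite_kernel B rpos p" "\<And>b. b \<in> space B \<Longrightarrow> p b \<in> mtri"
    and "sets \<mu> = sets rpos" "\<And>E. E \<in> sets rpos \<Longrightarrow> emeasure \<mu> E = (\<integral>\<^sup>+b\<in>N. emeasure (p b) E \<partial>B)"
  shows "is_measure_integral B N p \<mu>"
  unfolding is_measure_integral_def using assms finite_kernelD(4)[OF p(1)]
  by (auto intro!: AE_I2 measurable_completion)

lemma fibre_moment_finite:
  assumes P: "P \<in> Pol A B" and B: "finite_measure B" and M: "M \<in> sets A" and N: "N \<in> sets B"
  shows "(\<integral>\<^sup>+z. ennreal (snd z) \<partial>source_fibre B P M) < \<infinity>" "(\<integral>\<^sup>+z. ennreal (snd z) \<partial>target_fibre A P N) < \<infinity>"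
proof -
  note s = PolD(1)[OF P]
  have tm: "(\<lambda>z. ennreal (snd z)) \<in> borel_measurable (B \<Otimes>\<^sub>M rpos)" "(\<lambda>z. ennreal (snd z)) \<in> borel_measurable (A \<Otimes>\<^sub>M rpos)"
    by (rule measurable_compose[OF snd_rpos_borel measurable_ennreal])+
  have "(\<integral>\<^sup>+z. ennreal (snd z) \<partial>source_fibre B P M) = (\<integral>\<^sup>+z. ennreal (snd (snd z)) * indicator M (fst z) \<partial>P)"
    by (rule nn_integral_source_fibre[OF s M tm(1)])
  also have "\<dots> \<le> (\<integral>\<^sup>+z. ennreal (snd (snd z)) * indicator (space B) (fst (snd z)) \<partial>P)"
  proof (rule nn_integral_mono)
    fix z assume "z \<in> space P"
    then have "fst (snd z) \<in> space B" unfolding PolD(2)[OF P] by auto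
    then show "ennreal (snd (snd z)) * indicator M (fst z) \<le> ennreal (snd (snd z)) * indicator (space B) (fst (snd z))"
      by (simp add: indicator_def)
  qed
  also have "\<dots> < \<infinity>"
    using Pol_target_marginal[OF P sets.top] finite_measure.emeasure_finite[OF B] by (simp add: less_top)
  finally show "(\<integral>\<^sup>+z. ennreal (snd z) \<partial>source_fibre B P M) < \<infinity>" .
  show "(\<integral>\<^sup>+z. ennreal (snd z) \<partial>target_fibre A P N) < \<infinity>"
    using nn_integral_target_fibre[OF s N tm(2)] Pol_target_marginal[OF P N] finite_measure.emeasure_finite[OF B]
    by (simp add: less_top)
qed

lemma source_disintegration:
  assumes P: "P \<in> Pol A B" and A: "finite_measure A" and B: "finite_measure B" and M: "M \<in> sets A"
  obtains p where "finite_kernel B rpos p" "\<And>b. b \<in> space B \<Longrightarrow> p b \<in> mtri"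
    "\<And>N E. N \<in> sets B \<Longrightarrow> E \<in> sets rpos \<Longrightarrow> emeasure (source_fibre B P M) (N \<times> E) = (\<integral>\<^sup>+b\<in>N. emeasure (p b) E \<partial>B)"
    "\<And>N. N \<in> sets B \<Longrightarrow> is_measure_integral B N p (pol_block P M N)"
proof -
  note s = PolD(1)[OF P]
  have t: "(\<integral>\<^sup>+z. ennreal (snd z) \<partial>source_fibre B P M) < \<infinity>"
    by (rule fibre_moment_finite(1)[OF P B M sets.top])
  have null: "emeasure (source_fibre B P M) (N \<times> {0<..}) = 0" if N: "N \<in> null_sets B" for N
  proof -
    have Ns: "N \<in> sets B" using N by auto
    have "emeasure (source_fibre B P M) (N \<times> {0<..}) = emeasure P (M \<times> N \<times> {0<..})"
      using emeasure_source_fibre[OF s M Ns sets.top] by simp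
    also have "\<dots> \<le> emeasure P (space A \<times> N \<times> {0<..})"
      using sets.sets_into_space[OF M] triple_sets[OF s sets.top Ns sets.top] by (intro emeasure_mono) auto
    finally show ?thesis using Pol_null_target[OF P N] by simp
  qed
  obtain p where p: "finite_kernel B rpos p" "\<And>b. b \<in> space B \<Longrightarrow> p b \<in> mtri"
    "\<And>N E. N \<in> sets B \<Longrightarrow> E \<in> sets rpos \<Longrightarrow> emeasure (source_fibre B P M) (N \<times> E) = (\<integral>\<^sup>+b\<in>N. emeasure (p b) E \<partial>B)"
    using disintegration[OF B sets_fibre(1) fibre_finite(1)[OF P A M sets.top] t null] by blast
  moreover have "is_measure_integral B N p (pol_block P M N)" if N: "N \<in> sets B" for N
    using p(3)[OF N] emeasure_pol_block[OF s M N] emeasure_source_fibre[OF s M N]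
    by (intro is_measure_integralI p) simp_all
  ultimately show thesis using that by blast
qed

lemma target_disintegration:
  assumes Q: "Q \<in> Pol B C" and B: "finite_measure B" and C: "finite_measure C" and K: "K \<in> sets C"
  obtains q where "finite_kernel B rpos q" "\<And>b. b \<in> space B \<Longrightarrow> q b \<in> mtri"
    "\<And>N E. N \<in> sets B \<Longrightarrow> E \<in> sets rpos \<Longrightarrow> emeasure (target_fibre B Q K) (N \<times> E) = (\<integral>\<^sup>+b\<in>N. emeasure (q b) E \<partial>B)"
    "\<And>N. N \<in> sets B \<Longrightarrow> is_measure_integral B N q (pol_block Q N K)"
proof -
  note s = PolD(1)[OF Q]
  have t: "(\<integral>\<^sup>+z. ennreal (snd z) \<partial>target_fibre B Q K) < \<infinity>"
    by (rule fibre_moment_finite(2)[OF Q C sets.top K])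
  have null: "emeasure (target_fibre B Q K) (N \<times> {0<..}) = 0" if N: "N \<in> null_sets B" for N
  proof -
    have Ns: "N \<in> sets B" using N by auto
    have "emeasure (target_fibre B Q K) (N \<times> {0<..}) = emeasure Q (N \<times> K \<times> {0<..})"
      using emeasure_target_fibre[OF s Ns K sets.top] by simp
    also have "\<dots> \<le> emeasure Q (N \<times> space C \<times> {0<..})"
      using sets.sets_into_space[OF K] triple_sets[OF s Ns sets.top sets.top] by (intro emeasure_mono) auto
    finally show ?thesis using Pol_null_source[OF Q N] by simp
  qed
  obtain q where q: "finite_kernel B rpos q" "\<And>b. b \<in> space B \<Longrightarrow> q b \<in> mtri"
    "\<And>N E. N \<in> sets B \<Longrightarrow> E \<in> sets rpos \<Longrightarrow> emeasure (target_fibre B Q K) (N \<times> E) = (\<integral>\<^sup>+b\<in>N. emeasure (q b) E \<partial>B)"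
    using disintegration[OF B sets_fibre(2) fibre_finite(2)[OF Q B sets.top K] t null] by blast
  moreover have "is_measure_integral B N q (pol_block Q N K)" if N: "N \<in> sets B" for N
    using q(3)[OF N] emeasure_pol_block[OF s N K] emeasure_target_fibre[OF s N K]
    by (intro is_measure_integralI q) simp_all
  ultimately show thesis using that by blast
qed

lemma first_moment_disintegration:
  assumes q: "finite_kernel B rpos q" and s: "sets \<nu> = sets (B \<Otimes>\<^sub>M rpos)" and fin: "finite_measure \<nu>"
    and \<nu>: "\<And>N E. N \<in> sets B \<Longrightarrow> E \<in> sets rpos \<Longrightarrow> emeasure \<nu> (N \<times> E) = (\<integral>\<^sup>+b\<in>N. emeasure (q b) E \<partial>B)"
    and N: "N \<in> sets B"
  shows "(\<integral>\<^sup>+b\<in>N. (\<integral>\<^sup>+t. ennreal t \<partial>q b) \<partial>B) = (\<integral>\<^sup>+z. ennreal (snd z) * indicator N (fst z) \<partial>\<nu>)"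
proof -
  have m: "(\<lambda>z. ennreal (snd z) * indicator N (fst z)) \<in> borel_measurable (B \<Otimes>\<^sub>M rpos)"
    using N by (intro borel_measurable_times_ennreal measurable_compose[OF snd_rpos_borel measurable_ennreal]
       measurable_compose[OF measurable_fst borel_measurable_indicator])
  have i: "(\<lambda>t. ennreal t) \<in> borel_measurable (q b)" if "b \<in> space B" for b
    using measurable_compose[OF id_rpos_borel measurable_ennreal]
    by (simp add: measurable_cong_sets[OF finite_kernelD(1)[OF q that] refl])
  have "(\<integral>\<^sup>+z. ennreal (snd z) * indicator N (fst z) \<partial>\<nu>) =
    (\<integral>\<^sup>+b. \<integral>\<^sup>+t. ennreal (snd (b, t)) * indicator N (fst (b, t)) \<partial>q b \<partial>B)"
    by (rule nn_integral_disintegration[OF q s fin]) (use \<nu> m in blast)+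
  also have "\<dots> = (\<integral>\<^sup>+b\<in>N. (\<integral>\<^sup>+t. ennreal t \<partial>q b) \<partial>B)"
    using i by (intro nn_integral_cong) (simp add: nn_integral_multc)
  finally show ?thesis by simp
qed

text \<open>
  The second marginal condition bounds the \<open>t\<close>-weighted fibre measure by \<open>B\<close>, hence the first
  moments of its densities by 1.
\<close>

lemma source_moment_le_1:
  assumes P: "P \<in> Pol A B" and A: "finite_measure A" and B: "finite_measure B" and M: "M \<in> sets A"
    and p: "finite_kernel B rpos p"
    and \<nu>: "\<And>N E. N \<in> sets B \<Longrightarrow> E \<in> sets rpos \<Longrightarrow> emeasure (source_fibre B P M) (N \<times> E) = (\<integral>\<^sup>+b\<in>N. emeasure (p b) E \<partial>B)"
  shows "AE b in B. (\<integral>\<^sup>+t. ennreal t \<partial>p b) \<le> 1"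
    and "M = space A \<Longrightarrow> AE b in B. (\<integral>\<^sup>+t. ennreal t \<partial>p b) = 1"
proof -
  interpret finite_measure B by fact
  note s = PolD(1)[OF P]
  have meas: "(\<lambda>b. \<integral>\<^sup>+t. ennreal t \<partial>p b) \<in> borel_measurable B"
    using finite_kernel_nn_integral_measurable[OF p measurable_ident, of "\<lambda>z. ennreal (snd z)"]
      measurable_compose[OF snd_rpos_borel[of B] measurable_ennreal] by simp
  have *: "(\<integral>\<^sup>+b\<in>N. (\<integral>\<^sup>+t. ennreal t \<partial>p b) \<partial>B) = (\<integral>\<^sup>+z. (ennreal (snd (snd z)) * indicator N (fst (snd z))) * indicator M (fst z) \<partial>P)"
    if N: "N \<in> sets B" for N
  proof -
    have m: "(\<lambda>z. ennreal (snd z) * indicator N (fst z)) \<in> borel_measurable (B \<Otimes>\<^sub>M rpos)"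
      using N by (intro borel_measurable_times_ennreal measurable_compose[OF snd_rpos_borel measurable_ennreal]
         measurable_compose[OF measurable_fst borel_measurable_indicator])
    have "(\<integral>\<^sup>+b\<in>N. (\<integral>\<^sup>+t. ennreal t \<partial>p b) \<partial>B) = (\<integral>\<^sup>+z. ennreal (snd z) * indicator N (fst z) \<partial>source_fibre B P M)"
      by (rule first_moment_disintegration[OF p sets_fibre(1) fibre_finite(1)[OF P A M sets.top] _ N]) (rule \<nu>)
    then show ?thesis using nn_integral_source_fibre[OF s M m] by simp
  qed
  show "AE b in B. (\<integral>\<^sup>+t. ennreal t \<partial>p b) \<le> 1"
  proof (rule AE_le_1_of_integral_le[OF B meas])
    fix N assume N: "N \<in> sets B"
    show "(\<integral>\<^sup>+b\<in>N. (\<integral>\<^sup>+t. ennreal t \<partial>p b) \<partial>B) \<le> emeasure B N"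
      unfolding *[OF N] Pol_target_marginal[OF P N, symmetric]
      by (intro nn_integral_mono) (auto simp: indicator_def)
  qed
  assume M: "M = space A"
  show "AE b in B. (\<integral>\<^sup>+t. ennreal t \<partial>p b) = 1"
  proof (rule density_unique_finite_measure[OF meas])
    fix N assume N: "N \<in> sets B"
    have "(\<integral>\<^sup>+b\<in>N. (\<integral>\<^sup>+t. ennreal t \<partial>p b) \<partial>B) = emeasure B N"
      unfolding *[OF N] Pol_target_marginal[OF P N, symmetric]
      by (intro nn_integral_cong) (auto simp: PolD(2)[OF P] M indicator_def)
    then show "(\<integral>\<^sup>+b\<in>N. (\<integral>\<^sup>+t. ennreal t \<partial>p b) \<partial>B) = (\<integral>\<^sup>+b\<in>N. 1 \<partial>B)" using N by simp
  qed auto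
qed

text \<open>
  The first marginal condition bounds the fibre measure by \<open>B\<close>, hence the masses of its
  densities by 1. Here the masses are controlled, for the source fibres the first moments.
\<close>

lemma target_mass_le_1:
  assumes Q: "Q \<in> Pol B C" and B: "finite_measure B" and K: "K \<in> sets C"
    and q: "finite_kernel B rpos q"
    and \<nu>: "\<And>N E. N \<in> sets B \<Longrightarrow> E \<in> sets rpos \<Longrightarrow> emeasure (target_fibre B Q K) (N \<times> E) = (\<integral>\<^sup>+b\<in>N. emeasure (q b) E \<partial>B)"
  shows "AE b in B. emeasure (q b) {0<..} \<le> 1"
    and "K = space C \<Longrightarrow> AE b in B. emeasure (q b) {0<..} = 1"
proof -
  interpret finite_measure B by fact
  note s = PolD(1)[OF Q]
  have meas: "(\<lambda>b. emeasure (q b) {0<..}) \<in> borel_measurable B"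
    using finite_kernelD(4)[OF q sets.top] by simp
  have *: "(\<integral>\<^sup>+b\<in>N. emeasure (q b) {0<..} \<partial>B) = emeasure Q (N \<times> K \<times> {0<..})" if N: "N \<in> sets B" for N
    using \<nu>[OF N sets.top] emeasure_target_fibre[OF s N K sets.top] by simp
  show "AE b in B. emeasure (q b) {0<..} \<le> 1"
  proof (rule AE_le_1_of_integral_le[OF B meas])
    fix N assume N: "N \<in> sets B"
    show "(\<integral>\<^sup>+b\<in>N. emeasure (q b) {0<..} \<partial>B) \<le> emeasure B N"
      unfolding *[OF N] Pol_source_marginal[OF Q N, symmetric]
      using sets.sets_into_space[OF K] triple_sets[OF s N sets.top sets.top] by (intro emeasure_mono) auto
  qed
  assume K: "K = space C"
  show "AE b in B. emeasure (q b) {0<..} = 1"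
    by (rule density_unique_finite_measure[OF meas]) (use * Pol_source_marginal[OF Q] K in auto)
qed

section \<open>Existence and uniqueness of the product of polymorphisms\<close>

lemma pol_block_eq_distr:
  assumes s: "sets P = sets (A \<Otimes>\<^sub>M B \<Otimes>\<^sub>M rpos)" and M: "M \<in> sets A" and N: "N \<in> sets B"
  shows "pol_block P M N = distr (density P (indicator (M \<times> N \<times> {0<..}))) rpos (\<lambda>z. snd (snd z))"
proof (rule measure_eqI)
  fix E assume "E \<in> sets (pol_block P M N)"
  then have E: "E \<in> sets rpos" by simp
  have S: "M \<times> N \<times> {0<..} \<in> sets P" using triple_sets[OF s M N sets.top] by simp
  have V: "(\<lambda>z. snd (snd z)) -` E \<inter> space P \<in> sets P"
    using measurable_sets[OF triple_measurable(4)[OF s] E] .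
  have sp: "space P = space A \<times> space B \<times> {0<..}"
    using sets_eq_imp_space_eq[OF s] by (simp add: space_pair_measure)
  have "emeasure (distr (density P (indicator (M \<times> N \<times> {0<..}))) rpos (\<lambda>z. snd (snd z))) E =
    emeasure (density P (indicator (M \<times> N \<times> {0<..}))) ((\<lambda>z. snd (snd z)) -` E \<inter> space P)"
    using triple_measurable(4)[OF s] E by (subst emeasure_distr) simp_all
  also have "\<dots> = emeasure P ((M \<times> N \<times> {0<..}) \<inter> ((\<lambda>z. snd (snd z)) -` E \<inter> space P))"
    using S V by (subst emeasure_density) (simp_all add: nn_integral_indicator sets.Int flip: indicator_inter_arith)
  also have "(M \<times> N \<times> {0<..}) \<inter> ((\<lambda>z. snd (snd z)) -` E \<inter> space P) = M \<times> N \<times> E"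
    using sets.sets_into_space[OF M] sets.sets_into_space[OF N] sets.sets_into_space[OF E] by (auto simp: sp)
  finally show "emeasure (pol_block P M N) E = emeasure (distr (density P (indicator (M \<times> N \<times> {0<..}))) rpos (\<lambda>z. snd (snd z))) E"
    using emeasure_pol_block[OF s M N E] by simp
qed simp

lemma nn_integral_pol_block:
  assumes s: "sets P = sets (A \<Otimes>\<^sub>M B \<Otimes>\<^sub>M rpos)" and M: "M \<in> sets A" and N: "N \<in> sets B"
    and f: "f \<in> borel_measurable rpos"
  shows "(\<integral>\<^sup>+t. f t \<partial>pol_block P M N) = (\<integral>\<^sup>+z. f (snd (snd z)) * indicator (M \<times> N \<times> {0<..}) z \<partial>P)"
proof -
  note m = triple_measurable(4)[OF s]
  have S: "M \<times> N \<times> {0<..} \<in> sets P" using triple_sets[OF s M N sets.top] by simp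
  have "(\<integral>\<^sup>+t. f t \<partial>pol_block P M N) = (\<integral>\<^sup>+z. f (snd (snd z)) \<partial>density P (indicator (M \<times> N \<times> {0<..})))"
    unfolding pol_block_eq_distr[OF s M N] using m f by (intro nn_integral_distr) simp_all
  also have "\<dots> = (\<integral>\<^sup>+z. indicator (M \<times> N \<times> {0<..}) z * f (snd (snd z)) \<partial>P)"
    by (intro nn_integral_density borel_measurable_indicator S measurable_compose[OF m f])
  finally show ?thesis by (simp add: mult.commute)
qed

lemma triple_measure_eqI:
  assumes s: "sets R = sets (A \<Otimes>\<^sub>M C \<Otimes>\<^sub>M rpos)" "sets R' = sets (A \<Otimes>\<^sub>M C \<Otimes>\<^sub>M rpos)"
    and fin: "finite_measure R"
    and eq: "\<And>M K E. M \<in> sets A \<Longrightarrow> K \<in> sets C \<Longrightarrow> E \<in> sets rpos \<Longrightarrow> emeasure R (M \<times> K \<times> E) = emeasure R' (M \<times> K \<times> E)"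
  shows "R = R'"
proof (rule measure_eqI_pair[OF s fin])
  fix M G assume M: "M \<in> sets A" and G: "G \<in> sets (C \<Otimes>\<^sub>M rpos)"
  have em: "emeasure (source_fibre C S M) H = emeasure S (M \<times> H)"
    if s: "sets S = sets (A \<Otimes>\<^sub>M C \<Otimes>\<^sub>M rpos)" and H: "H \<in> sets (C \<Otimes>\<^sub>M rpos)" for S H
  proof -
    have MH: "M \<times> H \<in> sets S" using pair_measureI[OF M H] by (simp add: s)
    have "emeasure (source_fibre C S M) H = (\<integral>\<^sup>+z. indicator H z \<partial>source_fibre C S M)" using H by simp
    also have "\<dots> = (\<integral>\<^sup>+z. indicator H (snd z) * indicator M (fst z) \<partial>S)"
      using nn_integral_source_fibre[OF s M borel_measurable_indicator[OF H]] .
    also have "\<dots> = (\<integral>\<^sup>+z. indicator (M \<times> H) z \<partial>S)"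
    proof (rule nn_integral_cong)
      show "indicator H (snd z) * indicator M (fst z) = (indicator (M \<times> H) z :: ennreal)" for z
        by (cases z) (auto simp: indicator_def)
    qed
    finally show ?thesis using MH by simp
  qed
  have "source_fibre C R M = source_fibre C R' M"
  proof (rule measure_eqI_pair[OF sets_fibre(1) sets_fibre(1)])
    interpret finite_measure R by fact
    have "space (source_fibre C R M) \<in> sets (C \<Otimes>\<^sub>M rpos)"
      using sets.top[of "source_fibre C R M"] by simp
    from em[OF s(1) this] show "finite_measure (source_fibre C R M)"
      by (intro finite_measureI) simp
    fix K E assume KE: "K \<in> sets C" "E \<in> sets rpos"
    show "emeasure (source_fibre C R M) (K \<times> E) = emeasure (source_fibre C R' M) (K \<times> E)"
      using emeasure_source_fibre[OF s(1) M KE] emeasure_source_fibre[OF s(2) M KE] eq[OF M KE] by simp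
  qed
  then show "emeasure R (M \<times> G) = emeasure R' (M \<times> G)"
    using em[OF s(1) G] em[OF s(2) G] by simp
qed

lemma is_pol_product_unique:
  assumes B: "finite_measure B" and A: "finite_measure A"
    and R: "is_pol_product A B C Q P R" and R': "is_pol_product A B C Q P R'"
  shows "R = R'"
proof -
  have RP: "R \<in> Pol A C" "R' \<in> Pol A C" using R R' by (auto simp: is_pol_product_def)
  show ?thesis
  proof (rule triple_measure_eqI[OF PolD(1)[OF RP(1)] PolD(1)[OF RP(2)] Pol_finite[OF RP(1) A]])
    fix M K E assume MKE: "M \<in> sets A" "K \<in> sets C" "E \<in> sets rpos"
    obtain p q where pq: "\<And>N. N \<in> sets B \<Longrightarrow> is_measure_integral B N p (pol_block P M N)"
      "\<And>N. N \<in> sets B \<Longrightarrow> is_measure_integral B N q (pol_block Q N K)"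
      "is_measure_integral B (space B) (\<lambda>b. mult_convolution (q b) (p b)) (pol_block R M K)"
      using R MKE unfolding is_pol_product_def by blast
    obtain p' q' where pq': "\<And>N. N \<in> sets B \<Longrightarrow> is_measure_integral B N p' (pol_block P M N)"
      "\<And>N. N \<in> sets B \<Longrightarrow> is_measure_integral B N q' (pol_block Q N K)"
      "is_measure_integral B (space B) (\<lambda>b. mult_convolution (q' b) (p' b)) (pol_block R' M K)"
      using R' MKE unfolding is_pol_product_def by blast
    have "AE b in B. p b = p' b" "AE b in B. q b = q' b"
      by (rule measure_integral_density_unique[OF B]; fact)+
    then have "(\<integral>\<^sup>+b\<in>space B. emeasure (mult_convolution (q b) (p b)) E \<partial>B) =
        (\<integral>\<^sup>+b\<in>space B. emeasure (mult_convolution (q' b) (p' b)) E \<partial>B)"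
      by (intro nn_integral_cong_AE) (auto elim!: eventually_elim2)
    then have "emeasure (pol_block R M K) E = emeasure (pol_block R' M K) E"
      using pq(3) pq'(3) MKE(3) unfolding is_measure_integral_def by simp
    then show "emeasure R (M \<times> K \<times> E) = emeasure R' (M \<times> K \<times> E)"
      using emeasure_pol_block[OF PolD(1)[OF RP(1)] MKE] emeasure_pol_block[OF PolD(1)[OF RP(2)] MKE] by simp
  qed
qed

text \<open>
  For a disjoint sequence of sets \<open>K i\<close>, the measure \<open>\<rho> (\<Union>i. K i)\<close> and the sum of the measures
  \<open>\<rho> (K i)\<close> agree on rectangles, hence everywhere.
\<close>

lemma bimeasure_of_rectangles:
  assumes \<rho>: "\<And>K. K \<in> sets C \<Longrightarrow> sets (\<rho> K) = sets (X \<Otimes>\<^sub>M Y)" "\<And>K. K \<in> sets C \<Longrightarrow> finite_measure (\<rho> K)"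
    and rect: "\<And>F E. F \<in> sets X \<Longrightarrow> E \<in> sets Y \<Longrightarrow>
      \<exists>\<mu>. sets \<mu> = sets C \<and> (\<forall>K\<in>sets C. emeasure \<mu> K = emeasure (\<rho> K) (F \<times> E))"
  shows "bimeasure (X \<Otimes>\<^sub>M Y) C (\<lambda>G K. emeasure (\<rho> K) G)"
  unfolding bimeasure_def
proof (intro conjI ballI)
  show "emeasure (\<rho> (space C)) (space (X \<Otimes>\<^sub>M Y)) < \<infinity>"
    using finite_measure.emeasure_finite[OF \<rho>(2)[OF sets.top]] by (simp add: less_top)
  show "\<exists>\<nu>. sets \<nu> = sets (X \<Otimes>\<^sub>M Y) \<and> (\<forall>G\<in>sets (X \<Otimes>\<^sub>M Y). emeasure \<nu> G = emeasure (\<rho> K) G)"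
    if "K \<in> sets C" for K
    using \<rho>(1)[OF that] by blast
  fix G assume G: "G \<in> sets (X \<Otimes>\<^sub>M Y)"
  define f where "f K = emeasure (\<rho> K) G" for K
  have "f {} = 0"
  proof -
    obtain \<mu> where "\<forall>K\<in>sets C. emeasure \<mu> K = emeasure (\<rho> K) (space X \<times> space Y)"
      using rect[OF sets.top sets.top] by blast
    then have "emeasure (\<rho> {}) (space X \<times> space Y) = 0" by (metis emeasure_empty sets.empty_sets)
    moreover have "emeasure (\<rho> {}) G \<le> emeasure (\<rho> {}) (space X \<times> space Y)"
      using sets.sets_into_space[OF G] pair_measureI[OF sets.top[of X] sets.top[of Y]] \<rho>(1)[OF sets.empty_sets]
      by (intro emeasure_mono) (simp_all add: space_pair_measure)
    ultimately show ?thesis by (simp add: f_def)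
  qed
  then have pos: "positive (sets C) f" by (simp add: positive_def)
  have ca: "countably_additive (sets C) f"
    unfolding countably_additive_def
  proof (intro allI impI)
    fix K :: "nat \<Rightarrow> _" assume K: "range K \<subseteq> sets C" "disjoint_family K" "(\<Union>i. K i) \<in> sets C"
    have Ki: "K i \<in> sets C" for i using K(1) by auto
    \<comment> \<open>The countable sum of measures, as a mixture over the counting measure.\<close>
    define \<tau> where "\<tau> = mixture (count_space UNIV) (\<lambda>i. \<rho> (K i)) (X \<Otimes>\<^sub>M Y)"
    have k: "finite_kernel (count_space UNIV) (X \<Otimes>\<^sub>M Y) (\<lambda>i. \<rho> (K i))"
      unfolding finite_kernel_def using \<rho> Ki by auto
    have \<tau>: "emeasure \<tau> G = (\<Sum>i. emeasure (\<rho> (K i)) G)" if "G \<in> sets (X \<Otimes>\<^sub>M Y)" for G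
      unfolding \<tau>_def emeasure_mixture[OF k that] by (rule nn_integral_count_space_nat)
    have "\<rho> (\<Union>i. K i) = \<tau>"
    proof (rule measure_eqI_pair[OF \<rho>(1)[OF K(3)] _ \<rho>(2)[OF K(3)]])
      show "sets \<tau> = sets (X \<Otimes>\<^sub>M Y)" by (simp add: \<tau>_def)
      fix F E assume FE: "F \<in> sets X" "E \<in> sets Y"
      obtain \<mu> where \<mu>: "sets \<mu> = sets C" "\<And>K. K \<in> sets C \<Longrightarrow> emeasure \<mu> K = emeasure (\<rho> K) (F \<times> E)"
        using rect[OF FE] by blast
      have "(\<Sum>i. emeasure \<mu> (K i)) = emeasure \<mu> (\<Union>i. K i)"
        using K \<mu>(1) by (intro suminf_emeasure) auto
      then show "emeasure (\<rho> (\<Union>i. K i)) (F \<times> E) = emeasure \<tau> (F \<times> E)"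
        using \<mu>(2) Ki K(3) \<tau>[OF pair_measureI[OF FE]] by simp
    qed
    then show "(\<Sum>i. f (K i)) = f (\<Union>i. K i)"
      using \<tau>[OF G] by (simp add: f_def)
  qed
  show "\<exists>\<mu>. sets \<mu> = sets C \<and> (\<forall>K\<in>sets C. emeasure \<mu> K = emeasure (\<rho> K) G)"
  proof (intro exI[of _ "measure_of (space C) (sets C) f"] conjI ballI)
    show "emeasure (measure_of (space C) (sets C) f) K = emeasure (\<rho> K) G" if "K \<in> sets C" for K
      using emeasure_measure_of_sigma[OF sets.sigma_algebra_axioms pos ca that] by (simp add: f_def)
  qed (simp add: sets.space_closed)
qed

text \<open>
  For fixed \<open>K\<close> the required values on \<open>M \<times> E\<close> come from the measure \<open>\<rho> K\<close>: move along \<open>P\<close> and multiply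
  the third coordinate by a factor distributed as \<open>q K b\<close>. For fixed \<open>M\<close> and \<open>E\<close> the roles of \<open>P\<close> and
  \<open>Q\<close> can be exchanged, because convolution is commutative; this shows additivity in \<open>K\<close>. So the
  values form a bimeasure, which extends to a measure since \<open>C\<close> is a Lebesgue space. Its marginals
  are right because the densities of \<open>Q\<close> over the whole of \<open>C\<close> have mass 1 and those of \<open>P\<close> over the
  whole of \<open>A\<close> have first moment 1.
\<close>

lemma pol_product_blocks_exist:
  assumes A: "finite_measure A" "space A \<noteq> {}" and B: "finite_measure B" and C: "lebesgue_space C"
    and P: "P \<in> Pol A B" and Q: "Q \<in> Pol B C"
    and p: "\<And>M. M \<in> sets A \<Longrightarrow> finite_kernel B rpos (p M)"
      "\<And>M N E. M \<in> sets A \<Longrightarrow> N \<in> sets B \<Longrightarrow> E \<in> sets rpos \<Longrightarrow>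
        emeasure (source_fibre B P M) (N \<times> E) = (\<integral>\<^sup>+b\<in>N. emeasure (p M b) E \<partial>B)"
    and q: "\<And>K. K \<in> sets C \<Longrightarrow> finite_kernel B rpos (q K)"
      "\<And>K N E. K \<in> sets C \<Longrightarrow> N \<in> sets B \<Longrightarrow> E \<in> sets rpos \<Longrightarrow>
        emeasure (target_fibre B Q K) (N \<times> E) = (\<integral>\<^sup>+b\<in>N. emeasure (q K b) E \<partial>B)"
  obtains R where "R \<in> Pol A C"
    "\<And>M K E. M \<in> sets A \<Longrightarrow> K \<in> sets C \<Longrightarrow> E \<in> sets rpos \<Longrightarrow>
       emeasure R (M \<times> K \<times> E) = (\<integral>\<^sup>+b. emeasure (mult_convolution (q K b) (p M b)) E \<partial>B)"
proof -
  note sP = PolD(1)[OF P] and sQ = PolD(1)[OF Q]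
  define conv where "conv M K E = (\<integral>\<^sup>+b. emeasure (mult_convolution (q K b) (p M b)) E \<partial>B)" for M K E
  define k where "k K z = distr (q K (fst (snd z))) (A \<Otimes>\<^sub>M rpos) (\<lambda>u. (fst z, snd (snd z) * u))" for K z
  have k: "finite_kernel P (A \<Otimes>\<^sub>M rpos) (k K)" if K: "K \<in> sets C" for K
  proof -
    note m = triple_measurable[OF sP]
    have m1: "(\<lambda>z. fst (fst z)) \<in> P \<Otimes>\<^sub>M rpos \<rightarrow>\<^sub>M A"
      using measurable_compose[OF measurable_fst m(1)] .
    have m2: "(\<lambda>z. snd (snd (fst z)) * snd z) \<in> P \<Otimes>\<^sub>M rpos \<rightarrow>\<^sub>M rpos"
    proof (rule measurable_rposI)
      show "(\<lambda>z. snd (snd (fst z)) * snd z) \<in> borel_measurable (P \<Otimes>\<^sub>M rpos)"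
        by (rule borel_measurable_times[OF measurable_compose[OF measurable_fst m(5)] snd_rpos_borel])
      show "0 < snd (snd (fst z)) * snd z" if "z \<in> space (P \<Otimes>\<^sub>M rpos)" for z
        using that unfolding space_pair_measure PolD(2)[OF P] by auto
    qed
    show ?thesis
      unfolding k_def using finite_kernel_distr[OF q(1)[OF K] m(3) measurable_Pair[OF m1 m2]] by simp
  qed
  have emk: "emeasure (k K z) (M \<times> E) = emeasure (distr (q K (fst (snd z))) rpos (\<lambda>u. snd (snd z) * u)) E * indicator M (fst z)"
    if K: "K \<in> sets C" and M: "M \<in> sets A" and E: "E \<in> sets rpos" and z: "z \<in> space P" for K M E z
  proof -
    have z': "fst z \<in> space A" "fst (snd z) \<in> space B" "snd (snd z) > 0"
      using z unfolding PolD(2)[OF P] by auto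
    note f = finite_kernelD[OF q(1)[OF K]]
    have mult: "(\<lambda>u. snd (snd z) * u) \<in> q K (fst (snd z)) \<rightarrow>\<^sub>M rpos"
      unfolding measurable_cong_sets[OF f(1)[OF z'(2)] refl] using z'(3)
      by (intro measurable_rposI borel_measurable_times id_rpos_borel) auto
    have pair: "(\<lambda>u. (fst z, snd (snd z) * u)) \<in> q K (fst (snd z)) \<rightarrow>\<^sub>M A \<Otimes>\<^sub>M rpos"
      using z'(1) mult by (intro measurable_Pair) simp_all
    have "(\<lambda>u. (fst z, snd (snd z) * u)) -` (M \<times> E) \<inter> space (q K (fst (snd z))) =
      (if fst z \<in> M then (\<lambda>u. snd (snd z) * u) -` E \<inter> space (q K (fst (snd z))) else {})" by auto
    then show ?thesis
      unfolding k_def emeasure_distr[OF pair pair_measureI[OF M E]] emeasure_distr[OF mult E] by simp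
  qed
  define \<rho> where "\<rho> K = mixture P (k K) (A \<Otimes>\<^sub>M rpos)" for K
  have \<rho>: "emeasure (\<rho> K) (M \<times> E) = conv M K E" if K: "K \<in> sets C" and M: "M \<in> sets A" and E: "E \<in> sets rpos" for K M E
  proof -
    have "emeasure (\<rho> K) (M \<times> E) = (\<integral>\<^sup>+z. emeasure (k K z) (M \<times> E) \<partial>P)"
      unfolding \<rho>_def by (rule emeasure_mixture[OF k[OF K] pair_measureI[OF M E]])
    also have "\<dots> = (\<integral>\<^sup>+z. emeasure (distr (q K (fst (snd z))) rpos (\<lambda>u. snd (snd z) * u)) E * indicator M (fst z) \<partial>P)"
      by (intro nn_integral_cong emk K M E)
    also have "\<dots> = (\<integral>\<^sup>+y. emeasure (distr (q K (fst y)) rpos (\<lambda>u. snd y * u)) E \<partial>source_fibre B P M)"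
      by (rule nn_integral_source_fibre[OF sP M finite_kernelD(4)[OF mult_rpos_kernel[OF q(1)[OF K]] E], symmetric])
    also have "\<dots> = conv M K E"
      unfolding conv_def
      by (rule integral_mult_kernel_eq_convolution[OF p(1)[OF M] q(1)[OF K] sets_fibre(1) fibre_finite(1)[OF P A(1) M sets.top] p(2)[OF M] E])
    finally show ?thesis .
  qed
  have conv_mass: "conv M K {0<..} = (\<integral>\<^sup>+b. emeasure (q K b) {0<..} * emeasure (p M b) {0<..} \<partial>B)"
    if "K \<in> sets C" "M \<in> sets A" for K M
    unfolding conv_def using finite_kernelD[OF q(1)[OF that(1)]] finite_kernelD[OF p(1)[OF that(2)]]
    by (intro nn_integral_cong mult_convolution_mass(1)) auto
  have p_mass: "(\<integral>\<^sup>+b. emeasure (p M b) {0<..} \<partial>B) = emeasure A M" if M: "M \<in> sets A" for M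
  proof -
    have "(\<integral>\<^sup>+b\<in>space B. emeasure (p M b) {0<..} \<partial>B) = emeasure A M"
      using p(2)[OF M sets.top sets.top] emeasure_source_fibre[OF sP M sets.top sets.top] Pol_source_marginal[OF P M] by simp
    then show ?thesis by (simp cong: nn_integral_cong)
  qed
  have q_le: "AE b in B. emeasure (q K b) {0<..} \<le> 1" if K: "K \<in> sets C" for K
    by (rule target_mass_le_1(1)[OF Q B K q(1)[OF K]]) (rule q(2)[OF K])
  have q_1: "AE b in B. emeasure (q (space C) b) {0<..} = 1"
    by (rule target_mass_le_1(2)[OF Q B sets.top q(1)[OF sets.top] _ refl]) (rule q(2)[OF sets.top])
  have p_1: "AE b in B. (\<integral>\<^sup>+t. ennreal t \<partial>p (space A) b) = 1"
    by (rule source_moment_le_1(2)[OF P A(1) B sets.top p(1)[OF sets.top] _ refl]) (rule p(2)[OF sets.top])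
  have sets_\<rho>: "sets (\<rho> K) = sets (A \<Otimes>\<^sub>M rpos)" for K by (simp add: \<rho>_def)
  have fin_\<rho>: "finite_measure (\<rho> K)" if K: "K \<in> sets C" for K
  proof
    have "emeasure (\<rho> K) (space (\<rho> K)) = conv (space A) K {0<..}"
      using \<rho>[OF K sets.top sets.top] sets_eq_imp_space_eq[OF sets_\<rho>] by (simp add: space_pair_measure)
    also have "\<dots> \<le> (\<integral>\<^sup>+b. emeasure (p (space A) b) {0<..} \<partial>B)"
      unfolding conv_mass[OF K sets.top]
    proof (rule nn_integral_mono_AE)
      show "AE b in B. emeasure (q K b) {0<..} * emeasure (p (space A) b) {0<..} \<le> emeasure (p (space A) b) {0<..}"
        using q_le[OF K]
        by eventually_elim (use mult_right_mono[of _ "1::ennreal"] in auto)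
    qed
    also have "\<dots> < \<infinity>" using p_mass[OF sets.top] finite_measure.emeasure_finite[OF A(1)] by (simp add: less_top)
    finally show "emeasure (\<rho> K) (space (\<rho> K)) \<noteq> \<infinity>" by simp
  qed
  have m: "bimeasure (A \<Otimes>\<^sub>M rpos) C (\<lambda>G K. emeasure (\<rho> K) G)"
  proof (rule bimeasure_of_rectangles[OF sets_\<rho> fin_\<rho>])
    fix M E assume M: "M \<in> sets A" and E: "E \<in> sets rpos"
    let ?g = "\<lambda>y. emeasure (distr (p M (fst y)) rpos (\<lambda>s. snd y * s)) E"
    define H where "H = distr (density Q (\<lambda>z. ?g (fst z, snd (snd z)))) C (\<lambda>z. fst (snd z))"
    note mQ = triple_measurable[OF sQ]
    have g: "?g \<in> borel_measurable (B \<Otimes>\<^sub>M rpos)"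
      by (rule finite_kernelD(4)[OF mult_rpos_kernel[OF p(1)[OF M]] E])
    have g': "(\<lambda>z. ?g (fst z, snd (snd z))) \<in> borel_measurable Q"
      by (rule measurable_compose[OF mQ(6) g])
    have "emeasure H K = emeasure (\<rho> K) (M \<times> E)" if K: "K \<in> sets C" for K
    proof -
      have V: "(\<lambda>z. fst (snd z)) -` K \<inter> space Q \<in> sets Q" using measurable_sets[OF mQ(3) K] .
      have "emeasure H K = emeasure (density Q (\<lambda>z. ?g (fst z, snd (snd z)))) ((\<lambda>z. fst (snd z)) -` K \<inter> space Q)"
        unfolding H_def using mQ(3) K by (subst emeasure_distr) simp_all
      also have "\<dots> = (\<integral>\<^sup>+z. ?g (fst z, snd (snd z)) * indicator K (fst (snd z)) \<partial>Q)"
        using V g' by (subst emeasure_density) (auto intro!: nn_integral_cong simp: indicator_def)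
      also have "\<dots> = (\<integral>\<^sup>+y. ?g y \<partial>target_fibre B Q K)"
        by (rule nn_integral_target_fibre[OF sQ K g, symmetric])
      also have "\<dots> = (\<integral>\<^sup>+b. emeasure (mult_convolution (p M b) (q K b)) E \<partial>B)"
        by (rule integral_mult_kernel_eq_convolution[OF q(1)[OF K] p(1)[OF M] sets_fibre(2) fibre_finite(2)[OF Q B sets.top K] q(2)[OF K] E])
      also have "\<dots> = conv M K E"
        unfolding conv_def using finite_kernelD[OF q(1)[OF K]] finite_kernelD[OF p(1)[OF M]]
        by (intro nn_integral_cong arg_cong2[where f=emeasure] mult_convolution_commute refl) auto
      finally show ?thesis using \<rho>[OF K M E] by simp
    qed
    then show "\<exists>\<mu>. sets \<mu> = sets C \<and> (\<forall>K\<in>sets C. emeasure \<mu> K = emeasure (\<rho> K) (M \<times> E))"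
      by (intro exI[of _ H]) (simp add: H_def)
  qed
  have null: "emeasure (\<rho> K) (space (A \<Otimes>\<^sub>M rpos)) = 0" if K: "K \<in> null_sets C" for K
  proof -
    have Ks: "K \<in> sets C" using K by auto
    have "(\<integral>\<^sup>+b\<in>space B. emeasure (q K b) {0<..} \<partial>B) = 0"
      using q(2)[OF Ks sets.top sets.top] emeasure_target_fibre[OF sQ sets.top Ks sets.top] Pol_null_target[OF Q K] by simp
    then have "(\<integral>\<^sup>+b. emeasure (q K b) {0<..} \<partial>B) = 0" by (simp cong: nn_integral_cong)
    then have "AE b in B. emeasure (q K b) {0<..} = 0"
      using finite_kernelD(4)[OF q(1)[OF Ks] sets.top] by (subst (asm) nn_integral_0_iff_AE) simp_all
    then have "(\<integral>\<^sup>+b. emeasure (q K b) {0<..} * emeasure (p (space A) b) {0<..} \<partial>B) = (\<integral>\<^sup>+b. 0 \<partial>B)"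
      by (intro nn_integral_cong_AE) (auto elim!: eventually_mono)
    then have "conv (space A) K {0<..} = 0" using conv_mass[OF Ks sets.top] by simp
    then show ?thesis using \<rho>[OF Ks sets.top sets.top] by (simp add: space_pair_measure)
  qed
  have "space (A \<Otimes>\<^sub>M rpos) \<noteq> {}" using A(2) by (simp add: space_pair_measure)
  from bimeasure_extends[OF C m this null] obtain R' where
    sR': "sets R' = sets ((A \<Otimes>\<^sub>M rpos) \<Otimes>\<^sub>M C)"
    and R': "\<And>G K. G \<in> sets (A \<Otimes>\<^sub>M rpos) \<Longrightarrow> K \<in> sets C \<Longrightarrow> emeasure R' (G \<times> K) = emeasure (\<rho> K) G" by blast
  define swap where "swap = (\<lambda>z :: ('a \<times> real) \<times> 'c. (fst (fst z), snd z, snd (fst z)))"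
  define R where "R = distr R' (A \<Otimes>\<^sub>M C \<Otimes>\<^sub>M rpos) swap"
  have swap: "swap \<in> R' \<rightarrow>\<^sub>M A \<Otimes>\<^sub>M C \<Otimes>\<^sub>M rpos"
    unfolding measurable_cong_sets[OF sR' refl] swap_def by measurable
  have sR: "sets R = sets (A \<Otimes>\<^sub>M C \<Otimes>\<^sub>M rpos)" by (simp add: R_def)
  have R: "emeasure R (M \<times> K \<times> E) = conv M K E" if M: "M \<in> sets A" and K: "K \<in> sets C" and E: "E \<in> sets rpos" for M K E
  proof -
    have "emeasure R (M \<times> K \<times> E) = emeasure R' (swap -` (M \<times> K \<times> E) \<inter> space R')"
      unfolding R_def using pair_measureI[OF M pair_measureI[OF K E]] by (rule emeasure_distr[OF swap])
    also have "swap -` (M \<times> K \<times> E) \<inter> space R' = (M \<times> E) \<times> K"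
      using sets_eq_imp_space_eq[OF sR'] sets.sets_into_space[OF M] sets.sets_into_space[OF K] sets.sets_into_space[OF E]
      by (auto simp: space_pair_measure swap_def)
    finally show ?thesis using R'[OF pair_measureI[OF M E] K] \<rho>[OF K M E] by simp
  qed
  have spR: "space R = space A \<times> space C \<times> {0<..}"
    using sets_eq_imp_space_eq[OF sR] by (simp add: space_pair_measure)
  note mR = triple_measurable[OF sR]
  have "distr R A (\<lambda>(a, c, t). a) = A"
  proof (rule measure_eqI)
    fix M assume "M \<in> sets (distr R A (\<lambda>(a, c, t). a))"
    then have M: "M \<in> sets A" by simp
    have "emeasure (distr R A (\<lambda>(a, c, t). a)) M = emeasure R ((\<lambda>(a, c, t). a) -` M \<inter> space R)"
      using mR(1) M by (intro emeasure_distr) (simp_all add: case_prod_beta')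
    also have "(\<lambda>(a, c, t). a) -` M \<inter> space R = M \<times> space C \<times> {0<..}"
      using sets.sets_into_space[OF M] spR by auto
    also have "emeasure R \<dots> = conv M (space C) {0<..}" using R[OF M sets.top sets.top] by simp
    also have "\<dots> = (\<integral>\<^sup>+b. emeasure (p M b) {0<..} \<partial>B)"
      unfolding conv_mass[OF sets.top M]
      using q_1
      by (intro nn_integral_cong_AE) (auto elim!: eventually_mono)
    also have "\<dots> = emeasure A M" by (rule p_mass[OF M])
    finally show "emeasure (distr R A (\<lambda>(a, c, t). a)) M = emeasure A M" .
  qed simp
  moreover have "distr (density R (\<lambda>(a, c, t). ennreal t)) C (\<lambda>(a, c, t). c) = C"
  proof (rule measure_eqI)
    fix K assume "K \<in> sets (distr (density R (\<lambda>(a, c, t). ennreal t)) C (\<lambda>(a, c, t). c))"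
    then have K: "K \<in> sets C" by simp
    have im: "(\<lambda>t. ennreal t) \<in> borel_measurable rpos"
      by (rule measurable_compose[OF id_rpos_borel measurable_ennreal])
    have V: "(\<lambda>(a, c, t). c) -` K \<inter> space R \<in> sets R"
      using measurable_sets[OF mR(3) K] by (simp add: case_prod_beta' vimage_def)
    have ck: "finite_kernel B rpos (\<lambda>b. mult_convolution (q K b) (p (space A) b))"
      by (rule finite_kernel_mult_convolution[OF p(1)[OF sets.top] q(1)[OF K]])
    have "pol_block R (space A) K = mixture B (\<lambda>b. mult_convolution (q K b) (p (space A) b)) rpos"
      by (rule measure_eqI)
         (simp_all add: emeasure_pol_block[OF sR sets.top K] R[OF sets.top K] conv_def emeasure_mixture[OF ck])
    then have "(\<integral>\<^sup>+t. ennreal t \<partial>pol_block R (space A) K) = (\<integral>\<^sup>+b. \<integral>\<^sup>+t. ennreal t \<partial>mult_convolution (q K b) (p (space A) b) \<partial>B)"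
      using nn_integral_mixture[OF ck im] by simp
    also have "\<dots> = (\<integral>\<^sup>+b. (\<integral>\<^sup>+t. ennreal t \<partial>q K b) * (\<integral>\<^sup>+t. ennreal t \<partial>p (space A) b) \<partial>B)"
      using finite_kernelD[OF q(1)[OF K]] finite_kernelD[OF p(1)[OF sets.top]]
      by (intro nn_integral_cong mult_convolution_mass(2)) auto
    also have "\<dots> = (\<integral>\<^sup>+b\<in>space B. (\<integral>\<^sup>+t. ennreal t \<partial>q K b) \<partial>B)"
    proof (rule nn_integral_cong_AE)
      show "AE b in B. (\<integral>\<^sup>+t. ennreal t \<partial>q K b) * (\<integral>\<^sup>+t. ennreal t \<partial>p (space A) b) = (\<integral>\<^sup>+t. ennreal t \<partial>q K b) * indicator (space B) b"
        using p_1 AE_space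
        by eventually_elim simp
    qed
    also have "\<dots> = (\<integral>\<^sup>+z. ennreal (snd z) * indicator (space B) (fst z) \<partial>target_fibre B Q K)"
      by (rule first_moment_disintegration[OF q(1)[OF K] sets_fibre(2) fibre_finite(2)[OF Q B sets.top K] q(2)[OF K] sets.top])
    also have "\<dots> = (\<integral>\<^sup>+z. ennreal (snd z) \<partial>target_fibre B Q K)"
    proof (rule nn_integral_cong)
      fix z assume "z \<in> space (target_fibre B Q K)"
      then have "fst z \<in> space B"
        unfolding sets_eq_imp_space_eq[OF sets_fibre(2), of B Q K] space_pair_measure by auto
      then show "ennreal (snd z) * indicator (space B) (fst z) = ennreal (snd z)" by simp
    qed
    also have "\<dots> = emeasure C K"
      using nn_integral_target_fibre[OF sQ K measurable_compose[OF snd_rpos_borel measurable_ennreal]]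
        Pol_target_marginal[OF Q K] by simp
    finally have moment: "(\<integral>\<^sup>+t. ennreal t \<partial>pol_block R (space A) K) = emeasure C K" .
    have "emeasure (distr (density R (\<lambda>(a, c, t). ennreal t)) C (\<lambda>(a, c, t). c)) K =
        emeasure (density R (\<lambda>(a, c, t). ennreal t)) ((\<lambda>(a, c, t). c) -` K \<inter> space R)"
      using mR(3) K by (subst emeasure_distr) (simp_all add: case_prod_beta')
    also have "\<dots> = (\<integral>\<^sup>+z. ennreal (snd (snd z)) * indicator ((\<lambda>(a, c, t). c) -` K \<inter> space R) z \<partial>R)"
      using mR(5) V by (subst emeasure_density) (simp_all add: case_prod_beta')
    also have "\<dots> = (\<integral>\<^sup>+z. ennreal (snd (snd z)) * indicator (space A \<times> K \<times> {0<..}) z \<partial>R)"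
    proof (rule nn_integral_cong)
      fix z assume "z \<in> space R"
      then have "z \<in> (\<lambda>(a, c, t). c) -` K \<inter> space R \<longleftrightarrow> z \<in> space A \<times> K \<times> {0<..}"
        unfolding spR by auto
      then show "ennreal (snd (snd z)) * indicator ((\<lambda>(a, c, t). c) -` K \<inter> space R) z =
          ennreal (snd (snd z)) * indicator (space A \<times> K \<times> {0<..}) z"
        by (simp add: indicator_def)
    qed
    also have "\<dots> = emeasure C K"
      using nn_integral_pol_block[OF sR sets.top K im] moment by simp
    finally show "emeasure (distr (density R (\<lambda>(a, c, t). ennreal t)) C (\<lambda>(a, c, t). c)) K = emeasure C K" .
  qed simp
  ultimately have "R \<in> Pol A C" using sR by (simp add: Pol_def)
  then show thesis using that R unfolding conv_def by blast
qed

lemma pol_product: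
  assumes A: "lebesgue_space A" and B: "lebesgue_space B" and C: "lebesgue_space C"
    and P: "P \<in> Pol A B" and Q: "Q \<in> Pol B C"
  shows "is_pol_product A B C Q P (pol_product A B C Q P)"
proof -
  note fA = lebesgue_space_finite[OF A] and fB = lebesgue_space_finite[OF B] and fC = lebesgue_space_finite[OF C]
  have "\<forall>M\<in>sets A. \<exists>p. finite_kernel B rpos p \<and> (\<forall>b\<in>space B. p b \<in> mtri) \<and>
    (\<forall>N\<in>sets B. \<forall>E\<in>sets rpos. emeasure (source_fibre B P M) (N \<times> E) = (\<integral>\<^sup>+b\<in>N. emeasure (p b) E \<partial>B)) \<and>
    (\<forall>N\<in>sets B. is_measure_integral B N p (pol_block P M N))"
  proof
    fix M assume M: "M \<in> sets A"
    obtain p where "finite_kernel B rpos p" "\<And>b. b \<in> space B \<Longrightarrow> p b \<in> mtri"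
      "\<And>N E. N \<in> sets B \<Longrightarrow> E \<in> sets rpos \<Longrightarrow> emeasure (source_fibre B P M) (N \<times> E) = (\<integral>\<^sup>+b\<in>N. emeasure (p b) E \<partial>B)"
      "\<And>N. N \<in> sets B \<Longrightarrow> is_measure_integral B N p (pol_block P M N)"
      by (rule source_disintegration[OF P fA fB M]) blast
    then show "\<exists>p. finite_kernel B rpos p \<and> (\<forall>b\<in>space B. p b \<in> mtri) \<and>
      (\<forall>N\<in>sets B. \<forall>E\<in>sets rpos. emeasure (source_fibre B P M) (N \<times> E) = (\<integral>\<^sup>+b\<in>N. emeasure (p b) E \<partial>B)) \<and>
      (\<forall>N\<in>sets B. is_measure_integral B N p (pol_block P M N))" by blast
  qed
  from bchoice[OF this] obtain p where p: "\<And>M. M \<in> sets A \<Longrightarrow> finite_kernel B rpos (p M)"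
    "\<And>M b. M \<in> sets A \<Longrightarrow> b \<in> space B \<Longrightarrow> p M b \<in> mtri"
    "\<And>M N E. M \<in> sets A \<Longrightarrow> N \<in> sets B \<Longrightarrow> E \<in> sets rpos \<Longrightarrow>
        emeasure (source_fibre B P M) (N \<times> E) = (\<integral>\<^sup>+b\<in>N. emeasure (p M b) E \<partial>B)"
    "\<And>M N. M \<in> sets A \<Longrightarrow> N \<in> sets B \<Longrightarrow> is_measure_integral B N (p M) (pol_block P M N)"
    by blast
  have "\<forall>K\<in>sets C. \<exists>q. finite_kernel B rpos q \<and> (\<forall>b\<in>space B. q b \<in> mtri) \<and>
    (\<forall>N\<in>sets B. \<forall>E\<in>sets rpos. emeasure (target_fibre B Q K) (N \<times> E) = (\<integral>\<^sup>+b\<in>N. emeasure (q b) E \<partial>B)) \<and>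
    (\<forall>N\<in>sets B. is_measure_integral B N q (pol_block Q N K))"
  proof
    fix K assume K: "K \<in> sets C"
    obtain q where "finite_kernel B rpos q" "\<And>b. b \<in> space B \<Longrightarrow> q b \<in> mtri"
      "\<And>N E. N \<in> sets B \<Longrightarrow> E \<in> sets rpos \<Longrightarrow> emeasure (target_fibre B Q K) (N \<times> E) = (\<integral>\<^sup>+b\<in>N. emeasure (q b) E \<partial>B)"
      "\<And>N. N \<in> sets B \<Longrightarrow> is_measure_integral B N q (pol_block Q N K)"
      by (rule target_disintegration[OF Q fB fC K]) blast
    then show "\<exists>q. finite_kernel B rpos q \<and> (\<forall>b\<in>space B. q b \<in> mtri) \<and>
      (\<forall>N\<in>sets B. \<forall>E\<in>sets rpos. emeasure (target_fibre B Q K) (N \<times> E) = (\<integral>\<^sup>+b\<in>N. emeasure (q b) E \<partial>B)) \<and>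
      (\<forall>N\<in>sets B. is_measure_integral B N q (pol_block Q N K))" by blast
  qed
  from bchoice[OF this] obtain q where q: "\<And>K. K \<in> sets C \<Longrightarrow> finite_kernel B rpos (q K)"
    "\<And>K b. K \<in> sets C \<Longrightarrow> b \<in> space B \<Longrightarrow> q K b \<in> mtri"
    "\<And>K N E. K \<in> sets C \<Longrightarrow> N \<in> sets B \<Longrightarrow> E \<in> sets rpos \<Longrightarrow>
        emeasure (target_fibre B Q K) (N \<times> E) = (\<integral>\<^sup>+b\<in>N. emeasure (q K b) E \<partial>B)"
    "\<And>K N. K \<in> sets C \<Longrightarrow> N \<in> sets B \<Longrightarrow> is_measure_integral B N (q K) (pol_block Q N K)"
    by blast
  obtain R where R: "R \<in> Pol A C"
    "\<And>M K E. M \<in> sets A \<Longrightarrow> K \<in> sets C \<Longrightarrow> E \<in> sets rpos \<Longrightarrow>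
       emeasure R (M \<times> K \<times> E) = (\<integral>\<^sup>+b. emeasure (mult_convolution (q K b) (p M b)) E \<partial>B)"
    by (rule pol_product_blocks_exist[OF fA lebesgue_space_nonempty[OF A] fB C P Q p(1) p(3) q(1) q(3)]) blast+
  have "is_pol_product A B C Q P R"
    unfolding is_pol_product_def
  proof (intro conjI ballI R(1))
    fix M K assume M: "M \<in> sets A" and K: "K \<in> sets C"
    have "is_measure_integral B (space B) (\<lambda>b. mult_convolution (q K b) (p M b)) (pol_block R M K)"
    proof (rule is_measure_integralI)
      show "finite_kernel B rpos (\<lambda>b. mult_convolution (q K b) (p M b))"
        by (rule finite_kernel_mult_convolution[OF p(1)[OF M] q(1)[OF K]])
      show "mult_convolution (q K b) (p M b) \<in> mtri" if "b \<in> space B" for b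
        by (rule mult_convolution_mtri[OF q(2)[OF K that] p(2)[OF M that]])
      show "emeasure (pol_block R M K) E = (\<integral>\<^sup>+b\<in>space B. emeasure (mult_convolution (q K b) (p M b)) E \<partial>B)"
        if "E \<in> sets rpos" for E
        using emeasure_pol_block[OF PolD(1)[OF R(1)] M K that] R(2)[OF M K that] by (simp cong: nn_integral_cong)
    qed simp
    then show "\<exists>p q. (\<forall>N\<in>sets B. is_measure_integral B N p (pol_block P M N)) \<and>
        (\<forall>N\<in>sets B. is_measure_integral B N q (pol_block Q N K)) \<and>
        is_measure_integral B (space B) (\<lambda>b. mult_convolution (q b) (p b)) (pol_block R M K)"
      using p(4)[OF M] q(4)[OF K] by blast
  qed
  then show ?thesis
    unfolding pol_product_def by (rule theI) (rule is_pol_product_unique[OF fB fA _ \<open>is_pol_product A B C Q P R\<close>])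
qed

lemma pol_product_Pol:
  assumes "lebesgue_space A" "lebesgue_space B" "lebesgue_space C" "P \<in> Pol A B" "Q \<in> Pol B C"
  shows "pol_product A B C Q P \<in> Pol A C"
  using pol_product[OF assms] by (simp add: is_pol_product_def)

text \<open>
  The definition provides the formula for some pair of densities; by uniqueness almost everywhere it
  holds for every pair.
\<close>

lemma pol_block_pol_product:
  assumes "lebesgue_space A" "lebesgue_space B" "lebesgue_space C" "P \<in> Pol A B" "Q \<in> Pol B C"
    and M: "M \<in> sets A" and K: "K \<in> sets C" and E: "E \<in> sets rpos"
    and p: "\<And>N. N \<in> sets B \<Longrightarrow> is_measure_integral B N p (pol_block P M N)"
    and q: "\<And>N. N \<in> sets B \<Longrightarrow> is_measure_integral B N q (pol_block Q N K)"
  shows "emeasure (pol_block (pol_product A B C Q P) M K) E = (\<integral>\<^sup>+b. emeasure (mult_convolution (q b) (p b)) E \<partial>B)"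
proof -
  have fB: "finite_measure B" using assms(2) by (rule lebesgue_space_finite)
  obtain p' q' where pq': "\<And>N. N \<in> sets B \<Longrightarrow> is_measure_integral B N p' (pol_block P M N)"
      "\<And>N. N \<in> sets B \<Longrightarrow> is_measure_integral B N q' (pol_block Q N K)"
      "is_measure_integral B (space B) (\<lambda>b. mult_convolution (q' b) (p' b)) (pol_block (pol_product A B C Q P) M K)"
    using pol_product[OF assms(1-5)] M K unfolding is_pol_product_def by blast
  have ae: "AE b in B. p' b = p b" "AE b in B. q' b = q b"
    by (rule measure_integral_density_unique[OF fB]; fact)+
  have "emeasure (pol_block (pol_product A B C Q P) M K) E = (\<integral>\<^sup>+b\<in>space B. emeasure (mult_convolution (q' b) (p' b)) E \<partial>B)"
    using pq'(3) E unfolding is_measure_integral_def by blast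
  also have "\<dots> = (\<integral>\<^sup>+b. emeasure (mult_convolution (q b) (p b)) E \<partial>B)"
  proof (rule nn_integral_cong_AE)
    show "AE b in B. emeasure (mult_convolution (q' b) (p' b)) E * indicator (space B) b = emeasure (mult_convolution (q b) (p b)) E"
      using ae AE_space by eventually_elim simp
  qed
  finally show ?thesis .
qed

section \<open>Convergence of fibre measures against product test functions\<close>

lemma nn_integral_mono_measure:
  assumes s: "sets M = sets N" and le: "\<And>E. E \<in> sets N \<Longrightarrow> emeasure M E \<le> emeasure N E"
    and f: "f \<in> borel_measurable N"
  shows "(\<integral>\<^sup>+x. f x \<partial>M) \<le> (\<integral>\<^sup>+x. f x \<partial>N)"
  using f
proof induct
  note sp = sets_eq_imp_space_eq[OF s]
  have m: "g \<in> borel_measurable M" if "g \<in> borel_measurable N" for g :: "_ \<Rightarrow> ennreal"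
    using that by (simp add: measurable_cong_sets[OF s refl])
  {
    case (cong f g)
    have "(\<integral>\<^sup>+x. f x \<partial>M) = (\<integral>\<^sup>+x. g x \<partial>M)" "(\<integral>\<^sup>+x. f x \<partial>N) = (\<integral>\<^sup>+x. g x \<partial>N)"
      by (intro nn_integral_cong; simp add: cong sp)+
    then show ?case using cong(4) by simp
  next
    case (set E)
    then show ?case using le s by simp
  next
    case (mult u c)
    show ?case
      unfolding nn_integral_cmult[OF m[OF mult(2)]] nn_integral_cmult[OF mult(2)] by (rule mult_left_mono[OF mult(4)]) simp
  next
    case (add u v)
    show ?case
      unfolding nn_integral_add[OF m[OF add(4)] m[OF add(1)]] nn_integral_add[OF add(4) add(1)] by (rule add_mono[OF add(7) add(3)])
  next
    case (seq U)
    have "(\<integral>\<^sup>+x. (SUP i. U i) x \<partial>M) = (SUP i. \<integral>\<^sup>+x. U i x \<partial>M)"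
      unfolding SUP_apply by (rule nn_integral_monotone_convergence_SUP[OF seq(4) m[OF seq(1)]])
    also have "\<dots> \<le> (SUP i. \<integral>\<^sup>+x. U i x \<partial>N)"
      using seq(3) by (intro SUP_mono) auto
    also have "\<dots> = (\<integral>\<^sup>+x. (SUP i. U i) x \<partial>N)"
      unfolding SUP_apply by (rule nn_integral_monotone_convergence_SUP[OF seq(4) seq(1), symmetric])
    finally show ?case .
  }
qed

text \<open>
  A sequence converges if it can be approximated, uniformly in the index and together with its
  candidate limit, by convergent sequences. Both extensions of the class of test functions below
  have this form.
\<close>

lemma tendsto_of_uniform_approximation:
  fixes a :: "nat \<Rightarrow> 'v::real_normed_vector"
  assumes "\<And>e. e > 0 \<Longrightarrow> \<exists>a' l'. a' \<longlonglongrightarrow> l' \<and> (\<forall>j. norm (a j - a' j) \<le> e) \<and> norm (l - l') \<le> e"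
  shows "a \<longlonglongrightarrow> l"
proof (rule tendstoI)
  fix e :: real assume "0 < e"
  then obtain a' l' where a': "a' \<longlonglongrightarrow> l'" "\<And>j. norm (a j - a' j) \<le> e / 4" "norm (l - l') \<le> e / 4"
    using assms[of "e / 4"] by auto
  have "\<forall>\<^sub>F j in sequentially. dist (a' j) l' < e / 4"
    using tendstoD[OF a'(1), of "e / 4"] \<open>0 < e\<close> by simp
  then show "\<forall>\<^sub>F j in sequentially. dist (a j) l < e"
  proof eventually_elim
    case (elim j)
    have "a j - l = (a j - a' j) + (a' j - l') - (l - l')" by simp
    also have "norm \<dots> \<le> norm (a j - a' j) + norm (a' j - l') + norm (l - l')"
      by (rule order_trans[OF norm_triangle_ineq4 add_right_mono[OF norm_triangle_ineq]])
    finally show ?case using a'(2)[of j] a'(3) elim \<open>0 < e\<close> by (simp add: dist_norm)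
  qed
qed

text \<open>
  Weak convergence of the blocks over all \<open>N\<close>, expressed by the fibre measures themselves. The
  weighted blocks are covered by applying it to the weighted fibre measures.
\<close>

definition fibre_tendsto :: "'b measure \<Rightarrow> (nat \<Rightarrow> ('b \<times> real) measure) \<Rightarrow> ('b \<times> real) measure \<Rightarrow> bool" where
  "fibre_tendsto B \<nu>j \<nu> \<longleftrightarrow>
     (\<forall>j. sets (\<nu>j j) = sets (B \<Otimes>\<^sub>M rpos) \<and> finite_measure (\<nu>j j)) \<and>
     sets \<nu> = sets (B \<Otimes>\<^sub>M rpos) \<and> finite_measure \<nu> \<and>
     (\<forall>N\<in>sets B. \<forall>h::real \<Rightarrow> real. continuous_on {0<..} h \<and> bounded (h ` {0<..}) \<longrightarrow>
        (\<lambda>j. \<integral>z. indicator N (fst z) * h (snd z) \<partial>\<nu>j j) \<longlonglongrightarrow> (\<integral>z. indicator N (fst z) * h (snd z) \<partial>\<nu>))"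

definition base_marginal_le :: "'b measure \<Rightarrow> ('b \<times> real) measure \<Rightarrow> bool" where
  "base_marginal_le B \<nu> \<longleftrightarrow> (\<forall>N\<in>sets B. emeasure \<nu> (N \<times> {0<..}) \<le> emeasure B N)"

lemma base_measurable:
  assumes s: "sets \<nu> = sets (B \<Otimes>\<^sub>M rpos)"
  shows "fst \<in> \<nu> \<rightarrow>\<^sub>M B" "snd \<in> \<nu> \<rightarrow>\<^sub>M rpos" "space \<nu> = space B \<times> {0<..}"
  using sets_eq_imp_space_eq[OF s]
  by (simp_all add: measurable_cong_sets[OF s refl] space_pair_measure)

lemma continuous_rpos_measurable:
  fixes h :: "real \<Rightarrow> 'v::topological_space"
  assumes "continuous_on {0<..} h"
  shows "h \<in> borel_measurable rpos"
  unfolding rpos_def by (rule borel_measurable_continuous_on_restrict[OF assms])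

lemma product_test_integrable:
  fixes g :: "'b \<Rightarrow> real" and h :: "real \<Rightarrow> complex"
  assumes s: "sets \<nu> = sets (B \<Otimes>\<^sub>M rpos)"
    and h: "continuous_on {0<..} h" "\<And>t. t > 0 \<Longrightarrow> norm (h t) \<le> 1"
    and g: "g \<in> borel_measurable B"
    and fin: "(\<integral>\<^sup>+z. ennreal \<bar>g (fst z)\<bar> \<partial>\<nu>) < \<infinity>"
  shows "integrable \<nu> (\<lambda>z. g (fst z) *\<^sub>R h (snd z))"
    and "norm (\<integral>z. g (fst z) *\<^sub>R h (snd z) \<partial>\<nu>) \<le> enn2real (\<integral>\<^sup>+z. ennreal \<bar>g (fst z)\<bar> \<partial>\<nu>)"
proof -
  note m = base_measurable[OF s]
  have meas: "(\<lambda>z. g (fst z) *\<^sub>R h (snd z)) \<in> borel_measurable \<nu>"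
    by (intro borel_measurable_scaleR measurable_compose[OF m(1) g]
        measurable_compose[OF m(2) continuous_rpos_measurable[OF h(1)]])
  have le: "(\<integral>\<^sup>+z. ennreal (norm (g (fst z) *\<^sub>R h (snd z))) \<partial>\<nu>) \<le> (\<integral>\<^sup>+z. ennreal \<bar>g (fst z)\<bar> \<partial>\<nu>)"
  proof (rule nn_integral_mono)
    fix z assume "z \<in> space \<nu>"
    then have "norm (h (snd z)) \<le> 1" unfolding m(3) by (intro h(2)) auto
    then show "ennreal (norm (g (fst z) *\<^sub>R h (snd z))) \<le> ennreal \<bar>g (fst z)\<bar>"
      by (intro ennreal_leI) (simp add: mult_left_le)
  qed
  show int: "integrable \<nu> (\<lambda>z. g (fst z) *\<^sub>R h (snd z))"
    unfolding integrable_iff_bounded using meas le fin by (auto intro: le_less_trans)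
  have "ennreal (norm (\<integral>z. g (fst z) *\<^sub>R h (snd z) \<partial>\<nu>)) \<le> (\<integral>\<^sup>+z. ennreal \<bar>g (fst z)\<bar> \<partial>\<nu>)"
    using integral_norm_bound_ennreal[OF int] le by (rule order_trans)
  then have "enn2real (ennreal (norm (\<integral>z. g (fst z) *\<^sub>R h (snd z) \<partial>\<nu>))) \<le> enn2real (\<integral>\<^sup>+z. ennreal \<bar>g (fst z)\<bar> \<partial>\<nu>)"
    using fin by (intro enn2real_mono) auto
  then show "norm (\<integral>z. g (fst z) *\<^sub>R h (snd z) \<partial>\<nu>) \<le> enn2real (\<integral>\<^sup>+z. ennreal \<bar>g (fst z)\<bar> \<partial>\<nu>)"
    by simp
qed

lemma bounded_test_finite:
  fixes g :: "'b \<Rightarrow> real"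
  assumes s: "sets \<nu> = sets (B \<Otimes>\<^sub>M rpos)" and fin: "finite_measure \<nu>"
    and c: "\<And>b. b \<in> space B \<Longrightarrow> \<bar>g b\<bar> \<le> c"
  shows "(\<integral>\<^sup>+z. ennreal \<bar>g (fst z)\<bar> \<partial>\<nu>) < \<infinity>"
    "enn2real (\<integral>\<^sup>+z. ennreal \<bar>g (fst z)\<bar> \<partial>\<nu>) \<le> c * measure \<nu> (space \<nu>)"
proof -
  interpret finite_measure \<nu> by fact
  note m = base_measurable[OF s]
  have le: "(\<integral>\<^sup>+z. ennreal \<bar>g (fst z)\<bar> \<partial>\<nu>) \<le> (\<integral>\<^sup>+z. ennreal c \<partial>\<nu>)"
  proof (rule nn_integral_mono)
    fix z assume "z \<in> space \<nu>"
    then show "ennreal \<bar>g (fst z)\<bar> \<le> ennreal c" unfolding m(3) by (intro ennreal_leI c) auto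
  qed
  have top: "ennreal c * emeasure \<nu> (space \<nu>) < \<top>" 
    using emeasure_finite[of "space \<nu>"] less_top[of "emeasure \<nu> (space \<nu>)"] by (simp add: ennreal_mult_less_top)
  then show "(\<integral>\<^sup>+z. ennreal \<bar>g (fst z)\<bar> \<partial>\<nu>) < \<infinity>" using le by (simp add: le_less_trans)
  show "enn2real (\<integral>\<^sup>+z. ennreal \<bar>g (fst z)\<bar> \<partial>\<nu>) \<le> c * measure \<nu> (space \<nu>)"
  proof (cases "space \<nu> = {}")
    case True
    then have "(\<integral>\<^sup>+z. ennreal \<bar>g (fst z)\<bar> \<partial>\<nu>) = 0" by (simp add: nn_integral_empty)
    then show ?thesis using True by simp
  next
    case False
    then obtain b where "b \<in> space B" unfolding m(3) by auto
    then have "0 \<le> c" using c[of b] by linarith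
    have "enn2real (\<integral>\<^sup>+z. ennreal \<bar>g (fst z)\<bar> \<partial>\<nu>) \<le> enn2real (ennreal c * emeasure \<nu> (space \<nu>))"
      using le top by (intro enn2real_mono) simp_all
    then show ?thesis using \<open>0 \<le> c\<close> by (simp add: enn2real_mult measure_def)
  qed
qed

lemma fibre_tendsto_indicator:
  fixes h :: "real \<Rightarrow> complex"
  assumes conv: "fibre_tendsto B \<nu>j \<nu>" and N: "N \<in> sets B"
    and h: "continuous_on {0<..} h" "\<And>t. t > 0 \<Longrightarrow> norm (h t) \<le> 1"
  shows "(\<lambda>j. \<integral>z. indicator N (fst z) *\<^sub>R h (snd z) \<partial>\<nu>j j) \<longlonglongrightarrow> (\<integral>z. indicator N (fst z) *\<^sub>R h (snd z) \<partial>\<nu>)"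
proof -
  have int: "integrable \<mu> (\<lambda>z. indicator N (fst z) *\<^sub>R h (snd z))"
    if "sets \<mu> = sets (B \<Otimes>\<^sub>M rpos)" "finite_measure \<mu>" for \<mu>
    using N by (intro product_test_integrable[OF that(1) h] bounded_test_finite(1)[OF that, of _ 1]) (auto simp: indicator_def)
  have re: "Re (\<integral>z. indicator N (fst z) *\<^sub>R h (snd z) \<partial>\<mu>) = (\<integral>z. indicator N (fst z) * Re (h (snd z)) \<partial>\<mu>)"
    and im: "Im (\<integral>z. indicator N (fst z) *\<^sub>R h (snd z) \<partial>\<mu>) = (\<integral>z. indicator N (fst z) * Im (h (snd z)) \<partial>\<mu>)"
    if "sets \<mu> = sets (B \<Otimes>\<^sub>M rpos)" "finite_measure \<mu>" for \<mu>
    using integral_Re[OF int[OF that]] integral_Im[OF int[OF that]] by simp_all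
  have bR: "bounded ((\<lambda>t. Re (h t)) ` {0<..})" and bI: "bounded ((\<lambda>t. Im (h t)) ` {0<..})"
    using h(2) by (auto intro!: boundedI[of _ 1] order_trans[OF abs_Re_le_cmod] order_trans[OF abs_Im_le_cmod])
  have cR: "continuous_on {0<..} (\<lambda>t. Re (h t))" and cI: "continuous_on {0<..} (\<lambda>t. Im (h t))"
    using h(1) by (auto intro: continuous_intros)
  have c: "\<And>j. sets (\<nu>j j) = sets (B \<Otimes>\<^sub>M rpos)" "\<And>j. finite_measure (\<nu>j j)"
    "sets \<nu> = sets (B \<Otimes>\<^sub>M rpos)" "finite_measure \<nu>"
    using conv by (auto simp: fibre_tendsto_def)
  show ?thesis
    unfolding tendsto_complex_iff re[OF c(1,2)] im[OF c(1,2)] re[OF c(3,4)] im[OF c(3,4)]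
    using conv N cR cI bR bI unfolding fibre_tendsto_def by blast
qed

lemma fibre_tendsto_mass_bounded:
  assumes conv: "fibre_tendsto B \<nu>j \<nu>"
  obtains C where "0 \<le> C" "\<And>j. measure (\<nu>j j) (space (\<nu>j j)) \<le> C" "measure \<nu> (space \<nu>) \<le> C"
proof -
  have c: "\<And>j. sets (\<nu>j j) = sets (B \<Otimes>\<^sub>M rpos)" "sets \<nu> = sets (B \<Otimes>\<^sub>M rpos)"
    using conv by (auto simp: fibre_tendsto_def)
  have *: "(\<integral>z. indicator (space B) (fst z) * 1 \<partial>\<mu>) = measure \<mu> (space \<mu>)" if "sets \<mu> = sets (B \<Otimes>\<^sub>M rpos)" for \<mu> :: "('a \<times> real) measure"
  proof -
    have "(\<integral>z. indicator (space B) (fst z) * 1 \<partial>\<mu>) = (\<integral>z. (1::real) \<partial>\<mu>)"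
    proof (rule Bochner_Integration.integral_cong[OF refl])
      fix z assume "z \<in> space \<mu>"
      then show "indicator (space B) (fst z) * 1 = (1::real)" unfolding base_measurable(3)[OF that] by auto
    qed
    then show ?thesis by simp
  qed
  have "(\<lambda>j. \<integral>z. indicator (space B) (fst z) * (1::real) \<partial>\<nu>j j) \<longlonglongrightarrow> (\<integral>z. indicator (space B) (fst z) * 1 \<partial>\<nu>)"
    using conv unfolding fibre_tendsto_def
    by (elim conjE ballE[of _ _ "space B"] allE[of _ "\<lambda>_. 1"]) (auto simp: image_constant_conv)
  then have lim: "(\<lambda>j. measure (\<nu>j j) (space (\<nu>j j))) \<longlonglongrightarrow> measure \<nu> (space \<nu>)"
    unfolding *[OF c(1)] *[OF c(2)] .
  then have "Bseq (\<lambda>j. measure (\<nu>j j) (space (\<nu>j j)))"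
    by (intro convergent_imp_Bseq convergentI)
  then obtain K where K: "K > 0" "\<And>j. norm (measure (\<nu>j j) (space (\<nu>j j))) \<le> K" by (auto simp: Bseq_def)
  have le: "measure (\<nu>j j) (space (\<nu>j j)) \<le> K" for j using K(2)[of j] by simp
  have "measure \<nu> (space \<nu>) \<le> K" using LIMSEQ_le_const2[OF lim] le by blast
  then show thesis using that[of K] K(1) le by simp
qed

text \<open>
  The function \<open>g\<close> is uniformly within \<open>1 / n\<close> of a step function with finitely many values, and the
  masses of the measures are bounded, so the error is uniform along the sequence.
\<close>

lemma fibre_tendsto_bounded_test:
  fixes g :: "'b \<Rightarrow> real" and h :: "real \<Rightarrow> complex"
  assumes conv: "fibre_tendsto B \<nu>j \<nu>"
    and h: "continuous_on {0<..} h" "\<And>t. t > 0 \<Longrightarrow> norm (h t) \<le> 1"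
    and g: "g \<in> borel_measurable B" and c: "\<And>b. b \<in> space B \<Longrightarrow> \<bar>g b\<bar> \<le> c"
  shows "(\<lambda>j. \<integral>z. g (fst z) *\<^sub>R h (snd z) \<partial>\<nu>j j) \<longlonglongrightarrow> (\<integral>z. g (fst z) *\<^sub>R h (snd z) \<partial>\<nu>)"
proof (rule tendsto_of_uniform_approximation)
  fix e :: real assume e: "0 < e"
  have cs: "\<And>j. sets (\<nu>j j) = sets (B \<Otimes>\<^sub>M rpos)" "\<And>j. finite_measure (\<nu>j j)"
    "sets \<nu> = sets (B \<Otimes>\<^sub>M rpos)" "finite_measure \<nu>"
    using conv by (auto simp: fibre_tendsto_def)
  obtain C where C: "0 \<le> C" "\<And>j. measure (\<nu>j j) (space (\<nu>j j)) \<le> C" "measure \<nu> (space \<nu>) \<le> C"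
    using fibre_tendsto_mass_bounded[OF conv] by blast
  obtain n :: nat where n: "n > 0" "C / n < e"
  proof -
    obtain n :: nat where "real n > C / e" using reals_Archimedean2 by blast
    then have "real (Suc n) > C / e" by simp
    then have "C / Suc n < e" using e by (simp add: field_simps)
    then show thesis using that[of "Suc n"] by simp
  qed
  \<comment> \<open>Rounding down to multiples of \<open>1 / n\<close>: the step function takes only the values \<open>v / n\<close> with \<open>v\<close> in
    the finite set \<open>V\<close>.\<close>
  define k where "k b = \<lfloor>real n * g b\<rfloor>" for b
  define V where "V = {- \<lceil>real n * c\<rceil> - 1 .. \<lceil>real n * c\<rceil>}"
  define s where "s b = real_of_int (k b) / n" for b
  have k_V: "k b \<in> V" if "b \<in> space B" for b
  proof -
    have "\<bar>real n * g b\<bar> \<le> real n * c" using c[OF that] by (simp add: abs_mult mult_left_mono)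
    then have "real n * g b \<le> real n * c" "- (real n * c) \<le> real n * g b" by linarith+
    then show ?thesis unfolding V_def k_def by (simp, linarith)
  qed
  have gs: "\<bar>g b - s b\<bar> \<le> 1 / n" for b
  proof -
    have "0 \<le> real n * g b - real_of_int (k b)" "real n * g b - real_of_int (k b) \<le> 1"
      unfolding k_def by linarith+
    moreover have "g b - s b = (real n * g b - real_of_int (k b)) / n"
      using n(1) by (simp add: s_def field_simps)
    ultimately show ?thesis using n(1) by (simp add: divide_right_mono)
  qed
  have s_meas: "s \<in> borel_measurable B" unfolding s_def k_def using g by measurable
  define N where "N v = {b\<in>space B. k b = v}" for v
  have N: "N v \<in> sets B" for v unfolding N_def k_def using g by measurable
  let ?I = "\<lambda>\<mu> g. \<integral>z. g (fst z) *\<^sub>R h (snd z) \<partial>\<mu>"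
  have s_sum: "?I \<mu> s = (\<Sum>v\<in>V. (real_of_int v / n) *\<^sub>R ?I \<mu> (indicator (N v)))"
    if \<mu>: "sets \<mu> = sets (B \<Otimes>\<^sub>M rpos)" "finite_measure \<mu>" for \<mu>
  proof -
    have "?I \<mu> s = (\<integral>z. (\<Sum>v\<in>V. (real_of_int v / n) *\<^sub>R (indicator (N v) (fst z) *\<^sub>R h (snd z))) \<partial>\<mu>)"
    proof (rule Bochner_Integration.integral_cong[OF refl])
      fix z assume "z \<in> space \<mu>"
      then have z: "fst z \<in> space B" unfolding base_measurable(3)[OF \<mu>(1)] by auto
      have "(\<Sum>v\<in>V. (real_of_int v / n) *\<^sub>R (indicator (N v) (fst z) *\<^sub>R h (snd z))) =
        (\<Sum>v\<in>V. if v = k (fst z) then (real_of_int v / n) *\<^sub>R h (snd z) else 0)"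
        using z by (intro sum.cong refl) (auto simp: N_def indicator_def)
      also have "\<dots> = s (fst z) *\<^sub>R h (snd z)"
        using k_V[OF z] by (simp add: V_def s_def)
      finally show "s (fst z) *\<^sub>R h (snd z) = (\<Sum>v\<in>V. (real_of_int v / n) *\<^sub>R (indicator (N v) (fst z) *\<^sub>R h (snd z)))" by simp
    qed
    also have "\<dots> = (\<Sum>v\<in>V. \<integral>z. (real_of_int v / n) *\<^sub>R (indicator (N v) (fst z) *\<^sub>R h (snd z)) \<partial>\<mu>)"
    proof (rule Bochner_Integration.integral_sum)
      fix v
      have "integrable \<mu> (\<lambda>z. indicator (N v) (fst z) *\<^sub>R h (snd z))"
        using N by (intro product_test_integrable[OF \<mu>(1) h] bounded_test_finite(1)[OF \<mu>, of _ 1]) (auto simp: indicator_def)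
      then show "integrable \<mu> (\<lambda>z. (real_of_int v / n) *\<^sub>R (indicator (N v) (fst z) *\<^sub>R h (snd z)))"
        by (rule integrable_scaleR_right)
    qed
    finally show ?thesis unfolding integral_scaleR_right .
  qed
  have err: "norm (?I \<mu> g - ?I \<mu> s) \<le> e"
    if \<mu>: "sets \<mu> = sets (B \<Otimes>\<^sub>M rpos)" "finite_measure \<mu>" and mC: "measure \<mu> (space \<mu>) \<le> C" for \<mu>
  proof -
    have s_bd: "\<bar>s b\<bar> \<le> c + 1 / n" if "b \<in> space B" for b using gs[of b] c[OF that] by linarith
    have "?I \<mu> g - ?I \<mu> s = (\<integral>z. g (fst z) *\<^sub>R h (snd z) - s (fst z) *\<^sub>R h (snd z) \<partial>\<mu>)"
    proof (rule Bochner_Integration.integral_diff[symmetric])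
      show "integrable \<mu> (\<lambda>z. g (fst z) *\<^sub>R h (snd z))"
        by (rule product_test_integrable(1)[OF \<mu>(1) h g bounded_test_finite(1)[OF \<mu> c]])
      show "integrable \<mu> (\<lambda>z. s (fst z) *\<^sub>R h (snd z))"
        by (rule product_test_integrable(1)[OF \<mu>(1) h s_meas bounded_test_finite(1)[OF \<mu> s_bd]])
    qed
    also have "\<dots> = ?I \<mu> (\<lambda>b. g b - s b)" by (simp add: scaleR_diff_left)
    finally have "norm (?I \<mu> g - ?I \<mu> s) \<le> enn2real (\<integral>\<^sup>+z. ennreal \<bar>g (fst z) - s (fst z)\<bar> \<partial>\<mu>)"
      using product_test_integrable(2)[OF \<mu>(1) h borel_measurable_diff[OF g s_meas] bounded_test_finite(1)[OF \<mu> gs]] by simp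
    also have "\<dots> \<le> 1 / n * measure \<mu> (space \<mu>)"
      by (rule bounded_test_finite(2)[OF \<mu> gs])
    also have "\<dots> \<le> C / n" using mC n(1) by (simp add: divide_right_mono)
    finally show ?thesis using n(2) by simp
  qed
  have "(\<lambda>j. ?I (\<nu>j j) s) \<longlonglongrightarrow> ?I \<nu> s"
    unfolding s_sum[OF cs(1,2)] s_sum[OF cs(3,4)]
    by (intro tendsto_sum tendsto_scaleR tendsto_const fibre_tendsto_indicator[OF conv N h])
  then show "\<exists>a' l'. a' \<longlonglongrightarrow> l' \<and> (\<forall>j. norm (?I (\<nu>j j) g - a' j) \<le> e) \<and> norm (?I \<nu> g - l') \<le> e"
    using err[OF cs(1,2) C(2)] err[OF cs(3,4) C(3)] by blast
qed

lemma base_marginal_le_nn_integral: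
  assumes s: "sets \<nu> = sets (B \<Otimes>\<^sub>M rpos)" and le: "base_marginal_le B \<nu>" and f: "f \<in> borel_measurable B"
  shows "(\<integral>\<^sup>+z. f (fst z) \<partial>\<nu>) \<le> (\<integral>\<^sup>+b. f b \<partial>B)"
proof -
  note m = base_measurable[OF s]
  have "(\<integral>\<^sup>+z. f (fst z) \<partial>\<nu>) = (\<integral>\<^sup>+b. f b \<partial>distr \<nu> B fst)"
    using m(1) f by (intro nn_integral_distr[symmetric]) simp_all
  also have "\<dots> \<le> (\<integral>\<^sup>+b. f b \<partial>B)"
  proof (rule nn_integral_mono_measure[OF sets_distr _ f])
    fix N assume N: "N \<in> sets B"
    have "fst -` N \<inter> space \<nu> = N \<times> {0<..}" unfolding m(3) using sets.sets_into_space[OF N] by auto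
    then show "emeasure (distr \<nu> B fst) N \<le> emeasure B N"
      using le N by (simp add: emeasure_distr[OF m(1)] base_marginal_le_def)
  qed
  finally show ?thesis .
qed

text \<open>
  Truncation reduces to a bounded function. The error is at most the integral of \<open>\<bar>g - u n\<bar>\<close>
  against the marginals, hence against \<open>B\<close>, and the latter tends to zero by dominated convergence.
\<close>

lemma fibre_tendsto_integrable_test:
  fixes g :: "'b \<Rightarrow> real" and h :: "real \<Rightarrow> complex"
  assumes conv: "fibre_tendsto B \<nu>j \<nu>" and le: "\<And>j. base_marginal_le B (\<nu>j j)" "base_marginal_le B \<nu>"
    and h: "continuous_on {0<..} h" "\<And>t. t > 0 \<Longrightarrow> norm (h t) \<le> 1"
    and g: "integrable B g"
  shows "(\<lambda>j. \<integral>z. g (fst z) *\<^sub>R h (snd z) \<partial>\<nu>j j) \<longlonglongrightarrow> (\<integral>z. g (fst z) *\<^sub>R h (snd z) \<partial>\<nu>)"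
proof (rule tendsto_of_uniform_approximation)
  fix e :: real assume e: "0 < e"
  have cs: "\<And>j. sets (\<nu>j j) = sets (B \<Otimes>\<^sub>M rpos)" "sets \<nu> = sets (B \<Otimes>\<^sub>M rpos)"
    using conv by (auto simp: fibre_tendsto_def)
  have gm: "g \<in> borel_measurable B" using g by simp
  define u where "u n b = (if \<bar>g b\<bar> \<le> real n then g b else 0)" for n b
  have um: "u n \<in> borel_measurable B" for n unfolding u_def using gm by measurable
  have "(\<lambda>n. \<integral>\<^sup>+b. ennreal \<bar>g b - u n b\<bar> \<partial>B) \<longlonglongrightarrow> (\<integral>\<^sup>+b. 0 \<partial>B)"
  proof (rule nn_integral_dominated_convergence[where w="\<lambda>b. ennreal \<bar>g b\<bar>"])
    show "(\<integral>\<^sup>+b. ennreal \<bar>g b\<bar> \<partial>B) < \<infinity>" using g by (simp add: integrable_iff_bounded)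
    show "AE b in B. ennreal \<bar>g b - u n b\<bar> \<le> ennreal \<bar>g b\<bar>" for n
      by (intro AE_I2 ennreal_leI) (simp add: u_def)
    show "AE b in B. (\<lambda>n. ennreal \<bar>g b - u n b\<bar>) \<longlonglongrightarrow> 0"
    proof (intro AE_I2 tendsto_eventually)
      fix b
      obtain m :: nat where "\<bar>g b\<bar> \<le> real m" using real_arch_simple by blast
      then show "\<forall>\<^sub>F n in sequentially. ennreal \<bar>g b - u n b\<bar> = 0"
        by (auto simp: u_def eventually_sequentially intro!: exI[of _ m])
    qed
  qed (use gm um in measurable)
  then have "\<forall>\<^sub>F n in sequentially. (\<integral>\<^sup>+b. ennreal \<bar>g b - u n b\<bar> \<partial>B) < ennreal e"
  proof (rule order_tendstoD(2))
    show "(\<integral>\<^sup>+b. 0 \<partial>B) < ennreal e" using e by simp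
  qed
  then obtain n where n: "(\<integral>\<^sup>+b. ennreal \<bar>g b - u n b\<bar> \<partial>B) < ennreal e"
    by (auto simp: eventually_sequentially)
  let ?I = "\<lambda>\<mu> g. \<integral>z. g (fst z) *\<^sub>R h (snd z) \<partial>\<mu>"
  have err: "norm (?I \<mu> g - ?I \<mu> (u n)) \<le> e" if \<mu>: "sets \<mu> = sets (B \<Otimes>\<^sub>M rpos)" and m: "base_marginal_le B \<mu>" for \<mu>
  proof -
    have gfin: "(\<integral>\<^sup>+z. ennreal \<bar>g (fst z)\<bar> \<partial>\<mu>) < \<infinity>"
    proof -
      have "(\<integral>\<^sup>+z. ennreal \<bar>g (fst z)\<bar> \<partial>\<mu>) \<le> (\<integral>\<^sup>+b. ennreal \<bar>g b\<bar> \<partial>B)"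
        by (rule base_marginal_le_nn_integral[OF \<mu> m]) (use gm in measurable)
      also have "\<dots> < \<infinity>" using g by (simp add: integrable_iff_bounded)
      finally show ?thesis .
    qed
    have "(\<integral>\<^sup>+z. ennreal \<bar>u n (fst z)\<bar> \<partial>\<mu>) \<le> (\<integral>\<^sup>+z. ennreal \<bar>g (fst z)\<bar> \<partial>\<mu>)"
      by (intro nn_integral_mono ennreal_leI) (simp add: u_def)
    then have ufin: "(\<integral>\<^sup>+z. ennreal \<bar>u n (fst z)\<bar> \<partial>\<mu>) < \<infinity>" using gfin by (rule le_less_trans)
    have dle: "(\<integral>\<^sup>+z. ennreal \<bar>g (fst z) - u n (fst z)\<bar> \<partial>\<mu>) < ennreal e"
    proof -
      have "(\<integral>\<^sup>+z. ennreal \<bar>g (fst z) - u n (fst z)\<bar> \<partial>\<mu>) \<le> (\<integral>\<^sup>+b. ennreal \<bar>g b - u n b\<bar> \<partial>B)"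
        by (rule base_marginal_le_nn_integral[OF \<mu> m]) (use gm um in measurable)
      then show ?thesis using n by (rule le_less_trans)
    qed
    then have dfin: "(\<integral>\<^sup>+z. ennreal \<bar>g (fst z) - u n (fst z)\<bar> \<partial>\<mu>) < \<infinity>"
      by (rule less_trans) simp
    have "?I \<mu> g - ?I \<mu> (u n) = (\<integral>z. g (fst z) *\<^sub>R h (snd z) - u n (fst z) *\<^sub>R h (snd z) \<partial>\<mu>)"
      by (intro Bochner_Integration.integral_diff[symmetric] product_test_integrable(1)[OF \<mu> h] gm um gfin ufin)
    also have "\<dots> = ?I \<mu> (\<lambda>b. g b - u n b)" by (simp add: scaleR_diff_left)
    finally have "norm (?I \<mu> g - ?I \<mu> (u n)) \<le> enn2real (\<integral>\<^sup>+z. ennreal \<bar>g (fst z) - u n (fst z)\<bar> \<partial>\<mu>)"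
      using product_test_integrable(2)[OF \<mu> h borel_measurable_diff[OF gm um] dfin] by simp
    also have "\<dots> \<le> enn2real (ennreal e)" using dle by (intro enn2real_mono) auto
    finally show ?thesis using e by simp
  qed
  have "(\<lambda>j. ?I (\<nu>j j) (u n)) \<longlonglongrightarrow> ?I \<nu> (u n)"
  proof (rule fibre_tendsto_bounded_test[OF conv h um])
    show "\<bar>u n b\<bar> \<le> real n" for b by (simp add: u_def)
  qed
  then show "\<exists>a' l'. a' \<longlonglongrightarrow> l' \<and> (\<forall>j. norm (?I (\<nu>j j) g - a' j) \<le> e) \<and> norm (?I \<nu> g - l') \<le> e"
    using err[OF cs(1) le(1)] err[OF cs(2) le(2)] by blast
qed

section \<open>Characters of the multiplicative group and weak convergence\<close>

text \<open>
  The Mellin transform of \<open>\<mu>\<close> on the imaginary axis: the integral of \<open>t \<mapsto> t^(ix)\<close>.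
\<close>

definition mchar :: "real measure \<Rightarrow> real \<Rightarrow> complex" where
  "mchar \<mu> x = (\<integral>t. iexp (x * ln t) \<partial>\<mu>)"

lemma iexp_ln_continuous: "continuous_on {0<..} (\<lambda>t. iexp (x * ln t))"
  by (intro continuous_intros) auto

lemma iexp_ln_mult: "s > 0 \<Longrightarrow> t > 0 \<Longrightarrow> iexp (x * ln (s * t)) = iexp (x * ln s) * iexp (x * ln t)"
  by (simp add: ln_mult distrib_left exp_add[symmetric])

text \<open>
  The logarithm carries the multiplicative group to the real line, where the Levy continuity
  theorem is available for probability measures.
\<close>

lemma normalized_log_distribution:
  assumes s: "sets \<mu> = sets rpos" and fin: "finite_measure \<mu>" and pos: "measure \<mu> (space \<mu>) > 0"
  defines "\<mu>' \<equiv> distr (density \<mu> (\<lambda>_. ennreal (1 / measure \<mu> (space \<mu>)))) borel ln"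
  shows "real_distribution \<mu>'"
    and "\<And>F :: real \<Rightarrow> 'v::{banach, second_countable_topology}. F \<in> borel_measurable borel \<Longrightarrow>
      (\<integral>x. F x \<partial>\<mu>') = (1 / measure \<mu> (space \<mu>)) *\<^sub>R (\<integral>t. F (ln t) \<partial>\<mu>)"
proof -
  interpret finite_measure \<mu> by fact
  let ?m = "measure \<mu> (space \<mu>)"
  have ln: "ln \<in> \<mu> \<rightarrow>\<^sub>M (borel :: real measure)"
    unfolding measurable_cong_sets[OF s refl] by (intro continuous_rpos_measurable continuous_intros) auto
  have "prob_space (density \<mu> (\<lambda>_. ennreal (1 / ?m)))"
  proof
    have "emeasure (density \<mu> (\<lambda>_. ennreal (1 / ?m))) (space \<mu>) = ennreal (1 / ?m) * ennreal ?m"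
      by (subst emeasure_density_const) (simp_all add: emeasure_eq_measure)
    also have "\<dots> = 1" using pos by (simp flip: ennreal_mult')
    finally show "emeasure (density \<mu> (\<lambda>_. ennreal (1 / ?m))) (space (density \<mu> (\<lambda>_. ennreal (1 / ?m)))) = 1" by simp
  qed
  then have "prob_space \<mu>'" unfolding \<mu>'_def using ln by (intro prob_space.prob_space_distr) simp_all
  then show "real_distribution \<mu>'"
    by (simp add: real_distribution_def real_distribution_axioms_def \<mu>'_def)
  fix F :: "real \<Rightarrow> 'v" assume F: "F \<in> borel_measurable borel"
  have "(\<integral>x. F x \<partial>\<mu>') = (\<integral>t. F (ln t) \<partial>density \<mu> (\<lambda>_. ennreal (1 / ?m)))"
    unfolding \<mu>'_def using ln F by (intro integral_distr) simp_all
  also have "\<dots> = (\<integral>t. (1 / ?m) *\<^sub>R F (ln t) \<partial>\<mu>)"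
    using measurable_compose[OF ln F] pos by (intro integral_density) auto
  finally show "(\<integral>x. F x \<partial>\<mu>') = (1 / ?m) *\<^sub>R (\<integral>t. F (ln t) \<partial>\<mu>)" by simp
qed

text \<open>
  At \<open>x = 0\<close> the hypothesis says that the masses converge. If the limit is zero, bounded test
  functions give integrals tending to zero; otherwise the measures can be normalized and the Levy
  theorem applies to their images under the logarithm.
\<close>

lemma mellin_levy_continuity:
  fixes f :: "real \<Rightarrow> real"
  assumes s: "\<And>j. sets (\<mu>j j) = sets rpos" "sets \<mu> = sets rpos"
    and fin: "\<And>j. finite_measure (\<mu>j j)" "finite_measure \<mu>"
    and char: "\<And>x. (\<lambda>j. mchar (\<mu>j j) x) \<longlonglongrightarrow> mchar \<mu> x"
    and f: "continuous_on {0<..} f" "bounded (f ` {0<..})"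
  shows "(\<lambda>j. \<integral>t. f t \<partial>\<mu>j j) \<longlonglongrightarrow> (\<integral>t. f t \<partial>\<mu>)"
proof -
  let ?m = "\<lambda>\<mu> :: real measure. measure \<mu> (space \<mu>)"
  have sp: "space (\<mu>j j) = {0<..}" "space \<mu> = {0<..}" for j
    using sets_eq_imp_space_eq[OF s(1)] sets_eq_imp_space_eq[OF s(2)] by simp_all
  have "(\<lambda>j. complex_of_real (?m (\<mu>j j))) \<longlonglongrightarrow> complex_of_real (?m \<mu>)"
    using char[of 0] by (simp add: mchar_def scaleR_conv_of_real)
  then have mass: "(\<lambda>j. ?m (\<mu>j j)) \<longlonglongrightarrow> ?m \<mu>" by (simp add: tendsto_of_real_iff)
  obtain c where c: "\<And>t. t > 0 \<Longrightarrow> \<bar>f t\<bar> \<le> c"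
    using f(2) unfolding bounded_iff by auto
  have bound: "\<bar>\<integral>t. f t \<partial>\<rho>\<bar> \<le> c * ?m \<rho>" if "sets \<rho> = sets rpos" "finite_measure \<rho>" for \<rho>
  proof -
    interpret finite_measure \<rho> by fact
    have sp: "space \<rho> = {0<..}" using sets_eq_imp_space_eq[OF that(1)] by simp
    have "f \<in> borel_measurable \<rho>"
      unfolding measurable_cong_sets[OF that(1) refl] by (rule continuous_rpos_measurable[OF f(1)])
    then have "integrable \<rho> f" using c sp by (intro integrable_const_bound[of _ c]) auto
    then have "\<bar>\<integral>t. f t \<partial>\<rho>\<bar> \<le> (\<integral>t. \<bar>f t\<bar> \<partial>\<rho>)" by (intro integral_abs_bound)
    also have "\<dots> \<le> (\<integral>t. c \<partial>\<rho>)" using \<open>integrable \<rho> f\<close> c sp by (intro integral_mono) auto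
    finally show ?thesis by (simp add: mult.commute)
  qed
  show ?thesis
  proof (cases "?m \<mu> = 0")
    case True
    have "(\<integral>t. f t \<partial>\<mu>) = 0" using bound[OF s(2) fin(2)] True by simp
    moreover have "(\<lambda>j. \<integral>t. f t \<partial>\<mu>j j) \<longlonglongrightarrow> 0"
    proof (rule Lim_null_comparison)
      show "\<forall>\<^sub>F j in sequentially. norm (\<integral>t. f t \<partial>\<mu>j j) \<le> c * ?m (\<mu>j j)"
        using bound[OF s(1) fin(1)] by simp
      show "(\<lambda>j. c * ?m (\<mu>j j)) \<longlonglongrightarrow> 0"
        using tendsto_mult_left[OF mass, of c] True by simp
    qed
    ultimately show ?thesis by simp
  next
    case False
    then have pos: "?m \<mu> > 0" using zero_less_measure_iff by blast
    define \<nu> where "\<nu> \<rho> = distr (density \<rho> (\<lambda>_. ennreal (1 / ?m \<rho>))) borel ln" for \<rho> :: "real measure"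
    \<comment> \<open>The normalization exists for all large \<open>j\<close>; for the others the limit itself is inserted.\<close>
    define \<nu>j where "\<nu>j j = \<nu> (if ?m (\<mu>j j) > 0 then \<mu>j j else \<mu>)" for j
    have ev: "\<forall>\<^sub>F j in sequentially. ?m (\<mu>j j) > 0" using order_tendstoD(1)[OF mass pos] .
    have rd: "real_distribution (\<nu>j j)" for j
      using normalized_log_distribution(1)[OF s(1) fin(1), of j] normalized_log_distribution(1)[OF s(2) fin(2) pos]
      by (simp add: \<nu>j_def \<nu>_def)
    have rd': "real_distribution (\<nu> \<mu>)"
      using normalized_log_distribution(1)[OF s(2) fin(2) pos] by (simp add: \<nu>_def)
    have char_\<nu>: "char (\<nu> \<rho>) x = (1 / ?m \<rho>) *\<^sub>R mchar \<rho> x"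
      if "sets \<rho> = sets rpos" "finite_measure \<rho>" "?m \<rho> > 0" for \<rho> x
      unfolding char_def mchar_def \<nu>_def by (rule normalized_log_distribution(2)[OF that]) measurable
    have "weak_conv_m \<nu>j (\<nu> \<mu>)"
    proof (rule levy_continuity[OF rd rd'])
      fix x
      have "(\<lambda>j. (1 / ?m (\<mu>j j)) *\<^sub>R mchar (\<mu>j j) x) \<longlonglongrightarrow> (1 / ?m \<mu>) *\<^sub>R mchar \<mu> x"
        using pos by (intro tendsto_scaleR tendsto_divide tendsto_const mass char) simp
      moreover have "\<forall>\<^sub>F j in sequentially. (1 / ?m (\<mu>j j)) *\<^sub>R mchar (\<mu>j j) x = char (\<nu>j j) x"
        using ev by eventually_elim (simp add: \<nu>j_def char_\<nu>[OF s(1) fin(1)])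
      ultimately show "(\<lambda>j. char (\<nu>j j) x) \<longlonglongrightarrow> char (\<nu> \<mu>) x"
        unfolding char_\<nu>[OF s(2) fin(2) pos] by (rule Lim_transform_eventually)
    qed
    moreover have cont: "isCont (\<lambda>x. f (exp x)) x" for x
    proof -
      have "isCont f (exp x)" using f(1) by (simp add: continuous_on_eq_continuous_at)
      then show ?thesis by (rule isCont_o2[rotated]) simp
    qed
    moreover have "norm (f (exp x)) \<le> c" for x using c[of "exp x"] by simp
    ultimately have lim: "(\<lambda>j. \<integral>x. f (exp x) \<partial>\<nu>j j) \<longlonglongrightarrow> (\<integral>x. f (exp x) \<partial>\<nu> \<mu>)"
      by (rule weak_conv_imp_integral_bdd_continuous_conv[OF rd rd'])
    have int_\<nu>: "(\<integral>x. f (exp x) \<partial>\<nu> \<rho>) = (1 / ?m \<rho>) * (\<integral>t. f t \<partial>\<rho>)"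
      if \<rho>: "sets \<rho> = sets rpos" "finite_measure \<rho>" "?m \<rho> > 0" for \<rho>
    proof -
      have "(\<lambda>x. f (exp x)) \<in> borel_measurable borel"
        using cont by (intro borel_measurable_continuous_onI continuous_at_imp_continuous_on) auto
      from normalized_log_distribution(2)[OF \<rho> this]
      have "(\<integral>x. f (exp x) \<partial>\<nu> \<rho>) = (1 / ?m \<rho>) * (\<integral>t. f (exp (ln t)) \<partial>\<rho>)" by (simp add: \<nu>_def)
      moreover have "(\<integral>t. f (exp (ln t)) \<partial>\<rho>) = (\<integral>t. f t \<partial>\<rho>)"
        using sets_eq_imp_space_eq[OF \<rho>(1)] by (intro Bochner_Integration.integral_cong) auto
      ultimately show ?thesis by simp
    qed
    have l: "(\<lambda>j. ?m (\<mu>j j) * (\<integral>x. f (exp x) \<partial>\<nu>j j)) \<longlonglongrightarrow> ?m \<mu> * (\<integral>x. f (exp x) \<partial>\<nu> \<mu>)"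
      by (intro tendsto_mult mass lim)
    have e: "\<forall>\<^sub>F j in sequentially. ?m (\<mu>j j) * (\<integral>x. f (exp x) \<partial>\<nu>j j) = (\<integral>t. f t \<partial>\<mu>j j)"
      using ev by eventually_elim (simp add: \<nu>j_def int_\<nu>[OF s(1) fin(1)])
    have "?m \<mu> * (\<integral>x. f (exp x) \<partial>\<nu> \<mu>) = (\<integral>t. f t \<partial>\<mu>)"
      using pos by (simp add: int_\<nu>[OF s(2) fin(2)])
    with Lim_transform_eventually[OF l e] show ?thesis by simp
  qed
qed

section \<open>Convergence of multiplicative mixtures\<close>

lemma finite_kernel_cong_sets:
  assumes s: "sets \<nu> = sets X" and k: "finite_kernel X Y k"
  shows "finite_kernel \<nu> Y k"
  using k unfolding finite_kernel_def
  by (simp add: sets_eq_imp_space_eq[OF s] measurable_cong_sets[OF s refl])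

text \<open>
  The distribution of the product of \<open>snd z\<close> with a random factor distributed as \<open>q (fst z)\<close>.
\<close>

definition mult_kernel :: "('b \<Rightarrow> real measure) \<Rightarrow> 'b \<times> real \<Rightarrow> real measure" where
  "mult_kernel q z = distr (q (fst z)) rpos (\<lambda>u. snd z * u)"

lemma mult_kernel_finite_kernel:
  assumes "sets \<nu> = sets (B \<Otimes>\<^sub>M rpos)" "finite_kernel B rpos q"
  shows "finite_kernel \<nu> rpos (mult_kernel q)"
  using finite_kernel_cong_sets[OF assms(1) mult_rpos_kernel[OF assms(2)]]
  unfolding mult_kernel_def .

lemma mult_measurable:
  assumes s: "sets \<mu> = sets rpos" and "s > 0"
  shows "(\<lambda>u. s * u) \<in> \<mu> \<rightarrow>\<^sub>M rpos"
  unfolding measurable_cong_sets[OF s refl] using assms(2)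
  by (intro measurable_rposI borel_measurable_times id_rpos_borel) auto

lemma emeasure_mult_kernel_space:
  assumes q: "finite_kernel B rpos q" and z: "z \<in> space B \<times> {0<..}"
  shows "emeasure (mult_kernel q z) {0<..} = emeasure (q (fst z)) {0<..}"
proof -
  have z': "fst z \<in> space B" "snd z > 0" using z by auto
  note f = finite_kernelD[OF q]
  have E: "{0<..} \<in> sets rpos" using sets.top[of rpos] by simp
  have "(\<lambda>u. snd z * u) -` {0<..} \<inter> space (q (fst z)) = {0<..}"
    using f(2)[OF z'(1)] z'(2) by auto
  then show ?thesis
    unfolding mult_kernel_def by (subst emeasure_distr[OF mult_measurable[OF f(1)[OF z'(1)] z'(2)] E]) simp
qed

text \<open>
  The character is multiplicative, so the inner integral splits off the transform of \<open>q b\<close>.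
\<close>

lemma mchar_mult_mixture:
  assumes s: "sets \<nu> = sets (B \<Otimes>\<^sub>M rpos)" and q: "finite_kernel B rpos q"
    and fin: "(\<integral>\<^sup>+z. emeasure (q (fst z)) {0<..} \<partial>\<nu>) < \<infinity>"
  shows "mchar (mixture \<nu> (mult_kernel q) rpos) x = (\<integral>z. mchar (q (fst z)) x * iexp (x * ln (snd z)) \<partial>\<nu>)"
proof -
  note m = base_measurable[OF s]
  have k: "finite_kernel \<nu> rpos (mult_kernel q)" by (rule mult_kernel_finite_kernel[OF s q])
  have h: "(\<lambda>t. iexp (x * ln t)) \<in> borel_measurable rpos"
    by (rule continuous_rpos_measurable[OF iexp_ln_continuous])
  have "(\<integral>\<^sup>+z. emeasure (mult_kernel q z) {0<..} \<partial>\<nu>) = (\<integral>\<^sup>+z. emeasure (q (fst z)) {0<..} \<partial>\<nu>)"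
    by (intro nn_integral_cong emeasure_mult_kernel_space[OF q]) (simp add: m(3))
  then have fin': "(\<integral>\<^sup>+z. emeasure (mult_kernel q z) (space rpos) \<partial>\<nu>) < \<infinity>" using fin by simp
  have "mchar (mixture \<nu> (mult_kernel q) rpos) x = (\<integral>z. \<integral>t. iexp (x * ln t) \<partial>mult_kernel q z \<partial>\<nu>)"
    unfolding mchar_def by (rule integral_mixture(2)[OF k h _ fin', of 1]) simp
  also have "\<dots> = (\<integral>z. mchar (q (fst z)) x * iexp (x * ln (snd z)) \<partial>\<nu>)"
  proof (rule Bochner_Integration.integral_cong[OF refl])
    fix z assume "z \<in> space \<nu>"
    then have z: "fst z \<in> space B" "snd z > 0" unfolding m(3) by auto
    note f = finite_kernelD[OF q]
    have "(\<integral>t. iexp (x * ln t) \<partial>mult_kernel q z) = (\<integral>u. iexp (x * ln (snd z * u)) \<partial>q (fst z))"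
      unfolding mult_kernel_def by (rule integral_distr[OF mult_measurable[OF f(1)[OF z(1)] z(2)] h])
    also have "\<dots> = (\<integral>u. iexp (x * ln u) * iexp (x * ln (snd z)) \<partial>q (fst z))"
    proof (rule Bochner_Integration.integral_cong[OF refl])
      fix u assume "u \<in> space (q (fst z))"
      then have "u > 0" using f(2)[OF z(1)] by simp
      then show "iexp (x * ln (snd z * u)) = iexp (x * ln u) * iexp (x * ln (snd z))"
        using iexp_ln_mult[OF z(2)] by (simp add: mult.commute)
    qed
    also have "\<dots> = mchar (q (fst z)) x * iexp (x * ln (snd z))"
      unfolding mchar_def by (rule integral_mult_left_zero)
    finally show "(\<integral>t. iexp (x * ln t) \<partial>mult_kernel q z) = mchar (q (fst z)) x * iexp (x * ln (snd z))" .
  qed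
  finally show ?thesis .
qed

lemma mchar_norm_le:
  assumes "sets \<mu> = sets rpos" "finite_measure \<mu>"
  shows "norm (mchar \<mu> x) \<le> measure \<mu> (space \<mu>)"
proof -
  interpret finite_measure \<mu> by fact
  have "(\<lambda>t. iexp (x * ln t)) \<in> borel_measurable \<mu>"
    unfolding measurable_cong_sets[OF assms(1) refl] by (rule continuous_rpos_measurable[OF iexp_ln_continuous])
  then have "integrable \<mu> (\<lambda>t. iexp (x * ln t))" by (intro integrable_const_bound[of _ 1]) auto
  then have "norm (mchar \<mu> x) \<le> (\<integral>t. norm (iexp (x * ln t)) \<partial>\<mu>)"
    unfolding mchar_def by (intro integral_norm_bound)
  then show ?thesis by simp
qed

text \<open>
  The transform of the mixture is the integral of a product test function, whose factor on the base
  is the transform \<open>G\<close> of the kernel. The alternative in the hypothesis is what the two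
  extension results need: \<open>G\<close> is bounded by 1 in the first case, and in the second it is
  integrable and the marginals are dominated by \<open>B\<close>.
\<close>

lemma fibre_tendsto_mchar:
  assumes B: "finite_measure B" and conv: "fibre_tendsto B \<nu>j \<nu>" and q: "finite_kernel B rpos q"
    and mass: "(\<integral>\<^sup>+b. emeasure (q b) {0<..} \<partial>B) < \<infinity>"
    and dom: "(\<forall>b\<in>space B. emeasure (q b) {0<..} \<le> 1) \<or>
      ((\<forall>j. base_marginal_le B (\<nu>j j)) \<and> base_marginal_le B \<nu>)"
  shows "(\<lambda>j. mchar (mixture (\<nu>j j) (mult_kernel q) rpos) x) \<longlonglongrightarrow> mchar (mixture \<nu> (mult_kernel q) rpos) x"
    and "\<And>j. finite_measure (mixture (\<nu>j j) (mult_kernel q) rpos)"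
    and "finite_measure (mixture \<nu> (mult_kernel q) rpos)"
proof -
  have cs: "\<And>j. sets (\<nu>j j) = sets (B \<Otimes>\<^sub>M rpos)" "\<And>j. finite_measure (\<nu>j j)"
    "sets \<nu> = sets (B \<Otimes>\<^sub>M rpos)" "finite_measure \<nu>"
    using conv by (auto simp: fibre_tendsto_def)
  \<comment> \<open>What the members of the sequence and its limit have in common; it makes all integrals finite.\<close>
  define admissible where "admissible \<mu> \<longleftrightarrow> sets \<mu> = sets (B \<Otimes>\<^sub>M rpos) \<and> finite_measure \<mu> \<and>
    ((\<forall>b\<in>space B. emeasure (q b) {0<..} \<le> 1) \<or> base_marginal_le B \<mu>)" for \<mu>
  have adm: "admissible (\<nu>j j)" "admissible \<nu>" for j
    using cs dom by (auto simp: admissible_def)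
  have E: "{0<..} \<in> sets rpos" using sets.top[of rpos] by simp
  have massm: "(\<lambda>b. emeasure (q b) {0<..}) \<in> borel_measurable B" by (rule finite_kernelD(4)[OF q E])
  have fin: "(\<integral>\<^sup>+z. emeasure (q (fst z)) {0<..} \<partial>\<mu>) < \<infinity>" if "admissible \<mu>" for \<mu>
  proof (cases "\<forall>b\<in>space B. emeasure (q b) {0<..} \<le> 1")
    case True
    have s: "sets \<mu> = sets (B \<Otimes>\<^sub>M rpos)" and "finite_measure \<mu>" using that by (auto simp: admissible_def)
    interpret finite_measure \<mu> by fact
    have "(\<integral>\<^sup>+z. emeasure (q (fst z)) {0<..} \<partial>\<mu>) \<le> (\<integral>\<^sup>+z. 1 \<partial>\<mu>)"
    proof (rule nn_integral_mono)
      show "emeasure (q (fst z)) {0<..} \<le> 1" if "z \<in> space \<mu>" for z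
        using that True unfolding base_measurable(3)[OF s] by auto
    qed
    also have "\<dots> < \<infinity>" by (simp add: less_top[symmetric])
    finally show ?thesis .
  next
    case False
    then have "base_marginal_le B \<mu>" "sets \<mu> = sets (B \<Otimes>\<^sub>M rpos)" using that by (auto simp: admissible_def)
    from base_marginal_le_nn_integral[OF this(2,1) massm] mass show ?thesis by (rule le_less_trans)
  qed
  have finm: "finite_measure (mixture \<mu> (mult_kernel q) rpos)" if a: "admissible \<mu>" for \<mu>
  proof (rule finite_measure_mixture)
    have s: "sets \<mu> = sets (B \<Otimes>\<^sub>M rpos)" using a by (simp add: admissible_def)
    show "finite_kernel \<mu> rpos (mult_kernel q)" by (rule mult_kernel_finite_kernel[OF s q])
    have "(\<integral>\<^sup>+z. emeasure (mult_kernel q z) {0<..} \<partial>\<mu>) = (\<integral>\<^sup>+z. emeasure (q (fst z)) {0<..} \<partial>\<mu>)"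
      by (intro nn_integral_cong emeasure_mult_kernel_space[OF q]) (simp add: base_measurable(3)[OF s])
    then show "(\<integral>\<^sup>+z. emeasure (mult_kernel q z) (space rpos) \<partial>\<mu>) < \<infinity>" using fin[OF a] by simp
  qed
  show "\<And>j. finite_measure (mixture (\<nu>j j) (mult_kernel q) rpos)" "finite_measure (mixture \<nu> (mult_kernel q) rpos)"
    using finm adm by auto
  let ?h = "\<lambda>t. iexp (x * ln t)"
  have h: "continuous_on {0<..} ?h" "\<And>t. t > 0 \<Longrightarrow> norm (?h t) \<le> 1"
    using iexp_ln_continuous by auto
  define G where "G b = mchar (q b) x" for b
  have hm: "?h \<in> borel_measurable rpos" by (rule continuous_rpos_measurable[OF h(1)])
  have G: "integrable B G"
    unfolding G_def mchar_def by (rule integral_mixture(1)[OF q hm, of 1]) (use mass in simp_all)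
  have G_le: "norm (G b) \<le> 1" if "\<forall>b\<in>space B. emeasure (q b) {0<..} \<le> 1" "b \<in> space B" for b
  proof -
    have "norm (G b) \<le> measure (q b) {0<..}"
      using mchar_norm_le[OF finite_kernelD(1,3)[OF q that(2)]] finite_kernelD(2)[OF q that(2)] by (simp add: G_def)
    also have "\<dots> \<le> 1"
    proof -
      have "emeasure (q b) {0<..} \<le> 1" using that by blast
      then have "ennreal (measure (q b) {0<..}) \<le> 1"
        using finite_measure.emeasure_eq_measure[OF finite_kernelD(3)[OF q that(2)], of "{0<..}"] by simp
      then show ?thesis by simp
    qed
    finally show ?thesis .
  qed
  let ?I = "\<lambda>\<mu> g. \<integral>z. g (fst z) *\<^sub>R ?h (snd z) \<partial>\<mu>"
  have test: "(\<lambda>j. ?I (\<nu>j j) g) \<longlonglongrightarrow> ?I \<nu> g" "\<And>\<mu>. admissible \<mu> \<Longrightarrow> integrable \<mu> (\<lambda>z. g (fst z) *\<^sub>R ?h (snd z))"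
    if g: "integrable B g" and gG: "\<And>b. \<bar>g b\<bar> \<le> norm (G b)" for g :: "_ \<Rightarrow> real"
  proof -
    have gm: "g \<in> borel_measurable B" using g by simp
    show "(\<lambda>j. ?I (\<nu>j j) g) \<longlonglongrightarrow> ?I \<nu> g"
    proof (cases "\<forall>b\<in>space B. emeasure (q b) {0<..} \<le> 1")
      case True
      show ?thesis
        by (rule fibre_tendsto_bounded_test[OF conv h gm order_trans[OF gG G_le[OF True]]])
    next
      case False
      then show ?thesis using dom by (intro fibre_tendsto_integrable_test[OF conv _ _ h g]) auto
    qed
    fix \<mu> assume a: "admissible \<mu>"
    then have s: "sets \<mu> = sets (B \<Otimes>\<^sub>M rpos)" and f: "finite_measure \<mu>" by (auto simp: admissible_def)
    have gf: "(\<integral>\<^sup>+z. ennreal \<bar>g (fst z)\<bar> \<partial>\<mu>) < \<infinity>"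
    proof (cases "\<forall>b\<in>space B. emeasure (q b) {0<..} \<le> 1")
      case True
      show ?thesis by (rule bounded_test_finite(1)[OF s f order_trans[OF gG G_le[OF True]]])
    next
      case False
      then have "base_marginal_le B \<mu>" using a by (auto simp: admissible_def)
      then have "(\<integral>\<^sup>+z. ennreal \<bar>g (fst z)\<bar> \<partial>\<mu>) \<le> (\<integral>\<^sup>+b. ennreal \<bar>g b\<bar> \<partial>B)"
        by (intro base_marginal_le_nn_integral[OF s]) (use gm in measurable)
      also have "\<dots> < \<infinity>" using g by (simp add: integrable_iff_bounded)
      finally show ?thesis .
    qed
    show "integrable \<mu> (\<lambda>z. g (fst z) *\<^sub>R ?h (snd z))"
      by (rule product_test_integrable(1)[OF s h gm gf])
  qed
  note re = test[of "\<lambda>b. Re (G b)", OF integrable_Re[OF G] abs_Re_le_cmod]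
  note im = test[of "\<lambda>b. Im (G b)", OF integrable_Im[OF G] abs_Im_le_cmod]
  have split: "v * w = Re v *\<^sub>R w + \<i> * (Im v *\<^sub>R w)" for v w :: complex
    by (simp add: complex_eq_iff)
  have mix: "mchar (mixture \<mu> (mult_kernel q) rpos) x = ?I \<mu> (\<lambda>b. Re (G b)) + \<i> * ?I \<mu> (\<lambda>b. Im (G b))"
    if a: "admissible \<mu>" for \<mu>
  proof -
    have s: "sets \<mu> = sets (B \<Otimes>\<^sub>M rpos)" using a by (simp add: admissible_def)
    have "mchar (mixture \<mu> (mult_kernel q) rpos) x = (\<integral>z. G (fst z) * ?h (snd z) \<partial>\<mu>)"
      unfolding G_def by (rule mchar_mult_mixture[OF s q fin[OF a]])
    also have "\<dots> = (\<integral>z. Re (G (fst z)) *\<^sub>R ?h (snd z) + \<i> * (Im (G (fst z)) *\<^sub>R ?h (snd z)) \<partial>\<mu>)"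
      by (rule Bochner_Integration.integral_cong[OF refl split])
    also have "\<dots> = ?I \<mu> (\<lambda>b. Re (G b)) + (\<integral>z. \<i> * (Im (G (fst z)) *\<^sub>R ?h (snd z)) \<partial>\<mu>)"
      by (intro Bochner_Integration.integral_add integrable_mult_right re(2)[OF a] im(2)[OF a])
    also have "(\<integral>z. \<i> * (Im (G (fst z)) *\<^sub>R ?h (snd z)) \<partial>\<mu>) = \<i> * ?I \<mu> (\<lambda>b. Im (G b))"
      by (rule integral_mult_right_zero)
    finally show ?thesis .
  qed
  show "(\<lambda>j. mchar (mixture (\<nu>j j) (mult_kernel q) rpos) x) \<longlonglongrightarrow> mchar (mixture \<nu> (mult_kernel q) rpos) x"
    unfolding mix[OF adm(1)] mix[OF adm(2)]
    by (intro tendsto_add tendsto_mult tendsto_const re(1) im(1))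
qed

lemma fibre_tendsto_mult_mixture:
  fixes f :: "real \<Rightarrow> real"
  assumes "finite_measure B" "fibre_tendsto B \<nu>j \<nu>" "finite_kernel B rpos q"
    and "(\<integral>\<^sup>+b. emeasure (q b) {0<..} \<partial>B) < \<infinity>"
    and "(\<forall>b\<in>space B. emeasure (q b) {0<..} \<le> 1) \<or>
      ((\<forall>j. base_marginal_le B (\<nu>j j)) \<and> base_marginal_le B \<nu>)"
    and f: "continuous_on {0<..} f" "bounded (f ` {0<..})"
  shows "(\<lambda>j. \<integral>t. f t \<partial>mixture (\<nu>j j) (mult_kernel q) rpos) \<longlonglongrightarrow> (\<integral>t. f t \<partial>mixture \<nu> (mult_kernel q) rpos)"
  by (rule mellin_levy_continuity[OF sets_mixture sets_mixture fibre_tendsto_mchar(2,3,1)[OF assms(1-5)] f])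

lemma weighted_finite_kernel:
  assumes q: "finite_kernel B rpos q" and mtri: "\<And>b. b \<in> space B \<Longrightarrow> q b \<in> mtri"
  shows "finite_kernel B rpos (\<lambda>b. density (q b) ennreal)"
    and "b \<in> space B \<Longrightarrow> emeasure (density (q b) ennreal) {0<..} = (\<integral>\<^sup>+t. ennreal t \<partial>q b)"
proof -
  have i: "ennreal \<in> borel_measurable rpos" by (rule measurable_compose[OF id_rpos_borel measurable_ennreal])
  have i': "ennreal \<in> borel_measurable (q b)" if "b \<in> space B" for b
    using i by (simp add: measurable_cong_sets[OF finite_kernelD(1)[OF q that] refl])
  have mass: "emeasure (density (q b) ennreal) {0<..} = (\<integral>\<^sup>+t. ennreal t \<partial>q b)" if b: "b \<in> space B" for b
  proof -
    have "{0<..} \<in> sets (q b)" using finite_kernelD(2)[OF q b] sets.top[of "q b"] by simp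
    then have "emeasure (density (q b) ennreal) {0<..} = (\<integral>\<^sup>+t. ennreal t * indicator {0<..} t \<partial>q b)"
      by (rule emeasure_density[OF i'[OF b]])
    also have "\<dots> = (\<integral>\<^sup>+t. ennreal t \<partial>q b)"
      using finite_kernelD(2)[OF q b] by (intro nn_integral_cong) simp
    finally show ?thesis .
  qed
  then show "b \<in> space B \<Longrightarrow> emeasure (density (q b) ennreal) {0<..} = (\<integral>\<^sup>+t. ennreal t \<partial>q b)" .
  show "finite_kernel B rpos (\<lambda>b. density (q b) ennreal)"
    unfolding finite_kernel_def
  proof (intro conjI ballI)
    show "sets (density (q b) ennreal) = sets rpos" if "b \<in> space B" for b
      using finite_kernelD(1)[OF q that] by simp
    show "finite_measure (density (q b) ennreal)" if "b \<in> space B" for b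
      using mass[OF that] mtriD(4)[OF mtri[OF that]] finite_kernelD(2)[OF q that]
      by (intro finite_measureI) simp
    fix E assume E: "E \<in> sets rpos"
    have m: "(\<lambda>z. ennreal (snd z) * indicator E (snd z)) \<in> borel_measurable (B \<Otimes>\<^sub>M rpos)"
      using E by (intro borel_measurable_times_ennreal measurable_compose[OF measurable_snd i]
        measurable_compose[OF measurable_snd borel_measurable_indicator])
    have "(\<lambda>b. \<integral>\<^sup>+t. ennreal t * indicator E t \<partial>q b) \<in> borel_measurable B"
      using finite_kernel_nn_integral_measurable[OF q measurable_ident m] by simp
    then show "(\<lambda>b. emeasure (density (q b) ennreal) E) \<in> borel_measurable B"
    proof (rule measurable_congI)
      fix b assume b: "b \<in> space B"
      show "emeasure (density (q b) ennreal) E = (\<integral>\<^sup>+t. ennreal t * indicator E t \<partial>q b)"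
        using E finite_kernelD(1)[OF q b] by (intro emeasure_density[OF i'[OF b]]) simp
    qed
  qed
qed

text \<open>
  The weight \<open>t\<close> is itself multiplicative, so weighting a mixture amounts to weighting both the
  base measure and the kernel. This reduces weight \<open>t\<close> to weight 1.
\<close>

lemma density_mult_mixture:
  assumes s: "sets \<nu> = sets (B \<Otimes>\<^sub>M rpos)" and q: "finite_kernel B rpos q"
    and mtri: "\<And>b. b \<in> space B \<Longrightarrow> q b \<in> mtri"
  shows "density (mixture \<nu> (mult_kernel q) rpos) ennreal =
    mixture (density \<nu> (\<lambda>z. ennreal (snd z))) (mult_kernel (\<lambda>b. density (q b) ennreal)) rpos"
proof (rule measure_eqI)
  note m = base_measurable[OF s] and wq = weighted_finite_kernel[OF q mtri]
  have i: "ennreal \<in> borel_measurable rpos" by (rule measurable_compose[OF id_rpos_borel measurable_ennreal])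
  have i\<nu>: "(\<lambda>z. ennreal (snd z)) \<in> borel_measurable \<nu>" by (rule measurable_compose[OF m(2) i])
  have sd: "sets (density \<nu> (\<lambda>z. ennreal (snd z))) = sets (B \<Otimes>\<^sub>M rpos)" using s by simp
  have k: "finite_kernel \<nu> rpos (mult_kernel q)" by (rule mult_kernel_finite_kernel[OF s q])
  have kw: "finite_kernel (density \<nu> (\<lambda>z. ennreal (snd z))) rpos (mult_kernel (\<lambda>b. density (q b) ennreal))"
    by (rule mult_kernel_finite_kernel[OF sd wq(1)])
  have kw\<nu>: "finite_kernel \<nu> rpos (mult_kernel (\<lambda>b. density (q b) ennreal))"
    by (rule mult_kernel_finite_kernel[OF s wq(1)])
  show "sets (density (mixture \<nu> (mult_kernel q) rpos) ennreal) =
    sets (mixture (density \<nu> (\<lambda>z. ennreal (snd z))) (mult_kernel (\<lambda>b. density (q b) ennreal)) rpos)" by simp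
  fix E assume "E \<in> sets (density (mixture \<nu> (mult_kernel q) rpos) ennreal)"
  then have E: "E \<in> sets rpos" by simp
  have iE: "(\<lambda>t. ennreal t * indicator E t) \<in> borel_measurable rpos"
    using E i by (intro borel_measurable_times_ennreal borel_measurable_indicator)
  have im: "ennreal \<in> borel_measurable (mixture \<nu> (mult_kernel q) rpos)"
    using i by (simp add: measurable_cong_sets[OF sets_mixture refl])
  have "emeasure (density (mixture \<nu> (mult_kernel q) rpos) ennreal) E =
    (\<integral>\<^sup>+t. ennreal t * indicator E t \<partial>mixture \<nu> (mult_kernel q) rpos)"
    using E by (intro emeasure_density[OF im]) simp
  also have "\<dots> = (\<integral>\<^sup>+z. \<integral>\<^sup>+t. ennreal t * indicator E t \<partial>mult_kernel q z \<partial>\<nu>)"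
    by (rule nn_integral_mixture[OF k iE])
  also have "\<dots> = (\<integral>\<^sup>+z. ennreal (snd z) * emeasure (mult_kernel (\<lambda>b. density (q b) ennreal) z) E \<partial>\<nu>)"
  proof (rule nn_integral_cong)
    fix z assume "z \<in> space \<nu>"
    then have z: "fst z \<in> space B" "snd z > 0" unfolding m(3) by auto
    note f = finite_kernelD[OF q]
    have mm: "(\<lambda>u. snd z * u) \<in> q (fst z) \<rightarrow>\<^sub>M rpos" by (rule mult_measurable[OF f(1)[OF z(1)] z(2)])
    have iq: "ennreal \<in> borel_measurable (q (fst z))"
      using i by (simp add: measurable_cong_sets[OF f(1)[OF z(1)] refl])
    have V: "(\<lambda>u. snd z * u) -` E \<inter> space (q (fst z)) \<in> sets (q (fst z))" by (rule measurable_sets[OF mm E])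
    have "(\<integral>\<^sup>+t. ennreal t * indicator E t \<partial>mult_kernel q z) = (\<integral>\<^sup>+u. ennreal (snd z * u) * indicator E (snd z * u) \<partial>q (fst z))"
      unfolding mult_kernel_def by (subst nn_integral_distr[OF mm]) (simp_all add: iE)
    also have "\<dots> = (\<integral>\<^sup>+u. ennreal (snd z) * (ennreal u * indicator ((\<lambda>u. snd z * u) -` E \<inter> space (q (fst z))) u) \<partial>q (fst z))"
      using z(2) by (intro nn_integral_cong) (simp add: ennreal_mult' mult.assoc indicator_def)
    also have "\<dots> = ennreal (snd z) * (\<integral>\<^sup>+u. ennreal u * indicator ((\<lambda>u. snd z * u) -` E \<inter> space (q (fst z))) u \<partial>q (fst z))"
      by (intro nn_integral_cmult borel_measurable_times_ennreal iq borel_measurable_indicator V)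
    also have "(\<integral>\<^sup>+u. ennreal u * indicator ((\<lambda>u. snd z * u) -` E \<inter> space (q (fst z))) u \<partial>q (fst z)) =
        emeasure (density (q (fst z)) ennreal) ((\<lambda>u. snd z * u) -` E \<inter> space (q (fst z)))"
      by (rule emeasure_density[OF iq V, symmetric])
    also have "\<dots> = emeasure (mult_kernel (\<lambda>b. density (q b) ennreal) z) E"
      unfolding mult_kernel_def using mm E by (subst emeasure_distr) simp_all
    finally show "(\<integral>\<^sup>+t. ennreal t * indicator E t \<partial>mult_kernel q z) = ennreal (snd z) * emeasure (mult_kernel (\<lambda>b. density (q b) ennreal) z) E" .
  qed
  also have "\<dots> = (\<integral>\<^sup>+z. emeasure (mult_kernel (\<lambda>b. density (q b) ennreal) z) E \<partial>density \<nu> (\<lambda>z. ennreal (snd z)))"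
    by (rule nn_integral_density[OF i\<nu> finite_kernelD(4)[OF kw\<nu> E], symmetric])
  also have "\<dots> = emeasure (mixture (density \<nu> (\<lambda>z. ennreal (snd z))) (mult_kernel (\<lambda>b. density (q b) ennreal)) rpos) E"
    by (rule emeasure_mixture[OF kw E, symmetric])
  finally show "emeasure (density (mixture \<nu> (mult_kernel q) rpos) ennreal) E =
    emeasure (mixture (density \<nu> (\<lambda>z. ennreal (snd z))) (mult_kernel (\<lambda>b. density (q b) ennreal)) rpos) E" .
qed

lemma integral_weighted:
  fixes f :: "real \<Rightarrow> real"
  assumes s: "sets \<mu> = sets rpos" and f: "continuous_on {0<..} f"
  shows "(\<integral>t. f t \<partial>density \<mu> ennreal) = (\<integral>t. t * f t \<partial>\<mu>)"
proof -
  have "f \<in> borel_measurable \<mu>" "(\<lambda>t. t) \<in> borel_measurable \<mu>"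
    using continuous_rpos_measurable[OF f] id_rpos_borel by (simp_all add: measurable_cong_sets[OF s refl])
  moreover have "AE t in \<mu>. 0 \<le> t"
    using sets_eq_imp_space_eq[OF s] by (intro AE_I2) simp
  ultimately have "(\<integral>t. f t \<partial>density \<mu> (\<lambda>t. ennreal t)) = (\<integral>t. t *\<^sub>R f t \<partial>\<mu>)"
    by (rule integral_density)
  then show ?thesis by simp
qed

text \<open>
  Convergence in \<^const>\<open>mtri\<close> is weak convergence of the measures and of their weighted versions. The two
  alternatives are independent of each other: for a varying source polymorphism the first one holds
  through the kernel and the second through the marginals, for a varying target polymorphism the
  other way round.
\<close>

lemma mtri_tendsto_mult_mixture:
  assumes B: "finite_measure B"
    and conv: "fibre_tendsto B \<nu>j \<nu>"
    and convw: "fibre_tendsto B (\<lambda>j. density (\<nu>j j) (\<lambda>z. ennreal (snd z))) (density \<nu> (\<lambda>z. ennreal (snd z)))"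
    and q: "finite_kernel B rpos q" and mtri: "\<And>b. b \<in> space B \<Longrightarrow> q b \<in> mtri"
    and mass: "(\<integral>\<^sup>+b. emeasure (q b) {0<..} \<partial>B) < \<infinity>" "(\<integral>\<^sup>+b. (\<integral>\<^sup>+t. ennreal t \<partial>q b) \<partial>B) < \<infinity>"
    and dom: "(\<forall>b\<in>space B. emeasure (q b) {0<..} \<le> 1) \<or>
      ((\<forall>j. base_marginal_le B (\<nu>j j)) \<and> base_marginal_le B \<nu>)"
    and domw: "(\<forall>b\<in>space B. (\<integral>\<^sup>+t. ennreal t \<partial>q b) \<le> 1) \<or>
      ((\<forall>j. base_marginal_le B (density (\<nu>j j) (\<lambda>z. ennreal (snd z)))) \<and> base_marginal_le B (density \<nu> (\<lambda>z. ennreal (snd z))))"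
    and \<mu>: "\<And>j. \<mu>j j \<in> mtri" "\<mu> \<in> mtri"
    and \<mu>_eq: "\<And>j E. E \<in> sets rpos \<Longrightarrow> emeasure (\<mu>j j) E = (\<integral>\<^sup>+z. emeasure (mult_kernel q z) E \<partial>\<nu>j j)"
      "\<And>E. E \<in> sets rpos \<Longrightarrow> emeasure \<mu> E = (\<integral>\<^sup>+z. emeasure (mult_kernel q z) E \<partial>\<nu>)"
  shows "mtri_tendsto \<mu>j \<mu>"
proof -
  have cs: "\<And>j. sets (\<nu>j j) = sets (B \<Otimes>\<^sub>M rpos)" "sets \<nu> = sets (B \<Otimes>\<^sub>M rpos)"
    using conv by (auto simp: fibre_tendsto_def)
  note k = mult_kernel_finite_kernel[OF cs(1) q] mult_kernel_finite_kernel[OF cs(2) q]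
  have mj: "\<mu>j j = mixture (\<nu>j j) (mult_kernel q) rpos" for j
    by (rule measure_eqI) (simp_all add: mtriD(1)[OF \<mu>(1)] \<mu>_eq(1) emeasure_mixture[OF k(1)])
  have m: "\<mu> = mixture \<nu> (mult_kernel q) rpos"
    by (rule measure_eqI) (simp_all add: mtriD(1)[OF \<mu>(2)] \<mu>_eq(2) emeasure_mixture[OF k(2)])
  note wq = weighted_finite_kernel[OF q mtri]
  have massw: "(\<integral>\<^sup>+b. emeasure (density (q b) ennreal) {0<..} \<partial>B) < \<infinity>"
    using mass(2) wq(2) by (simp cong: nn_integral_cong)
  have domw': "(\<forall>b\<in>space B. emeasure (density (q b) ennreal) {0<..} \<le> 1) \<or>
      ((\<forall>j. base_marginal_le B (density (\<nu>j j) (\<lambda>z. ennreal (snd z)))) \<and> base_marginal_le B (density \<nu> (\<lambda>z. ennreal (snd z))))"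
    using domw wq(2) by auto
  have dens: "density (mixture (\<nu>j j) (mult_kernel q) rpos) ennreal =
      mixture (density (\<nu>j j) (\<lambda>z. ennreal (snd z))) (mult_kernel (\<lambda>b. density (q b) ennreal)) rpos"
    "density (mixture \<nu> (mult_kernel q) rpos) ennreal =
      mixture (density \<nu> (\<lambda>z. ennreal (snd z))) (mult_kernel (\<lambda>b. density (q b) ennreal)) rpos" for j
    by (rule density_mult_mixture[OF cs(1) q mtri] density_mult_mixture[OF cs(2) q mtri]; assumption)+
  show ?thesis
    unfolding mtri_tendsto_def
  proof (intro conjI allI impI \<mu>)
    fix f :: "real \<Rightarrow> real" assume f: "continuous_on {0<..} f \<and> bounded (f ` {0<..})"
    then have f': "continuous_on {0<..} f" "bounded (f ` {0<..})" by auto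
    show "(\<lambda>j. \<integral>t. f t \<partial>\<mu>j j) \<longlonglongrightarrow> (\<integral>t. f t \<partial>\<mu>)"
      unfolding mj m by (rule fibre_tendsto_mult_mixture[OF B conv q mass(1) dom f'])
    have "(\<lambda>j. \<integral>t. f t \<partial>density (\<mu>j j) ennreal) \<longlonglongrightarrow> (\<integral>t. f t \<partial>density \<mu> ennreal)"
      unfolding mj m dens
      by (rule fibre_tendsto_mult_mixture[OF B convw wq(1) massw domw' f'])
    then show "(\<lambda>j. \<integral>t. t * f t \<partial>\<mu>j j) \<longlonglongrightarrow> (\<integral>t. t * f t \<partial>\<mu>)"
      unfolding integral_weighted[OF mtriD(1)[OF \<mu>(1)] f'(1)] integral_weighted[OF mtriD(1)[OF \<mu>(2)] f'(1)] .
  qed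
qed

section \<open>Separate continuity of the product\<close>

lemma block_integral:
  fixes h :: "real \<Rightarrow> real"
  assumes s: "sets \<nu> = sets (B \<Otimes>\<^sub>M rpos)" and s\<mu>: "sets \<mu> = sets rpos" and N: "N \<in> sets B"
    and eq: "\<And>E. E \<in> sets rpos \<Longrightarrow> emeasure \<mu> E = emeasure \<nu> (N \<times> E)"
    and h: "h \<in> borel_measurable rpos"
  shows "(\<integral>z. indicator N (fst z) * h (snd z) \<partial>\<nu>) = (\<integral>t. h t \<partial>\<mu>)"
proof -
  note m = base_measurable[OF s]
  have i: "(\<lambda>z. indicator N (fst z) :: real) \<in> borel_measurable \<nu>"
    using N by (intro measurable_compose[OF m(1) borel_measurable_indicator])
  let ?d = "density \<nu> (\<lambda>z. ennreal (indicator N (fst z)))"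
  have "\<mu> = distr ?d rpos snd"
  proof (rule measure_eqI)
    fix E assume "E \<in> sets \<mu>"
    then have E: "E \<in> sets rpos" by (simp add: s\<mu>)
    have V: "snd -` E \<inter> space \<nu> \<in> sets \<nu>" by (rule measurable_sets[OF m(2) E])
    have NE: "N \<times> E \<in> sets \<nu>" using pair_measureI[OF N E] by (simp add: s)
    have "emeasure (distr ?d rpos snd) E = emeasure ?d (snd -` E \<inter> space \<nu>)"
      using m(2) E by (subst emeasure_distr) simp_all
    also have "\<dots> = (\<integral>\<^sup>+z. ennreal (indicator N (fst z)) * indicator (snd -` E \<inter> space \<nu>) z \<partial>\<nu>)"
      using i V by (intro emeasure_density) simp_all
    also have "\<dots> = (\<integral>\<^sup>+z. indicator (N \<times> E) z \<partial>\<nu>)"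
    proof (rule nn_integral_cong)
      fix z assume "z \<in> space \<nu>"
      then show "ennreal (indicator N (fst z)) * indicator (snd -` E \<inter> space \<nu>) z = (indicator (N \<times> E) z :: ennreal)"
        by (cases z) (simp add: indicator_def)
    qed
    also have "\<dots> = emeasure \<nu> (N \<times> E)" using NE by simp
    finally show "emeasure \<mu> E = emeasure (distr ?d rpos snd) E" using eq[OF E] by simp
  qed (simp add: s\<mu>)
  then have "(\<integral>t. h t \<partial>\<mu>) = (\<integral>z. h (snd z) \<partial>?d)"
    using m(2) h by (simp add: integral_distr)
  also have "\<dots> = (\<integral>z. indicator N (fst z) *\<^sub>R h (snd z) \<partial>\<nu>)"
    by (rule integral_density[OF measurable_compose[OF m(2) h] i]) simp
  finally show ?thesis by simp
qed

lemma fibre_tendsto_of_blocks: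
  assumes s: "\<And>j. sets (\<nu>j j) = sets (B \<Otimes>\<^sub>M rpos)" "sets \<nu> = sets (B \<Otimes>\<^sub>M rpos)"
    and fin: "\<And>j. finite_measure (\<nu>j j)" "finite_measure \<nu>"
    and mom: "\<And>j. (\<integral>\<^sup>+z. ennreal (snd z) \<partial>\<nu>j j) < \<infinity>" "(\<integral>\<^sup>+z. ennreal (snd z) \<partial>\<nu>) < \<infinity>"
    and blocks: "\<And>N. N \<in> sets B \<Longrightarrow> mtri_tendsto (\<lambda>j. \<beta>j j N) (\<beta> N)"
    and eq: "\<And>j N E. N \<in> sets B \<Longrightarrow> E \<in> sets rpos \<Longrightarrow> emeasure (\<beta>j j N) E = emeasure (\<nu>j j) (N \<times> E)"
      "\<And>N E. N \<in> sets B \<Longrightarrow> E \<in> sets rpos \<Longrightarrow> emeasure (\<beta> N) E = emeasure \<nu> (N \<times> E)"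
  shows "fibre_tendsto B \<nu>j \<nu>"
    and "fibre_tendsto B (\<lambda>j. density (\<nu>j j) (\<lambda>z. ennreal (snd z))) (density \<nu> (\<lambda>z. ennreal (snd z)))"
proof -
  have s\<beta>: "sets (\<beta>j j N) = sets rpos" "sets (\<beta> N) = sets rpos" if "N \<in> sets B" for j N
    using blocks[OF that] by (auto simp: mtri_tendsto_def mtri_def)
  show "fibre_tendsto B \<nu>j \<nu>"
    unfolding fibre_tendsto_def
  proof (intro conjI ballI allI impI s fin)
    fix N and h :: "real \<Rightarrow> real"
    assume N: "N \<in> sets B" and h: "continuous_on {0<..} h \<and> bounded (h ` {0<..})"
    have hm: "h \<in> borel_measurable rpos" using h by (intro continuous_rpos_measurable) blast
    have "(\<integral>z. indicator N (fst z) * h (snd z) \<partial>\<nu>j j) = (\<integral>t. h t \<partial>\<beta>j j N)" for j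
      by (rule block_integral[OF s(1) s\<beta>(1)[OF N] N eq(1)[OF N] hm])
    moreover have "(\<integral>z. indicator N (fst z) * h (snd z) \<partial>\<nu>) = (\<integral>t. h t \<partial>\<beta> N)"
      by (rule block_integral[OF s(2) s\<beta>(2)[OF N] N eq(2)[OF N] hm])
    ultimately show "(\<lambda>j. \<integral>z. indicator N (fst z) * h (snd z) \<partial>\<nu>j j) \<longlonglongrightarrow> (\<integral>z. indicator N (fst z) * h (snd z) \<partial>\<nu>)"
      using blocks[OF N] h unfolding mtri_tendsto_def by simp
  qed
  have snd_m: "(snd :: _ \<Rightarrow> real) \<in> borel_measurable \<mu>" if "sets \<mu> = sets (B \<Otimes>\<^sub>M rpos)" for \<mu>
    by (rule rpos_measurable[OF base_measurable(2)[OF that]])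
  have wfin: "finite_measure (density \<mu> (\<lambda>z. ennreal (snd z)))"
    if "sets \<mu> = sets (B \<Otimes>\<^sub>M rpos)" "(\<integral>\<^sup>+z. ennreal (snd z) \<partial>\<mu>) < \<infinity>" for \<mu>
  proof
    have "emeasure (density \<mu> (\<lambda>z. ennreal (snd z))) (space \<mu>) = (\<integral>\<^sup>+z. ennreal (snd z) * indicator (space \<mu>) z \<partial>\<mu>)"
      using snd_m[OF that(1)] by (intro emeasure_density) simp_all
    also have "\<dots> = (\<integral>\<^sup>+z. ennreal (snd z) \<partial>\<mu>)" by (intro nn_integral_cong) simp
    finally show "emeasure (density \<mu> (\<lambda>z. ennreal (snd z))) (space (density \<mu> (\<lambda>z. ennreal (snd z)))) \<noteq> \<infinity>"
      using that(2) by simp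
  qed
  have wint: "(\<integral>z. indicator N (fst z) * h (snd z) \<partial>density \<mu> (\<lambda>z. ennreal (snd z))) =
      (\<integral>z. indicator N (fst z) * (snd z * h (snd z)) \<partial>\<mu>)"
    if \<mu>: "sets \<mu> = sets (B \<Otimes>\<^sub>M rpos)" and N: "N \<in> sets B" and hm: "h \<in> borel_measurable rpos" for \<mu> N and h :: "real \<Rightarrow> real"
  proof -
    note m = base_measurable[OF \<mu>]
    have f: "(\<lambda>z. indicator N (fst z) * h (snd z)) \<in> borel_measurable \<mu>"
      using N by (intro borel_measurable_times measurable_compose[OF m(1) borel_measurable_indicator] measurable_compose[OF m(2) hm])
    have "AE z in \<mu>. 0 \<le> snd z"
    proof (rule AE_I2)
      show "0 \<le> snd z" if "z \<in> space \<mu>" for z using that unfolding m(3) by auto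
    qed
    then have "(\<integral>z. indicator N (fst z) * h (snd z) \<partial>density \<mu> (\<lambda>z. ennreal (snd z))) =
      (\<integral>z. snd z *\<^sub>R (indicator N (fst z) * h (snd z)) \<partial>\<mu>)"
      by (rule integral_density[OF f snd_m[OF \<mu>]])
    then show ?thesis by (simp add: mult.left_commute)
  qed
  show "fibre_tendsto B (\<lambda>j. density (\<nu>j j) (\<lambda>z. ennreal (snd z))) (density \<nu> (\<lambda>z. ennreal (snd z)))"
    unfolding fibre_tendsto_def
  proof (intro conjI ballI allI impI wfin s mom)
    fix N and h :: "real \<Rightarrow> real"
    assume N: "N \<in> sets B" and h: "continuous_on {0<..} h \<and> bounded (h ` {0<..})"
    have hm: "h \<in> borel_measurable rpos" using h by (intro continuous_rpos_measurable) blast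
    have tm: "(\<lambda>t. t * h t) \<in> borel_measurable rpos" by (intro borel_measurable_times id_rpos_borel hm)
    have "(\<integral>z. indicator N (fst z) * h (snd z) \<partial>density (\<nu>j j) (\<lambda>z. ennreal (snd z))) = (\<integral>t. t * h t \<partial>\<beta>j j N)" for j
      unfolding wint[OF s(1) N hm] by (rule block_integral[OF s(1) s\<beta>(1)[OF N] N eq(1)[OF N] tm])
    moreover have "(\<integral>z. indicator N (fst z) * h (snd z) \<partial>density \<nu> (\<lambda>z. ennreal (snd z))) = (\<integral>t. t * h t \<partial>\<beta> N)"
      unfolding wint[OF s(2) N hm] by (rule block_integral[OF s(2) s\<beta>(2)[OF N] N eq(2)[OF N] tm])
    ultimately show "(\<lambda>j. \<integral>z. indicator N (fst z) * h (snd z) \<partial>density (\<nu>j j) (\<lambda>z. ennreal (snd z))) \<longlonglongrightarrow>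
        (\<integral>z. indicator N (fst z) * h (snd z) \<partial>density \<nu> (\<lambda>z. ennreal (snd z)))"
      using blocks[OF N] h unfolding mtri_tendsto_def by simp
  qed (simp_all add: s)
qed

text \<open>
  A bound that holds almost everywhere is made to hold everywhere by replacing the exceptional
  measures by zero, which does not change the disintegrated measure. The functional \<open>\<phi>\<close> is the mass or
  the first moment.
\<close>

lemma kernel_bound_everywhere:
  assumes q: "finite_kernel B rpos q" and mtri: "\<And>b. b \<in> space B \<Longrightarrow> q b \<in> mtri"
    and eq: "\<And>N E. N \<in> sets B \<Longrightarrow> E \<in> sets rpos \<Longrightarrow> m N E = (\<integral>\<^sup>+b\<in>N. emeasure (q b) E \<partial>B)"
    and meas: "(\<lambda>b. \<phi> (q b)) \<in> borel_measurable B" and AE: "AE b in B. \<phi> (q b) \<le> (1::ennreal)"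
    and null: "\<phi> (null_measure rpos) = 0"
  obtains q' where "finite_kernel B rpos q'" "\<And>b. b \<in> space B \<Longrightarrow> q' b \<in> mtri"
    "\<And>N E. N \<in> sets B \<Longrightarrow> E \<in> sets rpos \<Longrightarrow> m N E = (\<integral>\<^sup>+b\<in>N. emeasure (q' b) E \<partial>B)"
    "\<And>b. b \<in> space B \<Longrightarrow> \<phi> (q' b) \<le> 1"
proof -
  define q' where "q' b = (if \<phi> (q b) \<le> 1 then q b else null_measure rpos)" for b
  have nm: "null_measure rpos \<in> mtri" by (auto simp: mtri_def)
  show thesis
  proof (rule that)
    show mq': "q' b \<in> mtri" if "b \<in> space B" for b using mtri[OF that] nm by (simp add: q'_def)
    show "\<phi> (q' b) \<le> 1" if "b \<in> space B" for b using null by (simp add: q'_def)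
    show "finite_kernel B rpos q'"
      unfolding finite_kernel_def
    proof (intro conjI ballI)
      show "sets (q' b) = sets rpos" "finite_measure (q' b)" if "b \<in> space B" for b
        using mtriD[OF mq'[OF that]] by auto
      fix E assume "E \<in> sets rpos"
      from finite_kernelD(4)[OF q this] meas
      have "(\<lambda>b. if \<phi> (q b) \<le> 1 then emeasure (q b) E else 0) \<in> borel_measurable B" by measurable
      then show "(\<lambda>b. emeasure (q' b) E) \<in> borel_measurable B"
        by (rule measurable_congI) (simp add: q'_def)
    qed
    fix N E assume "N \<in> sets B" "E \<in> sets rpos"
    then have "m N E = (\<integral>\<^sup>+b\<in>N. emeasure (q b) E \<partial>B)" by (rule eq)
    also have "\<dots> = (\<integral>\<^sup>+b\<in>N. emeasure (q' b) E \<partial>B)"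
    proof (rule nn_integral_cong_AE)
      show "AE b in B. emeasure (q b) E * indicator N b = emeasure (q' b) E * indicator N b"
        using AE by eventually_elim (simp add: q'_def)
    qed
    finally show "m N E = (\<integral>\<^sup>+b\<in>N. emeasure (q' b) E \<partial>B)" .
  qed
qed

lemma kernel_moments_finite:
  assumes q: "finite_kernel B rpos q" and s: "sets \<nu> = sets (B \<Otimes>\<^sub>M rpos)" and fin: "finite_measure \<nu>"
    and mom: "(\<integral>\<^sup>+z. ennreal (snd z) \<partial>\<nu>) < \<infinity>"
    and eq: "\<And>N E. N \<in> sets B \<Longrightarrow> E \<in> sets rpos \<Longrightarrow> emeasure \<nu> (N \<times> E) = (\<integral>\<^sup>+b\<in>N. emeasure (q b) E \<partial>B)"
  shows "(\<integral>\<^sup>+b. emeasure (q b) {0<..} \<partial>B) < \<infinity>" "(\<integral>\<^sup>+b. (\<integral>\<^sup>+t. ennreal t \<partial>q b) \<partial>B) < \<infinity>"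
proof -
  have "(\<integral>\<^sup>+b. emeasure (q b) {0<..} \<partial>B) = (\<integral>\<^sup>+b\<in>space B. emeasure (q b) {0<..} \<partial>B)"
    by (intro nn_integral_cong) simp
  also have "\<dots> = emeasure \<nu> (space B \<times> {0<..})" using eq[OF sets.top sets.top] by simp
  also have "\<dots> < \<infinity>" using finite_measure.emeasure_finite[OF fin] by (simp add: less_top)
  finally show "(\<integral>\<^sup>+b. emeasure (q b) {0<..} \<partial>B) < \<infinity>" .
  have "(\<integral>\<^sup>+b. (\<integral>\<^sup>+t. ennreal t \<partial>q b) \<partial>B) = (\<integral>\<^sup>+b\<in>space B. (\<integral>\<^sup>+t. ennreal t \<partial>q b) \<partial>B)"
    by (intro nn_integral_cong) simp
  also have "\<dots> = (\<integral>\<^sup>+z. ennreal (snd z) * indicator (space B) (fst z) \<partial>\<nu>)"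
    by (rule first_moment_disintegration[OF q s fin _ sets.top]) (rule eq)
  also have "\<dots> \<le> (\<integral>\<^sup>+z. ennreal (snd z) \<partial>\<nu>)"
    by (intro nn_integral_mono) (simp add: indicator_def)
  also have "\<dots> < \<infinity>" by (rule mom)
  finally show "(\<integral>\<^sup>+b. (\<integral>\<^sup>+t. ennreal t \<partial>q b) \<partial>B) < \<infinity>" .
qed

lemma pol_block_mtri:
  assumes P: "P \<in> Pol A B" and A: "finite_measure A" and B: "finite_measure B" and M: "M \<in> sets A" and N: "N \<in> sets B"
  shows "pol_block P M N \<in> mtri"
proof (rule mtriI)
  note s = PolD(1)[OF P]
  have sp: "space (pol_block P M N) = {0<..}" using sets_eq_imp_space_eq[OF sets_pol_block] by simp
  show "finite_measure (pol_block P M N)"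
    using emeasure_pol_block[OF s M N sets.top] finite_measure.emeasure_finite[OF Pol_finite[OF P A]] sp
    by (intro finite_measureI) simp
  have im: "ennreal \<in> borel_measurable rpos" by (rule measurable_compose[OF id_rpos_borel measurable_ennreal])
  have "(\<integral>\<^sup>+t. ennreal t \<partial>pol_block P M N) = (\<integral>\<^sup>+z. ennreal (snd (snd z)) * indicator (M \<times> N \<times> {0<..}) z \<partial>P)"
    by (rule nn_integral_pol_block[OF s M N im])
  also have "\<dots> \<le> (\<integral>\<^sup>+z. ennreal (snd (snd z)) * indicator N (fst (snd z)) \<partial>P)"
    by (intro nn_integral_mono mult_left_mono) (auto simp: indicator_def)
  also have "\<dots> < \<infinity>"
    using Pol_target_marginal[OF P N] finite_measure.emeasure_finite[OF B] by (simp add: less_top)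
  finally show "(\<integral>\<^sup>+t. ennreal t \<partial>pol_block P M N) < \<infinity>" .
qed simp

text \<open>
  Together with \<open>target_fibre_marginal\<close> this provides the uniform domination that allows truncation:
  the weighted measure is controlled for source fibres, the unweighted one for target fibres.
\<close>

lemma source_fibre_weighted_marginal:
  assumes P: "P \<in> Pol A B" and M: "M \<in> sets A"
  shows "base_marginal_le B (density (source_fibre B P M) (\<lambda>z. ennreal (snd z)))"
  unfolding base_marginal_le_def
proof
  fix N assume N: "N \<in> sets B"
  note s = PolD(1)[OF P]
  have tm: "(\<lambda>z. ennreal (snd z)) \<in> borel_measurable (B \<Otimes>\<^sub>M rpos)"
    by (rule measurable_compose[OF snd_rpos_borel measurable_ennreal])
  have S: "N \<times> {0<..} \<in> sets (B \<Otimes>\<^sub>M rpos)" using pair_measureI[OF N sets.top[of rpos]] by simp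
  have m: "(\<lambda>z. ennreal (snd z) * indicator (N \<times> {0<..}) z) \<in> borel_measurable (B \<Otimes>\<^sub>M rpos)"
    by (intro borel_measurable_times_ennreal tm borel_measurable_indicator S)
  have "emeasure (density (source_fibre B P M) (\<lambda>z. ennreal (snd z))) (N \<times> {0<..}) =
    (\<integral>\<^sup>+z. ennreal (snd z) * indicator (N \<times> {0<..}) z \<partial>source_fibre B P M)"
    using tm S by (intro emeasure_density) (simp_all add: measurable_cong_sets[OF sets_fibre(1) refl])
  also have "\<dots> = (\<integral>\<^sup>+z. (ennreal (snd (snd z)) * indicator (N \<times> {0<..}) (snd z)) * indicator M (fst z) \<partial>P)"
    by (rule nn_integral_source_fibre[OF s M m])
  also have "\<dots> \<le> (\<integral>\<^sup>+z. ennreal (snd (snd z)) * indicator N (fst (snd z)) \<partial>P)"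
  proof (rule nn_integral_mono)
    show "(ennreal (snd (snd z)) * indicator (N \<times> {0<..}) (snd z)) * indicator M (fst z) \<le> ennreal (snd (snd z)) * indicator N (fst (snd z))" for z
      by (cases z) (simp add: indicator_def)
  qed
  finally show "emeasure (density (source_fibre B P M) (\<lambda>z. ennreal (snd z))) (N \<times> {0<..}) \<le> emeasure B N"
    unfolding Pol_target_marginal[OF P N] .
qed

lemma target_fibre_marginal:
  assumes Q: "Q \<in> Pol B C" and K: "K \<in> sets C"
  shows "base_marginal_le B (target_fibre B Q K)"
  unfolding base_marginal_le_def
proof
  fix N assume N: "N \<in> sets B"
  note s = PolD(1)[OF Q]
  have "emeasure (target_fibre B Q K) (N \<times> {0<..}) = emeasure Q (N \<times> K \<times> {0<..})"
    using emeasure_target_fibre[OF s N K sets.top] by simp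
  also have "\<dots> \<le> emeasure Q (N \<times> space C \<times> {0<..})"
    using sets.sets_into_space[OF K] triple_sets[OF s N sets.top sets.top] by (intro emeasure_mono) auto
  finally show "emeasure (target_fibre B Q K) (N \<times> {0<..}) \<le> emeasure B N"
    unfolding Pol_source_marginal[OF Q N] .
qed

lemma pol_product_block_source:
  assumes L: "lebesgue_space A" "lebesgue_space B" "lebesgue_space C" and P: "P \<in> Pol A B" and Q: "Q \<in> Pol B C"
    and M: "M \<in> sets A" and K: "K \<in> sets C" and E: "E \<in> sets rpos"
    and q: "finite_kernel B rpos q" "\<And>b. b \<in> space B \<Longrightarrow> q b \<in> mtri"
      "\<And>N E. N \<in> sets B \<Longrightarrow> E \<in> sets rpos \<Longrightarrow> emeasure (target_fibre B Q K) (N \<times> E) = (\<integral>\<^sup>+b\<in>N. emeasure (q b) E \<partial>B)"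
  shows "emeasure (pol_block (pol_product A B C Q P) M K) E = (\<integral>\<^sup>+z. emeasure (mult_kernel q z) E \<partial>source_fibre B P M)"
proof -
  note fA = lebesgue_space_finite[OF L(1)] and fB = lebesgue_space_finite[OF L(2)]
  obtain p where p: "finite_kernel B rpos p" "\<And>b. b \<in> space B \<Longrightarrow> p b \<in> mtri"
    "\<And>N E. N \<in> sets B \<Longrightarrow> E \<in> sets rpos \<Longrightarrow> emeasure (source_fibre B P M) (N \<times> E) = (\<integral>\<^sup>+b\<in>N. emeasure (p b) E \<partial>B)"
    "\<And>N. N \<in> sets B \<Longrightarrow> is_measure_integral B N p (pol_block P M N)"
    by (rule source_disintegration[OF P fA fB M]) blast
  have qi: "is_measure_integral B N q (pol_block Q N K)" if N: "N \<in> sets B" for N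
  proof (rule is_measure_integralI[OF q(1,2)])
    fix E assume "E \<in> sets rpos"
    then show "emeasure (pol_block Q N K) E = (\<integral>\<^sup>+b\<in>N. emeasure (q b) E \<partial>B)"
      using q(3)[OF N] emeasure_pol_block[OF PolD(1)[OF Q] N K] emeasure_target_fibre[OF PolD(1)[OF Q] N K] by simp
  qed simp_all
  have "emeasure (pol_block (pol_product A B C Q P) M K) E = (\<integral>\<^sup>+b. emeasure (mult_convolution (q b) (p b)) E \<partial>B)"
    by (rule pol_block_pol_product[OF L P Q M K E p(4) qi])
  also have "\<dots> = (\<integral>\<^sup>+z. emeasure (mult_kernel q z) E \<partial>source_fibre B P M)"
    unfolding mult_kernel_def
    by (rule integral_mult_kernel_eq_convolution[OF p(1) q(1) sets_fibre(1) fibre_finite(1)[OF P fA M sets.top] p(3) E, symmetric])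
  finally show ?thesis .
qed

lemma pol_product_block_target:
  assumes L: "lebesgue_space A" "lebesgue_space B" "lebesgue_space C" and P: "P \<in> Pol A B" and Q: "Q \<in> Pol B C"
    and M: "M \<in> sets A" and K: "K \<in> sets C" and E: "E \<in> sets rpos"
    and p: "finite_kernel B rpos p" "\<And>b. b \<in> space B \<Longrightarrow> p b \<in> mtri"
      "\<And>N E. N \<in> sets B \<Longrightarrow> E \<in> sets rpos \<Longrightarrow> emeasure (source_fibre B P M) (N \<times> E) = (\<integral>\<^sup>+b\<in>N. emeasure (p b) E \<partial>B)"
  shows "emeasure (pol_block (pol_product A B C Q P) M K) E = (\<integral>\<^sup>+z. emeasure (mult_kernel p z) E \<partial>target_fibre B Q K)"
proof -
  note fB = lebesgue_space_finite[OF L(2)] and fC = lebesgue_space_finite[OF L(3)]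
  obtain q where q: "finite_kernel B rpos q" "\<And>b. b \<in> space B \<Longrightarrow> q b \<in> mtri"
    "\<And>N E. N \<in> sets B \<Longrightarrow> E \<in> sets rpos \<Longrightarrow> emeasure (target_fibre B Q K) (N \<times> E) = (\<integral>\<^sup>+b\<in>N. emeasure (q b) E \<partial>B)"
    "\<And>N. N \<in> sets B \<Longrightarrow> is_measure_integral B N q (pol_block Q N K)"
    by (rule target_disintegration[OF Q fB fC K]) blast
  have pi: "is_measure_integral B N p (pol_block P M N)" if N: "N \<in> sets B" for N
  proof (rule is_measure_integralI[OF p(1,2)])
    fix E assume "E \<in> sets rpos"
    then show "emeasure (pol_block P M N) E = (\<integral>\<^sup>+b\<in>N. emeasure (p b) E \<partial>B)"
      using p(3)[OF N] emeasure_pol_block[OF PolD(1)[OF P] M N] emeasure_source_fibre[OF PolD(1)[OF P] M N] by simp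
  qed simp_all
  have "emeasure (pol_block (pol_product A B C Q P) M K) E = (\<integral>\<^sup>+b. emeasure (mult_convolution (q b) (p b)) E \<partial>B)"
    by (rule pol_block_pol_product[OF L P Q M K E pi q(4)])
  also have "\<dots> = (\<integral>\<^sup>+b. emeasure (mult_convolution (p b) (q b)) E \<partial>B)"
    using finite_kernelD[OF p(1)] finite_kernelD[OF q(1)]
    by (intro nn_integral_cong arg_cong2[where f=emeasure] mult_convolution_commute refl) auto
  also have "\<dots> = (\<integral>\<^sup>+z. emeasure (mult_kernel p z) E \<partial>target_fibre B Q K)"
    unfolding mult_kernel_def
    by (rule integral_mult_kernel_eq_convolution[OF q(1) p(1) sets_fibre(2) fibre_finite(2)[OF Q fB sets.top K] q(3) E, symmetric])
  finally show ?thesis .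
qed

text \<open>
  The kernel comes from the fixed \<open>Q\<close>, with all masses at most 1; the varying fibre measures are those of
  the \<open>Pj j\<close>, whose weighted versions have marginals below \<open>B\<close>.
\<close>

lemma pol_product_continuous_first:
  assumes L: "lebesgue_space A" "lebesgue_space B" "lebesgue_space C"
    and conv: "pol_tendsto A B Pj P" and Q: "Q \<in> Pol B C"
  shows "pol_tendsto A C (\<lambda>j. pol_product A B C Q (Pj j)) (pol_product A B C Q P)"
proof -
  note fA = lebesgue_space_finite[OF L(1)] and fB = lebesgue_space_finite[OF L(2)] and fC = lebesgue_space_finite[OF L(3)]
  have Pj: "Pj j \<in> Pol A B" and P: "P \<in> Pol A B" for j using conv by (auto simp: pol_tendsto_def)
  note Rj = pol_product_Pol[OF L Pj Q] and R = pol_product_Pol[OF L P Q]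
  show ?thesis
    unfolding pol_tendsto_def
  proof (intro conjI allI ballI Rj R)
    fix M K assume M: "M \<in> sets A" and K: "K \<in> sets C"
    have E: "{0<..} \<in> sets rpos" using sets.top[of rpos] by simp
    obtain q0 where q0: "finite_kernel B rpos q0" "\<And>b. b \<in> space B \<Longrightarrow> q0 b \<in> mtri"
      "\<And>N E. N \<in> sets B \<Longrightarrow> E \<in> sets rpos \<Longrightarrow> emeasure (target_fibre B Q K) (N \<times> E) = (\<integral>\<^sup>+b\<in>N. emeasure (q0 b) E \<partial>B)"
      by (rule target_disintegration[OF Q fB fC K]) blast
    obtain q where q: "finite_kernel B rpos q" "\<And>b. b \<in> space B \<Longrightarrow> q b \<in> mtri"
      "\<And>N E. N \<in> sets B \<Longrightarrow> E \<in> sets rpos \<Longrightarrow> emeasure (target_fibre B Q K) (N \<times> E) = (\<integral>\<^sup>+b\<in>N. emeasure (q b) E \<partial>B)"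
      "\<And>b. b \<in> space B \<Longrightarrow> emeasure (q b) {0<..} \<le> 1"
    proof (rule kernel_bound_everywhere[OF q0, where \<phi>="\<lambda>\<mu>. emeasure \<mu> {0<..}"])
      show "(\<lambda>b. emeasure (q0 b) {0<..}) \<in> borel_measurable B" by (rule finite_kernelD(4)[OF q0(1) E])
      show "AE b in B. emeasure (q0 b) {0<..} \<le> 1"
        by (rule target_mass_le_1(1)[OF Q fB K q0(1)]) (rule q0(3))
    qed simp_all
    have bl: "mtri_tendsto (\<lambda>j. pol_block (Pj j) M N) (pol_block P M N)" if "N \<in> sets B" for N
      using conv M that by (auto simp: pol_tendsto_def)
    have eqj: "emeasure (pol_block (Pj j) M N) E = emeasure (source_fibre B (Pj j) M) (N \<times> E)"
      and eq: "emeasure (pol_block P M N) E = emeasure (source_fibre B P M) (N \<times> E)"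
      if "N \<in> sets B" "E \<in> sets rpos" for j N E
      using emeasure_source_fibre[OF PolD(1)[OF Pj] M that] emeasure_source_fibre[OF PolD(1)[OF P] M that] emeasure_pol_block[OF PolD(1)[OF Pj] M that] emeasure_pol_block[OF PolD(1)[OF P] M that] by simp_all
    note fj = fibre_finite(1)[OF Pj fA M sets.top] and fl = fibre_finite(1)[OF P fA M sets.top] and mj = fibre_moment_finite(1)[OF Pj fB M sets.top] and ml = fibre_moment_finite(1)[OF P fB M sets.top]
    have f: "fibre_tendsto B (\<lambda>j. source_fibre B (Pj j) M) (source_fibre B P M)"
      by (rule fibre_tendsto_of_blocks(1)[OF sets_fibre(1) sets_fibre(1) fj fl mj ml bl eqj eq]; assumption)
    have fw: "fibre_tendsto B (\<lambda>j. density (source_fibre B (Pj j) M) (\<lambda>z. ennreal (snd z))) (density (source_fibre B P M) (\<lambda>z. ennreal (snd z)))"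
      by (rule fibre_tendsto_of_blocks(2)[OF sets_fibre(1) sets_fibre(1) fj fl mj ml bl eqj eq]; assumption)
    note fin = kernel_moments_finite[OF q(1) sets_fibre(2) fibre_finite(2)[OF Q fB sets.top K] fibre_moment_finite(2)[OF Q fC sets.top K] q(3)]
    show "mtri_tendsto (\<lambda>j. pol_block (pol_product A B C Q (Pj j)) M K) (pol_block (pol_product A B C Q P) M K)"
    proof (rule mtri_tendsto_mult_mixture[OF fB f fw q(1,2) fin])
      show "(\<forall>b\<in>space B. emeasure (q b) {0<..} \<le> 1) \<or>
        (\<forall>j. base_marginal_le B (source_fibre B (Pj j) M)) \<and> base_marginal_le B (source_fibre B P M)"
        using q(4) by blast
      show "(\<forall>b\<in>space B. (\<integral>\<^sup>+t. ennreal t \<partial>q b) \<le> 1) \<or>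
        (\<forall>j. base_marginal_le B (density (source_fibre B (Pj j) M) (\<lambda>z. ennreal (snd z)))) \<and>
        base_marginal_le B (density (source_fibre B P M) (\<lambda>z. ennreal (snd z)))"
        using source_fibre_weighted_marginal[OF Pj M] source_fibre_weighted_marginal[OF P M] by blast
      show "pol_block (pol_product A B C Q (Pj j)) M K \<in> mtri" for j by (rule pol_block_mtri[OF Rj fA fC M K])
      show "pol_block (pol_product A B C Q P) M K \<in> mtri" by (rule pol_block_mtri[OF R fA fC M K])
      show "emeasure (pol_block (pol_product A B C Q (Pj j)) M K) E = (\<integral>\<^sup>+z. emeasure (mult_kernel q z) E \<partial>source_fibre B (Pj j) M)"
        if "E \<in> sets rpos" for j E by (rule pol_product_block_source[OF L Pj Q M K that q(1,2,3)])
      show "emeasure (pol_block (pol_product A B C Q P) M K) E = (\<integral>\<^sup>+z. emeasure (mult_kernel q z) E \<partial>source_fibre B P M)"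
        if "E \<in> sets rpos" for E by (rule pol_product_block_source[OF L P Q M K that q(1,2,3)])
    qed
  qed
qed

text \<open>
  The kernel comes from the fixed \<open>P\<close>, with all first moments at most 1; the varying fibre measures are
  those of the \<open>Qj j\<close>, whose marginals are below \<open>B\<close>.
\<close>

lemma pol_product_continuous_second:
  assumes L: "lebesgue_space A" "lebesgue_space B" "lebesgue_space C"
    and conv: "pol_tendsto B C Qj Q" and P: "P \<in> Pol A B"
  shows "pol_tendsto A C (\<lambda>j. pol_product A B C (Qj j) P) (pol_product A B C Q P)"
proof -
  note fA = lebesgue_space_finite[OF L(1)] and fB = lebesgue_space_finite[OF L(2)] and fC = lebesgue_space_finite[OF L(3)]
  have Qj: "Qj j \<in> Pol B C" and Q: "Q \<in> Pol B C" for j using conv by (auto simp: pol_tendsto_def)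
  note Rj = pol_product_Pol[OF L P Qj] and R = pol_product_Pol[OF L P Q]
  show ?thesis
    unfolding pol_tendsto_def
  proof (intro conjI allI ballI Rj R)
    fix M K assume M: "M \<in> sets A" and K: "K \<in> sets C"
    obtain p0 where p0: "finite_kernel B rpos p0" "\<And>b. b \<in> space B \<Longrightarrow> p0 b \<in> mtri"
      "\<And>N E. N \<in> sets B \<Longrightarrow> E \<in> sets rpos \<Longrightarrow> emeasure (source_fibre B P M) (N \<times> E) = (\<integral>\<^sup>+b\<in>N. emeasure (p0 b) E \<partial>B)"
      by (rule source_disintegration[OF P fA fB M]) blast
    obtain p where p: "finite_kernel B rpos p" "\<And>b. b \<in> space B \<Longrightarrow> p b \<in> mtri"
      "\<And>N E. N \<in> sets B \<Longrightarrow> E \<in> sets rpos \<Longrightarrow> emeasure (source_fibre B P M) (N \<times> E) = (\<integral>\<^sup>+b\<in>N. emeasure (p b) E \<partial>B)"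
      "\<And>b. b \<in> space B \<Longrightarrow> (\<integral>\<^sup>+t. ennreal t \<partial>p b) \<le> 1"
    proof (rule kernel_bound_everywhere[OF p0, where \<phi>="\<lambda>\<mu>. \<integral>\<^sup>+t. ennreal t \<partial>\<mu>"])
      show "(\<lambda>b. \<integral>\<^sup>+t. ennreal t \<partial>p0 b) \<in> borel_measurable B"
        using finite_kernel_nn_integral_measurable[OF p0(1) measurable_ident, of "\<lambda>z. ennreal (snd z)"]
          measurable_compose[OF snd_rpos_borel[of B] measurable_ennreal] by simp
      show "AE b in B. (\<integral>\<^sup>+t. ennreal t \<partial>p0 b) \<le> 1"
        by (rule source_moment_le_1(1)[OF P fA fB M p0(1)]) (rule p0(3))
    qed simp_all
    have bl: "mtri_tendsto (\<lambda>j. pol_block (Qj j) N K) (pol_block Q N K)" if "N \<in> sets B" for N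
      using conv K that by (auto simp: pol_tendsto_def)
    have eqj: "emeasure (pol_block (Qj j) N K) E = emeasure (target_fibre B (Qj j) K) (N \<times> E)"
      and eq: "emeasure (pol_block Q N K) E = emeasure (target_fibre B Q K) (N \<times> E)"
      if "N \<in> sets B" "E \<in> sets rpos" for j N E
      using emeasure_target_fibre[OF PolD(1)[OF Qj] that(1) K that(2)] emeasure_target_fibre[OF PolD(1)[OF Q] that(1) K that(2)] emeasure_pol_block[OF PolD(1)[OF Qj] that(1) K that(2)] emeasure_pol_block[OF PolD(1)[OF Q] that(1) K that(2)] by simp_all
    note fj = fibre_finite(2)[OF Qj fB sets.top K] and fl = fibre_finite(2)[OF Q fB sets.top K] and mj = fibre_moment_finite(2)[OF Qj fC sets.top K] and ml = fibre_moment_finite(2)[OF Q fC sets.top K]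
    have f: "fibre_tendsto B (\<lambda>j. target_fibre B (Qj j) K) (target_fibre B Q K)"
      by (rule fibre_tendsto_of_blocks(1)[OF sets_fibre(2) sets_fibre(2) fj fl mj ml bl eqj eq]; assumption)
    have fw: "fibre_tendsto B (\<lambda>j. density (target_fibre B (Qj j) K) (\<lambda>z. ennreal (snd z))) (density (target_fibre B Q K) (\<lambda>z. ennreal (snd z)))"
      by (rule fibre_tendsto_of_blocks(2)[OF sets_fibre(2) sets_fibre(2) fj fl mj ml bl eqj eq]; assumption)
    note fin = kernel_moments_finite[OF p(1) sets_fibre(1) fibre_finite(1)[OF P fA M sets.top] fibre_moment_finite(1)[OF P fB M sets.top] p(3)]
    show "mtri_tendsto (\<lambda>j. pol_block (pol_product A B C (Qj j) P) M K) (pol_block (pol_product A B C Q P) M K)"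
    proof (rule mtri_tendsto_mult_mixture[OF fB f fw p(1,2) fin])
      show "(\<forall>b\<in>space B. emeasure (p b) {0<..} \<le> 1) \<or>
        (\<forall>j. base_marginal_le B (target_fibre B (Qj j) K)) \<and> base_marginal_le B (target_fibre B Q K)"
        using target_fibre_marginal[OF Qj K] target_fibre_marginal[OF Q K] by blast
      show "(\<forall>b\<in>space B. (\<integral>\<^sup>+t. ennreal t \<partial>p b) \<le> 1) \<or>
        (\<forall>j. base_marginal_le B (density (target_fibre B (Qj j) K) (\<lambda>z. ennreal (snd z)))) \<and>
        base_marginal_le B (density (target_fibre B Q K) (\<lambda>z. ennreal (snd z)))"
        using p(4) by blast
      show "pol_block (pol_product A B C (Qj j) P) M K \<in> mtri" for j by (rule pol_block_mtri[OF Rj fA fC M K])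
      show "pol_block (pol_product A B C Q P) M K \<in> mtri" by (rule pol_block_mtri[OF R fA fC M K])
      show "emeasure (pol_block (pol_product A B C (Qj j) P) M K) E = (\<integral>\<^sup>+z. emeasure (mult_kernel p z) E \<partial>target_fibre B (Qj j) K)"
        if "E \<in> sets rpos" for j E by (rule pol_product_block_target[OF L P Qj M K that p(1,2,3)])
      show "emeasure (pol_block (pol_product A B C Q P) M K) E = (\<integral>\<^sup>+z. emeasure (mult_kernel p z) E \<partial>target_fibre B Q K)"
        if "E \<in> sets rpos" for E by (rule pol_product_block_target[OF L P Q M K that p(1,2,3)])
    qed
  qed
qed

theorem theorem5p9:
  fixes A :: "'a measure" and B :: "'b measure" and C :: "'c measure"
  assumes "lebesgue_space A" and "lebesgue_space B" and "lebesgue_space C"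
  shows "(\<forall>Pj P Q. pol_tendsto A B Pj P \<and> Q \<in> Pol B C \<longrightarrow>
            pol_tendsto A C (\<lambda>j. pol_product A B C Q (Pj j)) (pol_product A B C Q P)) \<and>
         (\<forall>Qj Q P. pol_tendsto B C Qj Q \<and> P \<in> Pol A B \<longrightarrow>
            pol_tendsto A C (\<lambda>j. pol_product A B C (Qj j) P) (pol_product A B C Q P))"
  using pol_product_continuous_first[OF assms] pol_product_continuous_second[OF assms] by blast

end
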